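(* Let $\Re(\mu)>0$, $\Re(\beta)>0$, $w\in\mathbb{C}\setminus\{0\}$, $1\le m\le q$, $0\le n\le p$ and $\Re(\beta)+\min_{1\le j\le m}\Re\left(\frac{\alpha b_j}{\beta_j}\right)>0$. Then $$\left(\mathcal{H}^{w;m,n;\alpha}_{a+;p,q;\beta}\,I^{\mu}_{a+}\phi\right)(x)=\left(\mathcal{H}^{w;m,n+1;\alpha}_{a+;p+1,q+1;\beta+\mu}\phi\right)(x),$$ where the $H$-function in the kernel of the operator on the right-hand side is $$H^{m,n+1}_{p+1,q+1}\left[w(x-t)^{\alpha}\left|\begin{array}{l}(1-\beta,\alpha),(a_j,\alpha_j)_{1,p}\\(b_j,\beta_j)_{1,q},(1-\beta-\mu,\alpha)\end{array}\right.\right].$$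
   Context: Throughout, $a\in\mathbb{R}$, $x>a$, $\alpha>0$, $\mu,\beta\in\mathbb{C}$; $(a_j,\alpha_j)_{1,p}$ stands for the list $(a_1,\alpha_1),\dots,(a_p,\alpha_p)$, with $a_j,b_j\in\mathbb{C}$ and $\alpha_j,\beta_j>0$. Fox $H$-function: for $z\neq0$, $$H^{m,n}_{p,q}[z]=H^{m,n}_{p,q}\left[z\left|\begin{array}{c}(a_j,\alpha_j)_{1,p}\\(b_j,\beta_j)_{1,q}\end{array}\right.\right]=\frac1{2\pi i}\int_L\varphi(\xi)z^{\xi}\,d\xi,\qquad \varphi(\xi)=\frac{\prod_{j=1}^m\Gamma(b_j-\beta_j\xi)\prod_{j=1}^n\Gamma(1-a_j+\alpha_j\xi)}{\prod_{j=m+1}^q\Gamma(1-b_j+\beta_j\xi)\prod_{j=n+1}^p\Gamma(a_j-\alpha_j\xi)},$$ where $L$ is a suitable contour (running from $-i\infty$ to $+i\infty$, or a loop) separating the poles of $\Gamma(b_j-\beta_j\xi)$, $j\le m$ (to its right), from those of $\Gamma(1-a_j+\alpha_j\xi)$, $j\le n$ (to its left); as usual these two sets of poles are assumed disjoint and the integral is assumed to converge absolutely. Operators: $$\left(\mathcal{H}^{w;m,n;\alpha}_{a+;p,q;\beta}\varphi\right)(x)=\int_a^x(x-t)^{\beta-1}H^{m,n}_{p,q}[w(x-t)^{\alpha}]\varphi(t)\,dt,\qquad (I^{\mu}_{a+}f)(x)=\frac1{\Gamma(\mu)}\int_a^x\frac{f(t)}{(x-t)^{1-\mu}}\,dt\quad(\Re(\mu)>0),$$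 where (unless other parameters are displayed) the $H$-function has parameters $(a_j,\alpha_j)_{1,p}$, $(b_j,\beta_j)_{1,q}$. The function $\phi$ is any complex-valued integrable function for which the integrals occurring on both sides, including the iterated ones, exist and converge absolutely.
   Formalization: Loops L from −∞ to −∞ around the left poles are excluded for both H-functions, since the identity fails for them (e.g. m=1, n=0, p=q=1, α_1>β_1: the left side vanishes, the right side does not); contours from −i∞ to +i∞ (within a vertical strip) and loops at +∞ are covered. *)

theory Defs
  imports "HOL-Analysis.Analysis"
begin

text \<open>
  The parameters \<open>(a\<^sub>j, \<alpha>\<^sub>j)\<close>, \<open>1 \<le> j \<le> p\<close>, and \<open>(b\<^sub>j, \<beta>\<^sub>j)\<close>, \<open>1 \<le> j \<le> q\<close>, of the
  \<open>H\<close>-function are lists \<open>as\<close> and \<open>bs\<close> of pairs, so that \<open>p = length as\<close> and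
  \<open>q = length bs\<close>; list positions start at \<open>0\<close>.
\<close>

text \<open>\<open>rGamma\<close> is the entire function \<open>1 / \<Gamma>\<close>, so it also covers the poles of the denominator.\<close>

definition fox_integrand ::
  "nat \<Rightarrow> nat \<Rightarrow> (complex \<times> real) list \<Rightarrow> (complex \<times> real) list \<Rightarrow> complex \<Rightarrow> complex" where
  "fox_integrand m n as bs \<xi> =
     (\<Prod>j<m. Gamma (fst (bs ! j) - of_real (snd (bs ! j)) * \<xi>)) *
     (\<Prod>j<n. Gamma (1 - fst (as ! j) + of_real (snd (as ! j)) * \<xi>)) *
     (\<Prod>j\<in>{m..<length bs}. rGamma (1 - fst (bs ! j) + of_real (snd (bs ! j)) * \<xi>)) *
     (\<Prod>j\<in>{n..<length as}. rGamma (fst (as ! j) - of_real (snd (as ! j)) * \<xi>))"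

text \<open>The poles of the two groups of Gamma functions in the numerator.\<close>

definition right_poles :: "nat \<Rightarrow> (complex \<times> real) list \<Rightarrow> complex set" where
  "right_poles m bs = {\<xi>. \<exists>j<m. fst (bs ! j) - of_real (snd (bs ! j)) * \<xi> \<in> \<int>\<^sub>\<le>\<^sub>0}"

definition left_poles :: "nat \<Rightarrow> (complex \<times> real) list \<Rightarrow> complex set" where
  "left_poles n as = {\<xi>. \<exists>j<n. 1 - fst (as ! j) + of_real (snd (as ! j)) * \<xi> \<in> \<int>\<^sub>\<le>\<^sub>0}"

text \<open>
  Contours are parametrised over the whole real line. There are three shapes: from \<open>-i\<infinity>\<close> to
  \<open>+i\<infinity>\<close> within a vertical strip; a loop from \<open>+\<infinity> + i \<phi>\<^sub>1\<close> to \<open>+\<infinity> + i \<phi>\<^sub>2\<close>; a loop from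
  \<open>-\<infinity> + i \<phi>\<^sub>1\<close> to \<open>-\<infinity> + i \<phi>\<^sub>2\<close>, where \<open>\<phi>\<^sub>1 < \<phi>\<^sub>2\<close>. For the loops, \<open>\<eta>\<close> is a height strictly
  between the two ends.
\<close>

definition vertical_shape :: "(real \<Rightarrow> complex) \<Rightarrow> bool" where
  "vertical_shape L \<longleftrightarrow>
     bounded (range (\<lambda>t. Re (L t))) \<and>
     filterlim (\<lambda>t. Im (L t)) at_bot at_bot \<and> filterlim (\<lambda>t. Im (L t)) at_top at_top"

definition right_loop_shape :: "(real \<Rightarrow> complex) \<Rightarrow> real \<Rightarrow> bool" where
  "right_loop_shape L \<eta> \<longleftrightarrow>
     (\<exists>\<phi>1 \<phi>2. \<phi>1 < \<eta> \<and> \<eta> < \<phi>2 \<and>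
        eventually (\<lambda>t. Im (L t) = \<phi>1) at_bot \<and> eventually (\<lambda>t. Im (L t) = \<phi>2) at_top \<and>
        filterlim (\<lambda>t. Re (L t)) at_top at_bot \<and> filterlim (\<lambda>t. Re (L t)) at_top at_top)"

definition left_loop_shape :: "(real \<Rightarrow> complex) \<Rightarrow> real \<Rightarrow> bool" where
  "left_loop_shape L \<eta> \<longleftrightarrow>
     (\<exists>\<phi>1 \<phi>2. \<phi>1 < \<eta> \<and> \<eta> < \<phi>2 \<and>
        eventually (\<lambda>t. Im (L t) = \<phi>1) at_bot \<and> eventually (\<lambda>t. Im (L t) = \<phi>2) at_top \<and>
        filterlim (\<lambda>t. Re (L t)) at_bot at_bot \<and> filterlim (\<lambda>t. Re (L t)) at_bot at_top)"

text \<open>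
  A point lies to the right (left) of the contour if it can be joined, without meeting the
  contour, to the points at height \<open>\<eta>\<close> that are far to the right (left). For the right-hand loop
  the former is the inside of the loop, for the left-hand loop the latter is.
\<close>

definition right_of_contour :: "(real \<Rightarrow> complex) \<Rightarrow> real \<Rightarrow> complex \<Rightarrow> bool" where
  "right_of_contour L \<eta> p \<longleftrightarrow>
     eventually (\<lambda>r. connected_component (- range L) p (Complex r \<eta>)) at_top"

definition left_of_contour :: "(real \<Rightarrow> complex) \<Rightarrow> real \<Rightarrow> complex \<Rightarrow> bool" where
  "left_of_contour L \<eta> p \<longleftrightarrow>
     eventually (\<lambda>r. connected_component (- range L) p (Complex r \<eta>)) at_bot"

definition fox_contour ::
  "(real \<Rightarrow> complex) \<Rightarrow> nat \<Rightarrow> nat \<Rightarrow> (complex \<times> real) list \<Rightarrow> (complex \<times> real) list \<Rightarrow> bool" where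
  "fox_contour L m n as bs \<longleftrightarrow>
     (\<forall>T. L piecewise_C1_differentiable_on {-T..T}) \<and>
     (\<exists>\<eta>. (vertical_shape L \<or> right_loop_shape L \<eta> \<or> left_loop_shape L \<eta>) \<and>
          (\<forall>p\<in>right_poles m bs. right_of_contour L \<eta> p) \<and>
          (\<forall>p\<in>left_poles n as. left_of_contour L \<eta> p))"

text \<open>
  The contour integral, written out in the parametrisation. The power \<open>z\<^sup>\<xi>\<close> is \<open>powr\<close>, that is,
  \<open>exp (\<xi> Ln z)\<close> with the principal branch of the logarithm.
\<close>

definition fox_H_convergent ::
  "(real \<Rightarrow> complex) \<Rightarrow> nat \<Rightarrow> nat \<Rightarrow> (complex \<times> real) list \<Rightarrow> (complex \<times> real) list \<Rightarrow> complex \<Rightarrow> bool" where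
  "fox_H_convergent L m n as bs z \<longleftrightarrow>
     (\<lambda>t. fox_integrand m n as bs (L t) * z powr (L t) * vector_derivative L (at t))
       absolutely_integrable_on UNIV"

definition fox_H ::
  "(real \<Rightarrow> complex) \<Rightarrow> nat \<Rightarrow> nat \<Rightarrow> (complex \<times> real) list \<Rightarrow> (complex \<times> real) list \<Rightarrow> complex \<Rightarrow> complex" where
  "fox_H L m n as bs z =
     1 / (2 * of_real pi * \<i>) *
     (LINT t|lebesgue. fox_integrand m n as bs (L t) * z powr (L t) * vector_derivative L (at t))"

definition fox_kernel ::
  "(real \<Rightarrow> complex) \<Rightarrow> complex \<Rightarrow> nat \<Rightarrow> nat \<Rightarrow> real \<Rightarrow> (complex \<times> real) list \<Rightarrow>
   (complex \<times> real) list \<Rightarrow> complex \<Rightarrow> real \<Rightarrow> complex" where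
  "fox_kernel L w m n \<alpha> as bs \<beta> u =
     of_real u powr (\<beta> - 1) * fox_H L m n as bs (w * of_real (u powr \<alpha>))"

definition fox_operator ::
  "(real \<Rightarrow> complex) \<Rightarrow> complex \<Rightarrow> nat \<Rightarrow> nat \<Rightarrow> real \<Rightarrow> real \<Rightarrow> (complex \<times> real) list \<Rightarrow>
   (complex \<times> real) list \<Rightarrow> complex \<Rightarrow> (real \<Rightarrow> complex) \<Rightarrow> real \<Rightarrow> complex" where
  "fox_operator L w m n \<alpha> a as bs \<beta> f x =
     (LINT t:{a<..<x}|lebesgue. fox_kernel L w m n \<alpha> as bs \<beta> (x - t) * f t)"

definition frac_integral :: "real \<Rightarrow> complex \<Rightarrow> (real \<Rightarrow> complex) \<Rightarrow> real \<Rightarrow> complex" where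
  "frac_integral a \<mu> f x =
     1 / Gamma \<mu> * (LINT t:{a<..<x}|lebesgue. f t / of_real (x - t) powr (1 - \<mu>))"

end

theory Submission
  imports Defs "HOL-Complex_Analysis.Complex_Analysis" "HOL-Real_Asymp.Real_Asymp"
begin

text \<open>
  By Fubini the claim reduces to
  \<open>\<integral>\<^sub>0\<^sup>v u\<^sup>\<beta>\<^sup>-\<^sup>1 (v - u)\<^sup>\<mu>\<^sup>-\<^sup>1 H[w u\<^sup>\<alpha>] du = \<Gamma>(\<mu>) v\<^sup>\<beta>\<^sup>+\<^sup>\<mu>\<^sup>-\<^sup>1 H'[w v\<^sup>\<alpha>]\<close> for almost all relevant \<open>v\<close>, where
  the integrand of \<open>H'\<close> is that of \<open>H\<close> times \<open>\<Gamma>(\<beta> + \<alpha>\<xi>) / \<Gamma>(\<beta> + \<mu> + \<alpha>\<xi>)\<close>. Interchanging the \<open>u\<close>-integral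
  with the contour integral is only possible where \<open>Re (\<beta> + \<alpha>\<xi>) > 0\<close>, and the contour \<open>L\<close> of \<open>H\<close> may
  leave this half-plane. So \<open>\<beta>\<close> is replaced by \<open>\<beta> + l\<close> with large real \<open>l\<close>, and the resulting
  identity is continued analytically to \<open>l = 0\<close>; to keep the new poles away during the
  continuation, the finite part of \<open>L\<close> is first replaced, by the residue theorem, with segments far
  to the right and circles around right poles.

  The same replacement for the contour \<open>L'\<close> of \<open>H'\<close> leaves the tails to be compared. No asymptotics of
  the Gamma function is needed for this: both tails run in a quadrant-like region where the
  integrand has order at most \<open>3/2 < 2\<close>, so a Phragmen-Lindeloef regulator shows that a
  primitive has the same limit along both.
\<close>

section \<open>Holomorphic parameter integrals and the complex Beta integral\<close>

text \<open>The obstacle is that \<open>L\<close> and \<open>L'\<close> are unrelated. One may be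
  vertical and the other a loop, and \<open>L'\<close> keeps the poles \<xi> = -(\<beta> +
  k)/\<alpha> of the new Gamma factor on its left, whereas these may lie on either side of
  \<open>L\<close> or on it. The condition on the minimum places every right-hand pole in Re
  (\<beta> + \<alpha>\<xi>) >= 4\<delta> for some \<delta> > 0, which leaves room for circles and
  segments on which Re (\<beta> + \<alpha>\<xi>) >= 2\<delta>. The tails of \<open>L\<close> itself
  are kept, so no convergence along a new curve has to be proved. On them the factor
  \<Gamma>(\<beta> + l + \<alpha>\<xi>) / \<Gamma>(\<beta> + l + \<alpha>\<xi> + \<mu>) is bounded:
  it is a Beta function divided by \<Gamma>(\<mu>), continued to the left by finitely many uses of
  the functional equation away from the real axis. Finitely many suffice because Re is bounded below
  on the contour. The same boundedness makes the integral of H' converge along the tails of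
  \<open>L\<close>, without which they could not be compared with those of
  \<open>L'\<close>.\<close>

text \<open>Cauchy's inequality on discs of radius r/2 bounds the derivative on the half-size disc
  by 2B/r, and convexity turns this into a bound of the difference quotient. It supplies the
  majorant for differentiation under the integral sign.\<close>

lemma norm_diff_quotient_le:
  fixes f :: "complex \<Rightarrow> complex"
  assumes f: "f holomorphic_on cball z r" and "r > 0"
    and B: "\<And>w. w \<in> cball z r \<Longrightarrow> norm (f w) \<le> B"
    and w: "w \<in> ball z (r / 2)" "w \<noteq> z"
  shows "norm ((f w - f z) / (w - z)) \<le> 2 * B / r"
proof -
  have der: "norm (deriv f y) \<le> 2 * B / r" if y: "y \<in> ball z (r / 2)" for y
  proof -
    have sub: "cball y (r / 2) \<subseteq> cball z r"
    proof
      fix u assume "u \<in> cball y (r / 2)"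
      then have "dist z u \<le> dist z y + dist y u" "dist y u \<le> r / 2" "dist z y < r / 2"
        using y by (auto simp: dist_triangle)
      then show "u \<in> cball z r" by auto
    qed
    have "norm ((deriv ^^ 1) f y) \<le> fact 1 * B / (r / 2) ^ 1"
    proof (rule Cauchy_inequality)
      show "f holomorphic_on ball y (r / 2)"
        using f sub by (meson ball_subset_cball holomorphic_on_subset order_trans)
      show "continuous_on (cball y (r / 2)) f"
        using f sub by (meson holomorphic_on_imp_continuous_on holomorphic_on_subset)
      show "norm (f x) \<le> B" if "norm (y - x) = r / 2" for x
        using that sub by (intro B) (auto simp: dist_norm subset_iff)
    qed (use \<open>r > 0\<close> in auto)
    then show ?thesis by (simp add: mult.commute)
  qed
  have "norm (f w - f z) \<le> 2 * B / r * norm (w - z)"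
  proof (rule field_differentiable_bound[where S = "ball z (r / 2)" and f' = "deriv f"])
    show "(f has_field_derivative deriv f y) (at y within ball z (r / 2))"
      if "y \<in> ball z (r / 2)" for y
    proof -
      have "f holomorphic_on ball z r"
        using f holomorphic_on_subset ball_subset_cball by blast
      then show ?thesis
        using that \<open>r > 0\<close> by (intro holomorphic_derivI[of _ "ball z r"]) auto
    qed
  qed (use w der \<open>r > 0\<close> in auto)
  then show ?thesis
    using w \<open>r > 0\<close> by (simp add: norm_divide divide_simps)
qed

text \<open>A local integrable majorant of the integrand alone is enough: Cauchy's estimate, applied
  for each x, turns it into a majorant of the difference quotients, and dominated convergence then
  identifies the derivative along every sequence tending to \<open>l0\<close>.\<close>

lemma holomorphic_on_lebesgue_integral:
  fixes k :: "complex \<Rightarrow> 'a \<Rightarrow> complex"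
  assumes "open D"
    and hol: "\<And>x. x \<in> space M \<Longrightarrow> (\<lambda>l. k l x) holomorphic_on D"
    and meas: "\<And>l. l \<in> D \<Longrightarrow> k l \<in> borel_measurable M"
    and dom: "\<And>l0. l0 \<in> D \<Longrightarrow> \<exists>r>0. \<exists>g. cball l0 r \<subseteq> D \<and> integrable M g \<and>
               (\<forall>l\<in>cball l0 r. \<forall>x\<in>space M. norm (k l x) \<le> g x)"
  shows "(\<lambda>l. \<integral>x. k l x \<partial>M) holomorphic_on D"
proof (rule holomorphic_onI)
  fix l0 assume l0: "l0 \<in> D"
  obtain r g where r: "r > 0" "cball l0 r \<subseteq> D" and g: "integrable M g"
    and kg: "\<And>l x. l \<in> cball l0 r \<Longrightarrow> x \<in> space M \<Longrightarrow> norm (k l x) \<le> g x"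
    using dom[OF l0] by metis
  have int: "integrable M (k l)" if "l \<in> cball l0 r" for l
    using that r by (intro Bochner_Integration.integrable_bound[OF g] meas AE_I2)
      (auto intro: order_trans[OF kg])
  let ?d = "\<lambda>x. deriv (\<lambda>l. k l x) l0"
  have der: "((\<lambda>l. k l x) has_field_derivative ?d x) (at l0)" if "x \<in> space M" for x
    using hol[OF that] l0 \<open>open D\<close> by (intro holomorphic_derivI)
  have "((\<lambda>l. ((\<integral>x. k l x \<partial>M) - (\<integral>x. k l0 x \<partial>M)) / (l - l0)) \<longlongrightarrow> (\<integral>x. ?d x \<partial>M)) (at l0)"
    unfolding tendsto_at_iff_sequentially
  proof (intro allI impI)
    fix X :: "nat \<Rightarrow> complex"
    assume X: "\<forall>i. X i \<in> UNIV - {l0}" "X \<longlonglongrightarrow> l0"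
    have "eventually (\<lambda>n. X n \<in> ball l0 (r / 2)) sequentially"
      using X(2) r by (intro topological_tendstoD) auto
    then obtain N where N: "\<And>n. n \<ge> N \<Longrightarrow> X n \<in> ball l0 (r / 2)"
      by (auto simp: eventually_sequentially)
    \<comment> \<open>Dropping the first \<open>N\<close> terms puts the whole sequence into the
      half-size disc, where the quotient bound holds for every index; \<open>LIMSEQ_offset\<close>
      undoes the shift at the end.\<close>
    define Y where "Y n = X (n + N)" for n
    have Y: "Y n \<in> ball l0 (r / 2)" "Y n \<noteq> l0" "Y n \<in> cball l0 r" for n
      using N[of "n + N"] X r by (auto simp: Y_def)
    have Yl: "Y \<longlonglongrightarrow> l0"
      unfolding Y_def using X(2) by (rule LIMSEQ_ignore_initial_segment)
    let ?s = "\<lambda>n x. (k (Y n) x - k l0 x) / (Y n - l0)"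
    have ms: "?s n \<in> borel_measurable M" for n
      using meas[of "Y n"] meas[OF l0] Y(3)[of n] r by (auto intro!: borel_measurable_divide)
    have lim: "(\<lambda>n. ?s n x) \<longlonglongrightarrow> ?d x" if "x \<in> space M" for x
    proof -
      have "((\<lambda>l. (k l x - k l0 x) / (l - l0)) \<longlongrightarrow> ?d x) (at l0)"
        using der[OF that] by (simp add: has_field_derivative_iff)
      then show ?thesis
        unfolding tendsto_at_iff_sequentially using Yl Y(2) by (auto simp: o_def)
    qed
    have int_lim: "(\<lambda>n. \<integral>x. ?s n x \<partial>M) \<longlonglongrightarrow> (\<integral>x. ?d x \<partial>M)"
    proof (rule integral_dominated_convergence[where w = "\<lambda>x. 2 * g x / r"])
      show "?d \<in> borel_measurable M"
        using borel_measurable_LIMSEQ_metric[OF ms lim] by simp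
      show "AE x in M. norm (?s n x) \<le> 2 * g x / r" for n
      proof (rule AE_I2)
        fix x assume x: "x \<in> space M"
        have "(\<lambda>l. k l x) holomorphic_on cball l0 r"
          using hol[OF x] r(2) by (rule holomorphic_on_subset)
        then show "norm (?s n x) \<le> 2 * g x / r"
          using norm_diff_quotient_le[of "\<lambda>l. k l x" l0 r "g x" "Y n"] kg x r(1) Y[of n] by auto
      qed
    qed (use g ms lim in auto)
    have int_s: "(\<integral>x. ?s n x \<partial>M) = ((\<integral>x. k (Y n) x \<partial>M) - (\<integral>x. k l0 x \<partial>M)) / (Y n - l0)" for n
    proof -
      have "(\<integral>x. ?s n x \<partial>M) = (\<integral>x. k (Y n) x - k l0 x \<partial>M) / (Y n - l0)"
        by simp
      also have "(\<integral>x. k (Y n) x - k l0 x \<partial>M) = (\<integral>x. k (Y n) x \<partial>M) - (\<integral>x. k l0 x \<partial>M)"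
        using int[OF Y(3)[of n]] int[of l0] r(1) by (intro Bochner_Integration.integral_diff) auto
      finally show ?thesis .
    qed
    have "(\<lambda>n. ((\<integral>x. k (Y n) x \<partial>M) - (\<integral>x. k l0 x \<partial>M)) / (Y n - l0)) \<longlonglongrightarrow> (\<integral>x. ?d x \<partial>M)"
      using int_lim unfolding int_s .
    then have "(\<lambda>n. ((\<integral>x. k (X (n + N)) x \<partial>M) - (\<integral>x. k l0 x \<partial>M)) / (X (n + N) - l0)) \<longlonglongrightarrow> (\<integral>x. ?d x \<partial>M)"
      unfolding Y_def .
    then show "((\<lambda>l. ((\<integral>x. k l x \<partial>M) - (\<integral>x. k l0 x \<partial>M)) / (l - l0)) \<circ> X) \<longlonglongrightarrow> (\<integral>x. ?d x \<partial>M)"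
      unfolding o_def by (rule LIMSEQ_offset)
  qed
  then have "((\<lambda>l. \<integral>x. k l x \<partial>M) has_field_derivative (\<integral>x. ?d x \<partial>M)) (at l0)"
    unfolding has_field_derivative_iff .
  then show "(\<lambda>l. \<integral>x. k l x \<partial>M) field_differentiable at l0 within D"
    using field_differentiable_at_within field_differentiable_def by blast
qed

section \<open>The Euler integral of the Beta function for complex arguments\<close>

lemma norm_of_real_powr:
  fixes t :: real
  assumes "t > 0"
  shows "norm (of_real t powr (z::complex)) = t powr Re z"
  using assms by (simp add: norm_powr_real_powr)

text \<open>Small t is governed by the smallest exponent and large t by the largest. The sum covers
  both cases and so gives one majorant for a whole range of exponents, as is needed on discs of
  complex parameters.\<close>

lemma powr_le_powr_add_powr:
  fixes t :: real
  assumes "0 < t" "p \<le> s" "s \<le> q"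
  shows "t powr s \<le> t powr p + t powr q"
proof (cases "t \<le> 1")
  case True
  then have "t powr s \<le> t powr p"
    using assms by (intro powr_mono') auto
  then show ?thesis by (simp add: add_increasing2)
next
  case False
  then have "t powr s \<le> t powr q"
    using assms by (intro powr_mono) auto
  then show ?thesis by (simp add: add_increasing)
qed

lemma set_integrable_Beta_real:
  fixes a b :: real
  assumes "a > 0" "b > 0"
  shows "set_integrable lborel {0<..<1} (\<lambda>t. t powr (a - 1) * (1 - t) powr (b - 1))"
  by (rule set_integrable_subset[OF integrable_Beta[OF assms]]) auto

lemma LINT_Beta_real:
  fixes a b :: real
  assumes "a > 0" "b > 0"
  shows "(LINT t:{0<..<1}|lborel. t powr (a - 1) * (1 - t) powr (b - 1)) = Beta a b"
proof -
  have "((\<lambda>t. t powr (a - 1) * (1 - t) powr (b - 1)) has_integral Beta a b) {0<..<1}"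
    using has_integral_Beta_real[OF assms] by (simp add: has_integral_Icc_iff_Ioo)
  then show ?thesis
    using set_borel_integral_eq_integral[OF set_integrable_Beta_real[OF assms]]
    by (simp add: integral_unique)
qed

lemma set_integrable_Beta_complex:
  fixes a b :: complex
  assumes "Re a > 0" "Re b > 0"
  shows "set_integrable lborel {0<..<1} (\<lambda>t. of_real t powr (a - 1) * of_real (1 - t) powr (b - 1))"
proof (rule set_integrable_bound[OF set_integrable_Beta_real[OF assms]])
  show "set_borel_measurable lborel {0<..<1} (\<lambda>t. complex_of_real t powr (a - 1) * of_real (1 - t) powr (b - 1))"
    unfolding set_borel_measurable_def by measurable
qed (auto simp: norm_mult norm_of_real_powr intro!: AE_I2 mult_mono simp del: of_real_diff)

lemma holomorphic_LINT_Beta: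
  fixes b :: complex
  assumes "Re b > 0"
  shows "(\<lambda>a. LINT t:{0<..<1}|lborel. of_real t powr (a - 1) * of_real (1 - t) powr (b - 1))
           holomorphic_on {a. Re a > 0}"
  unfolding set_lebesgue_integral_def
proof (rule holomorphic_on_lebesgue_integral)
  fix l0 :: complex assume "l0 \<in> {a. Re a > 0}"
  then have l0: "Re l0 > 0" by simp
  define r where "r = Re l0 / 2"
  have R: "r > 0" "Re l0 - r > 0" "Re l0 + r > 0" using l0 by (auto simp: r_def)
  have Rl: "Re l0 - r \<le> Re l" "Re l \<le> Re l0 + r" if "l \<in> cball l0 r" for l
    using abs_Re_le_cmod[of "l0 - l"] that by (auto simp: dist_norm)
  let ?g = "\<lambda>t. indicator {0<..<1} t *\<^sub>R (t powr ((Re l0 - r) - 1) * (1 - t) powr (Re b - 1))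
            + indicator {0<..<1} t *\<^sub>R (t powr ((Re l0 + r) - 1) * (1 - t) powr (Re b - 1))"
  have "cball l0 r \<subseteq> {a. Re a > 0}"
    using Rl R by fastforce
  moreover have "integrable lborel ?g"
    using set_integrable_Beta_real[of "Re l0 - r" "Re b"] set_integrable_Beta_real[of "Re l0 + r" "Re b"] R assms
    unfolding set_integrable_def by (intro Bochner_Integration.integrable_add) auto
  moreover have "norm (indicator {0<..<1} t *\<^sub>R (complex_of_real t powr (l - 1) * of_real (1 - t) powr (b - 1))) \<le> ?g t"
    if l: "l \<in> cball l0 r" for l t
  proof (cases "t \<in> {0<..<1}")
    case True
    then have "t powr (Re l - 1) \<le> t powr ((Re l0 - r) - 1) + t powr ((Re l0 + r) - 1)"
      using Rl[OF l] by (intro powr_le_powr_add_powr) auto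
    then have "t powr (Re l - 1) * (1 - t) powr (Re b - 1) \<le>
      (t powr ((Re l0 - r) - 1) + t powr ((Re l0 + r) - 1)) * (1 - t) powr (Re b - 1)"
      by (intro mult_right_mono) auto
    with True show ?thesis
      by (auto simp: norm_mult norm_of_real_powr algebra_simps simp del: of_real_diff)
  qed auto
  ultimately show "\<exists>r>0. \<exists>g. cball l0 r \<subseteq> {a. Re a > 0} \<and> integrable lborel g \<and>
               (\<forall>l\<in>cball l0 r. \<forall>t\<in>space lborel. norm (indicat_real {0<..<1} t *\<^sub>R (complex_of_real t powr (l - 1) * of_real (1 - t) powr (b - 1))) \<le> g t)"
    using R(1) by blast
next
  fix t :: real
  show "(\<lambda>l. indicat_real {0<..<1} t *\<^sub>R (complex_of_real t powr (l - 1) * of_real (1 - t) powr (b - 1)))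
         holomorphic_on {a. Re a > 0}"
    by (cases "t \<in> {0<..<1}") (auto intro!: holomorphic_intros)
qed (auto intro!: open_halfspace_Re_gt)

lemma of_real_greaterThan_islimpt: "complex_of_real (c + 1) islimpt complex_of_real ` {c<..}"
proof (rule islimptI)
  fix T :: "complex set" assume "complex_of_real (c + 1) \<in> T" "open T"
  then obtain e where e: "e > 0" "ball (of_real (c + 1)) e \<subseteq> T"
    by (meson open_contains_ball)
  have "complex_of_real (c + 1 + e / 2) \<in> ball (of_real (c + 1)) e"
    using e(1) by (simp add: dist_norm flip: of_real_add of_real_diff)
  then show "\<exists>y\<in>complex_of_real ` {c<..}. y \<in> T \<and> y \<noteq> complex_of_real (c + 1)"
    using e by (intro bexI[of _ "complex_of_real (c + 1 + e / 2)"])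
      (auto intro!: image_eqI[of _ _ "c + 1 + e / 2"] simp flip: of_real_add)
qed

text \<open>The identity theorem with a real ray as the set of agreement; the point c + 1 of the ray
  is an accumulation point inside the half-plane.\<close>

lemma halfplane_eqI:
  assumes f: "f holomorphic_on {a. Re a > c}" and g: "g holomorphic_on {a. Re a > c}"
    and eq: "\<And>r::real. r > c \<Longrightarrow> f (of_real r) = g (of_real r)"
    and z: "Re z > c"
  shows "f z = g z"
proof -
  have "f z - g z = 0"
  proof (rule analytic_continuation[where f = "\<lambda>z. f z - g z" and S = "{a. Re a > c}"
        and U = "of_real ` {c<..}" and \<xi> = "of_real (c + 1)"])
    show "complex_of_real (c + 1) islimpt complex_of_real ` {c<..}" by (rule of_real_greaterThan_islimpt)
    show "open {a. Re a > c}" by (simp add: open_halfspace_Re_gt)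
    show "connected {a. Re a > c}" by (simp add: convex_connected convex_halfspace_Re_gt)
  qed (use f g eq z in \<open>auto intro!: holomorphic_intros\<close>)
  then show ?thesis by simp
qed

lemma LINT_Beta_commute:
  "(LINT t:{0<..<1}|lborel. of_real t powr (a - 1) * of_real (1 - t) powr (b - 1)) =
   (LINT t:{0<..<1}|lborel. complex_of_real t powr (b - 1) * of_real (1 - t) powr (a - 1))"
  unfolding set_lebesgue_integral_def
  by (subst lborel_integral_real_affine[where c = "-1" and t = 1])
     (auto intro!: Bochner_Integration.integral_cong simp: indicator_def)

lemma not_nonpos_Ints_Re_pos: "Re z > 0 \<Longrightarrow> z \<notin> \<int>\<^sub>\<le>\<^sub>0"
  by (auto elim!: nonpos_Ints_cases)

text \<open>The real formula is continued in one argument at a time: in \<open>a\<close> while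
  \<open>b\<close> is real, and then, after exchanging the arguments by t -> 1 - t, in
  \<open>b\<close> while \<open>a\<close> is already complex.\<close>

lemma LINT_Beta_complex:
  fixes a b :: complex
  assumes "Re a > 0" "Re b > 0"
  shows "(LINT t:{0<..<1}|lborel. of_real t powr (a - 1) * of_real (1 - t) powr (b - 1)) = Beta a b"
proof -
  let ?B = "\<lambda>a b. LINT t:{0<..<1}|lborel. complex_of_real t powr (a - 1) * of_real (1 - t) powr (b - 1)"
  have hol: "(\<lambda>a. Beta a b) holomorphic_on {a. Re a > 0}" if "Re b > 0" for b
    using that by (intro holomorphic_intros) (auto dest: not_nonpos_Ints_Re_pos)
  have rr: "?B (of_real a) (of_real b) = Beta (of_real a) (of_real b)" if "a > 0" "b > 0" for a b :: real
  proof -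
    have "?B (of_real a) (of_real b) =
          (LINT t:{0<..<1}|lborel. complex_of_real (t powr (a - 1) * (1 - t) powr (b - 1)))"
      by (intro set_lebesgue_integral_cong)
         (simp_all add: powr_of_real[symmetric])
    also have "\<dots> = Beta (of_real a) (of_real b)"
      using LINT_Beta_real[OF that]
      by (simp add: set_lebesgue_integral_def Beta_complex_of_real scaleR_conv_of_real flip: of_real_mult)
    finally show ?thesis .
  qed
  have cr: "?B a (of_real b) = Beta a (of_real b)" if "Re a > 0" "b > 0" for a and b :: real
    by (rule halfplane_eqI[where c = 0]) (use holomorphic_LINT_Beta hol rr that in auto)
  have "?B b a = Beta b a"
  proof (rule halfplane_eqI[where c = 0 and f = "\<lambda>b. ?B b a" and g = "\<lambda>b. Beta b a"])
    show "?B (of_real r) a = Beta (of_real r) a" if "r > 0" for r :: real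
      using cr[OF assms(1) that] LINT_Beta_commute Beta_commute by metis
  qed (use holomorphic_LINT_Beta[OF assms(1)] hol[OF assms(1)] assms(2) in auto)
  then show ?thesis
    using LINT_Beta_commute Beta_commute by metis
qed

section \<open>Growth of the Gamma function\<close>

lemma norm_Beta_le:
  assumes "e > 0" "Re s \<ge> e" "Re \<mu> > 0"
  shows "norm (Beta s \<mu>) \<le> Beta e (Re \<mu>)"
proof -
  let ?f = "\<lambda>t. complex_of_real t powr (s - 1) * of_real (1 - t) powr (\<mu> - 1)"
  have "norm (Beta s \<mu>) = norm (LINT t:{0<..<1}|lborel. ?f t)"
    using assms by (subst LINT_Beta_complex) auto
  also have "\<dots> \<le> (LINT t:{0<..<1}|lborel. norm (?f t))"
    using assms by (intro set_integral_norm_bound set_integrable_Beta_complex) auto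
  also have "\<dots> = (LINT t:{0<..<1}|lborel. t powr (Re s - 1) * (1 - t) powr (Re \<mu> - 1))"
    by (intro set_lebesgue_integral_cong) (auto simp: norm_mult norm_of_real_powr simp del: of_real_diff)
  also have "\<dots> = Beta (Re s) (Re \<mu>)"
    using assms by (intro LINT_Beta_real) auto
  also have "\<dots> \<le> Beta e (Re \<mu>)"
    using assms by (intro Beta_real_mono) auto
  finally show ?thesis .
qed

text \<open>The quotient equals B(s, \<mu>) / \<Gamma>(\<mu>). The modulus of the Beta integral is
  at most its value at the real parts, and that value decreases in Re s, so the bound is uniform on
  a half-plane.\<close>

lemma norm_Gamma_ratio_le:
  assumes "e > 0" "Re s \<ge> e" "Re \<mu> > 0"
  shows "norm (Gamma s * rGamma (s + \<mu>)) \<le> Beta e (Re \<mu>) * norm (rGamma \<mu>)"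
proof -
  have "Gamma \<mu> \<noteq> 0"
    using assms(3) by (simp add: Gamma_eq_zero_iff not_nonpos_Ints_Re_pos)
  then have "Gamma s * rGamma (s + \<mu>) = Beta s \<mu> * rGamma \<mu>"
    by (simp add: Beta_altdef rGamma_inverse_Gamma)
  then show ?thesis
    using norm_Beta_le[OF assms] by (simp add: norm_mult mult_right_mono)
qed

text \<open>One step to the left by the functional equation multiplies the quotient by 1 + \<mu>/s.
  Since |Im s| >= 1 forces |s| >= 1, each step costs at most the factor 1 + |\<mu>|;
  \<open>N\<close> counts the steps from the half-plane Re s >= 1.\<close>

lemma norm_Gamma_ratio_le_off_axis:
  assumes "Re \<mu> > 0" "\<bar>Im s\<bar> \<ge> 1" "Re s \<ge> 1 - real N"
  shows "norm (Gamma s * rGamma (s + \<mu>)) \<le> (1 + norm \<mu>) ^ N * (Beta 1 (Re \<mu>) * norm (rGamma \<mu>))"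
  using assms(2,3)
proof (induction N arbitrary: s)
  case 0
  then show ?case using norm_Gamma_ratio_le[of 1 s \<mu>] assms(1) by simp
next
  case (Suc N)
  have s1: "norm s \<ge> 1"
    using Suc.prems abs_Im_le_cmod[of s] by linarith
  have "s \<notin> \<int>\<^sub>\<le>\<^sub>0"
    using Suc.prems(1) by (auto elim!: nonpos_Ints_cases)
  then have "Gamma s = Gamma (s + 1) / s"
    using s1 by (subst Gamma_plus1) auto
  moreover have "rGamma (s + \<mu>) = (s + \<mu>) * rGamma ((s + 1) + \<mu>)"
    using rGamma_plus1[of "s + \<mu>"] by (simp add: add_ac)
  moreover have "s \<noteq> 0" using s1 by auto
  ultimately have eq: "Gamma s * rGamma (s + \<mu>) = (1 + \<mu> / s) * (Gamma (s + 1) * rGamma ((s + 1) + \<mu>))"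
    by (simp only: divide_inverse) (simp add: algebra_simps)
  have "norm (1 + \<mu> / s) \<le> 1 + norm (\<mu> / s)"
    using norm_triangle_ineq[of 1 "\<mu> / s"] by simp
  also have "\<dots> \<le> 1 + norm \<mu>"
    using s1 mult_left_mono[of 1 "norm s" "norm \<mu>"] by (simp add: norm_divide divide_le_eq)
  finally have "norm (1 + \<mu> / s) \<le> 1 + norm \<mu>" .
  moreover have "norm (Gamma (s + 1) * rGamma ((s + 1) + \<mu>)) \<le>
      (1 + norm \<mu>) ^ N * (Beta 1 (Re \<mu>) * norm (rGamma \<mu>))"
    using Suc.prems by (intro Suc.IH) auto
  ultimately show ?case
    unfolding eq norm_mult[of "1 + \<mu> / s"] power_Suc mult.assoc
    by (intro mult_mono) (auto simp: mult.assoc)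
qed

section \<open>Functions of order at most 3/2: powers, 1/\<Gamma>, and \<Gamma> away from its
  poles\<close>

text \<open>The exponent \<open>3/2\<close> is any number between the order \<open>1\<close> of \<open>1 / \<Gamma>\<close> and the order \<open>2\<close> admitted by
  Phragmen-Lindeloef in a quadrant; a value above \<open>1\<close> absorbs all logarithms.\<close>

definition order_bounded :: "(complex \<Rightarrow> complex) \<Rightarrow> complex set \<Rightarrow> bool" where
  "order_bounded f U \<longleftrightarrow> (\<exists>M\<ge>0. \<forall>z\<in>U. norm (f z) \<le> exp (M * (1 + norm z) powr (3/2)))"

lemma order_boundedI:
  assumes "\<And>z. z \<in> U \<Longrightarrow> norm (f z) \<le> exp (M * (1 + norm z) powr (3/2))"
  shows "order_bounded f U"
proof -
  have "norm (f z) \<le> exp (max M 0 * (1 + norm z) powr (3/2))" if "z \<in> U" for z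
    using assms[OF that] by (rule order_trans) (auto intro!: mult_right_mono)
  then show ?thesis
    unfolding order_bounded_def by (intro exI[of _ "max M 0"]) auto
qed

lemma order_bounded_mono:
  assumes "order_bounded f U" and le: "\<And>z. z \<in> U \<Longrightarrow> norm (g z) \<le> norm (f z)"
  shows "order_bounded g U"
  using assms(1) order_trans[OF le] unfolding order_bounded_def by blast

lemma one_le_powr_norm: "1 \<le> (1 + norm z) powr (3/2)"
  using powr_mono2[of "3/2" 1 "1 + norm z"] by simp

lemma norm_le_powr_norm: "1 + norm z \<le> (1 + norm z) powr (3/2)"
  using powr_mono[of 1 "3/2" "1 + norm z"] by simp

lemma order_bounded_const: "order_bounded (\<lambda>_. c) U"
proof (rule order_boundedI)
  fix z :: complex
  have "norm c \<le> exp (norm c * 1)" using exp_ge_add_one_self[of "norm c"] unfolding mult_1_right by linarith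
  also have "\<dots> \<le> exp (norm c * (1 + norm z) powr (3/2))"
    using one_le_powr_norm[of z] by (simp add: mult_left_le_one_le mult_le_cancel_left1)
  finally show "norm c \<le> exp (norm c * (1 + norm z) powr (3/2))" .
qed

lemma order_bounded_mult:
  assumes "order_bounded f U" "order_bounded g U"
  shows "order_bounded (\<lambda>z. f z * g z) U"
proof -
  obtain M1 M2 where
    "\<And>z. z \<in> U \<Longrightarrow> norm (f z) \<le> exp (M1 * (1 + norm z) powr (3/2))"
    "\<And>z. z \<in> U \<Longrightarrow> norm (g z) \<le> exp (M2 * (1 + norm z) powr (3/2))"
    using assms unfolding order_bounded_def by metis
  then show ?thesis
    by (intro order_boundedI[where M = "M1 + M2"])
       (auto simp: norm_mult distrib_right exp_add intro!: mult_mono)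
qed

lemma order_bounded_prod:
  assumes "finite A" "\<And>j. j \<in> A \<Longrightarrow> order_bounded (f j) U"
  shows "order_bounded (\<lambda>z. \<Prod>j\<in>A. f j z) U"
  using assms by (induction A rule: finite_induct) (auto intro!: order_bounded_const order_bounded_mult)

lemma order_bounded_affine:
  assumes f: "order_bounded f V" and g: "\<And>z. z \<in> U \<Longrightarrow> a + b * z \<in> V"
  shows "order_bounded (\<lambda>z. f (a + b * z)) U"
proof -
  obtain M where M: "M \<ge> 0" "\<And>z. z \<in> V \<Longrightarrow> norm (f z) \<le> exp (M * (1 + norm z) powr (3/2))"
    using f unfolding order_bounded_def by metis
  let ?K = "1 + norm a + norm b"
  show ?thesis
  proof (rule order_boundedI)
    fix z assume "z \<in> U"
    have "1 + norm (a + b * z) \<le> 1 + norm a + norm b * norm z"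
      using norm_triangle_ineq[of a "b * z"] by (simp add: norm_mult)
    also have "\<dots> \<le> ?K * (1 + norm z)"
      by (simp add: algebra_simps)
    finally have "(1 + norm (a + b * z)) powr (3/2) \<le> (?K * (1 + norm z)) powr (3/2)"
      by (intro powr_mono2) auto
    also have "\<dots> = ?K powr (3/2) * (1 + norm z) powr (3/2)"
      by (rule powr_mult)
    finally have "M * (1 + norm (a + b * z)) powr (3/2) \<le> M * (?K powr (3/2) * (1 + norm z) powr (3/2))"
      using M(1) by (rule mult_left_mono)
    then show "norm (f (a + b * z)) \<le> exp ((M * ?K powr (3/2)) * (1 + norm z) powr (3/2))"
      using order_trans[OF M(2)[OF g[OF \<open>z \<in> U\<close>]]] by (simp add: mult.assoc)
  qed
qed

lemma order_bounded_powr: "order_bounded (\<lambda>\<xi>. z powr \<xi>) U"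
proof (cases "z = 0")
  case True
  then show ?thesis by (simp add: order_bounded_const)
next
  case False
  show ?thesis
  proof (rule order_boundedI[where M = "norm (Ln z)"])
    fix \<xi> :: complex
    have "norm (z powr \<xi>) = exp (Re (\<xi> * Ln z))"
      using False by (simp add: powr_def)
    also have "Re (\<xi> * Ln z) \<le> norm \<xi> * norm (Ln z)"
      by (metis complex_Re_le_cmod norm_mult)
    also have "\<dots> \<le> norm (Ln z) * (1 + norm \<xi>) powr (3/2)"
      using norm_le_powr_norm[of \<xi>] by (subst mult.commute) (intro mult_left_mono, auto)
    finally show "norm (z powr \<xi>) \<le> exp (norm (Ln z) * (1 + norm \<xi>) powr (3/2))"
      by simp
  qed
qed

text \<open>This is the elementary factor of genus one at -u. For small u its logarithm is
  quadratic, for large u at most linear in size; the exponent 3/2 lies between 1 and 2 and therefore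
  dominates in both ranges.\<close>

lemma norm_Weierstrass_factor_le: "norm ((1 + u) * exp (- u)) \<le> exp (4 * norm u powr (3/2))"
  for u :: complex
proof (cases "norm u \<le> 1/2")
  case True
  show ?thesis
  proof (cases "u = 0")
    case False
    have "u \<noteq> -1" using True by auto
    then have "1 + u \<noteq> 0" by (metis add.commute add_eq_0_iff)
    then have "norm ((1 + u) * exp (- u)) = norm (exp (Ln (1 + u) - u))"
      by (simp add: exp_diff exp_minus field_simps)
    also have "\<dots> \<le> exp (norm (Ln (1 + u) - u))"
      by (rule norm_exp)
    also have "norm (Ln (1 + u) - u) \<le> norm u ^ 2 / (1 - norm u)"
      using True by (intro Ln_approx_linear) auto
    also have "\<dots> \<le> norm u ^ 2 / (1/2)"
      using True by (intro divide_left_mono) auto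
    also have "\<dots> \<le> 4 * norm u powr 2"
      using False by simp
    also have "norm u powr 2 \<le> norm u powr (3/2)"
      using True False by (intro powr_mono') auto
    finally show ?thesis by simp
  qed auto
next
  case False
  have "norm ((1 + u) * exp (- u)) \<le> (1 + norm u) * exp (norm (- u))"
    unfolding norm_mult by (intro mult_mono norm_exp) (use norm_triangle_ineq[of 1 u] in auto)
  also have "\<dots> \<le> exp (norm u) * exp (norm u)"
    by (intro mult_mono) auto
  also have "\<dots> = exp (2 * norm u powr 1)"
    by (simp flip: exp_add)
  also have "norm u powr 1 = (2 * norm u) powr 1 / 2" by simp
  also have "(2 * norm u) powr 1 \<le> (2 * norm u) powr (3/2)"
    using False by (intro powr_mono) auto
  also have "\<dots> = 2 powr (3/2) * norm u powr (3/2)"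
    by (simp add: powr_mult)
  also have "(2::real) powr (3/2) \<le> 2 powr 2" by (intro powr_mono) auto
  finally show ?thesis by (simp add: mult_right_mono)
qed

text \<open>In the Weierstrass product the factor with index k is bounded by exp (4 |z|^(3/2)
  k^(-3/2)), and the sum of k^(-3/2) converges. The bound holds for all partial products and so
  passes to the limit.\<close>

lemma order_bounded_rGamma: "order_bounded rGamma U"
proof -
  define S where "S = (\<Sum>k. real (Suc k) powr - (3/2))"
  have summ: "summable (\<lambda>k. real (Suc k) powr - (3/2))"
    by (subst summable_Suc_iff) (simp add: summable_real_powr_iff)
  have S: "S \<ge> 0" unfolding S_def using summ by (intro suminf_nonneg) auto
  \<comment> \<open>\<open>euler_mascheroni\<close> comes from the exponential factor, 1 from the
    factor z, bounded by exp |z|, and 4S from the elementary factors.\<close>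
  define M where "M = euler_mascheroni + 1 + 4 * S"
  show ?thesis
  proof (rule order_boundedI[where M = M])
    fix z :: complex
    let ?P = "(1 + norm z) powr (3/2)"
    have bound: "norm (rGamma_series_Weierstrass z n) \<le> exp (M * ?P)" for n
    proof -
      have "norm (\<Prod>k=1..n. (1 + z / of_nat k) * exp (-z / of_nat k)) \<le>
            (\<Prod>k=1..n. exp (4 * norm (z / of_nat k) powr (3/2)))"
        unfolding prod_norm[symmetric]
        by (intro prod_mono conjI norm_ge_zero)
           (metis minus_divide_left norm_Weierstrass_factor_le)
      also have "\<dots> = exp (4 * norm z powr (3/2) * (\<Sum>k=1..n. real k powr - (3/2)))"
        by (simp add: exp_sum sum_distrib_left norm_divide powr_divide powr_minus_divide)
      also have "(\<Sum>k=1..n. real k powr - (3/2)) = (\<Sum>k<n. real (Suc k) powr - (3/2))"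
        by (simp only: One_nat_def sum.atLeast1_atMost_eq)
      also have "\<dots> \<le> S"
        unfolding S_def using summ by (intro sum_le_suminf) auto
      also have "norm z powr (3/2) \<le> ?P" by (intro powr_mono2) auto
      finally have prod: "norm (\<Prod>k=1..n. (1 + z / of_nat k) * exp (-z / of_nat k)) \<le> exp (4 * ?P * S)"
        using S by (simp add: mult_left_mono mult_right_mono)
      have "norm (exp (euler_mascheroni * z) * z) \<le> exp (norm (euler_mascheroni * z)) * exp (norm z)"
        unfolding norm_mult[of "exp _"]
        by (intro mult_mono norm_exp) (use exp_ge_add_one_self[of "norm z"] in \<open>linarith | simp\<close>)+
      also have "\<dots> = exp ((euler_mascheroni + 1) * norm z)"
      proof -
        have "norm (euler_mascheroni :: complex) = euler_mascheroni"
          using euler_mascheroni_pos norm_of_real[of euler_mascheroni, where ?'a = complex] by simp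
        then show ?thesis by (simp add: norm_mult distrib_right exp_add)
      qed
      also have "\<dots> \<le> exp ((euler_mascheroni + 1) * ?P)"
        using norm_le_powr_norm[of z] euler_mascheroni_pos by (simp add: mult_left_mono)
      finally have "norm (exp (euler_mascheroni * z) * z) \<le> exp ((euler_mascheroni + 1) * ?P)" .
      then have "norm (rGamma_series_Weierstrass z n) \<le> exp ((euler_mascheroni + 1) * ?P) * exp (4 * ?P * S)"
        unfolding rGamma_series_Weierstrass_def norm_mult[of "exp _ * z"] using prod by (intro mult_mono) auto
      also have "\<dots> = exp (M * ?P)"
        by (simp add: M_def algebra_simps flip: exp_add)
      finally show ?thesis .
    qed
    show "norm (rGamma z) \<le> exp (M * ?P)"
      by (rule LIMSEQ_le_const2[OF tendsto_norm[OF rGamma_Weierstrass_complex]]) (use bound in auto)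
  qed
qed

text \<open>With y = Im z, the two exponentials in the sine have moduli exp (-y) and exp y, so the
  reverse triangle inequality gives |sin z| >= sinh |y| >= |y|.\<close>

lemma norm_sin_ge_Im: "\<bar>Im z\<bar> \<le> norm (sin z)"
proof -
  have *: "y \<le> (exp y - exp (- y)) / 2" if "y \<ge> 0" for y :: real
  proof -
    have "sinh 0 - 0 \<le> sinh y - y"
    proof (rule DERIV_nonneg_imp_nondecreasing[OF that])
      fix t :: real
      show "\<exists>d. ((\<lambda>y. sinh y - y) has_real_derivative d) (at t) \<and> 0 \<le> d"
        by (rule exI[of _ "cosh t - 1"]) (auto intro!: derivative_eq_intros simp: cosh_real_ge_1)
    qed
    then show ?thesis by (simp add: sinh_def)
  qed
  have "2 * norm (sin z) = norm (exp (\<i> * z) - exp (- (\<i> * z)))"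
    by (simp add: sin_exp_eq norm_divide norm_mult)
  moreover have "norm (exp (\<i> * z)) = exp (- Im z)" "norm (exp (- (\<i> * z))) = exp (Im z)"
    by simp_all
  moreover have "\<bar>norm (exp (\<i> * z)) - norm (exp (- (\<i> * z)))\<bar> \<le> norm (exp (\<i> * z) - exp (- (\<i> * z)))"
    by (rule norm_triangle_ineq3)
  ultimately show ?thesis
    using *[of "Im z"] *[of "- Im z"] by (cases "Im z \<ge> 0") auto
qed

text \<open>The reflection formula expresses \<Gamma>(s) through 1/\<Gamma>(1 - s), whose growth is
  known, and 1/sin (\<pi>s), which is bounded at a positive distance from the real axis.\<close>

lemma order_bounded_Gamma_off_axis:
  assumes "d > 0"
  shows "order_bounded Gamma {s. \<bar>Im s\<bar> \<ge> d}"
proof (rule order_bounded_mono)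
  show "order_bounded (\<lambda>s. rGamma (1 + (-1) * s) * (1 / of_real d)) {s. \<bar>Im s\<bar> \<ge> d}"
    by (intro order_bounded_mult order_bounded_const order_bounded_affine[OF order_bounded_rGamma[of UNIV]]) auto
  fix s assume s: "s \<in> {s. \<bar>Im s\<bar> \<ge> d}"
  then have "s \<notin> \<int>\<^sub>\<le>\<^sub>0"
    using \<open>d > 0\<close> by (auto elim!: nonpos_Ints_cases)
  then have nz: "rGamma s \<noteq> 0" by (simp add: rGamma_eq_zero_iff)
  have "pi * d \<le> \<bar>Im (of_real pi * s)\<bar>"
    using s by (simp add: abs_mult)
  then have sn: "pi * d \<le> norm (sin (of_real pi * s))"
    using norm_sin_ge_Im order_trans by blast
  have pd: "pi * d > 0" using assms by simp
  have "Gamma s = rGamma (1 - s) * (of_real pi / sin (of_real pi * s))"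
  proof -
    have "sin (of_real pi * s) \<noteq> 0" using sn pd by auto
    then show ?thesis
      using rGamma_reflection_complex[of s] nz by (simp add: Gamma_def field_simps)
  qed
  moreover have "norm (of_real pi / sin (of_real pi * s)) \<le> 1 / d"
  proof -
    have "norm (of_real pi / sin (of_real pi * s)) \<le> pi / (pi * d)"
      unfolding norm_divide using sn pd by (intro frac_le) auto
    then show ?thesis by simp
  qed
  ultimately show "norm (Gamma s) \<le> norm (rGamma (1 + (-1) * s) * (1 / of_real d))"
    using assms mult_left_mono[of "norm (of_real pi / sin (of_real pi * s))" "1 / d" "norm (rGamma (1 - s))"]
    by (simp add: norm_mult norm_divide)
qed

text \<open>Near the positive real axis the sine in the reflection formula has zeros and yields no
  bound. There \<Gamma>(s) is compared with \<Gamma>(s + \<mu>) at a point shifted off the axis; the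
  quotient of the two is bounded because Re s >= e.\<close>

lemma order_bounded_Gamma:
  assumes "d > 0" "e > 0"
  shows "order_bounded Gamma {s. Re s \<ge> e \<or> \<bar>Im s\<bar> \<ge> d}"
proof -
  define d' where "d' = min d 1"
  have d': "d' > 0" "d' \<le> d" "d' \<le> 1" using assms by (auto simp: d'_def)
  obtain M1 where M1: "M1 \<ge> 0" "\<And>s. \<bar>Im s\<bar> \<ge> d' \<Longrightarrow> norm (Gamma s) \<le> exp (M1 * (1 + norm s) powr (3/2))"
    using order_bounded_Gamma_off_axis[OF d'(1)] unfolding order_bounded_def by auto
  \<comment> \<open>Im \<mu> = 2 turns |Im s| <= 1 into Im (s + \<mu>) >= 1, and Re \<mu> > 0 is
    what the bound of the quotient asks for.\<close>
  define \<mu> where "\<mu> = 1 + 2 * \<i>"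
  define B where "B = Beta e (Re \<mu>) * norm (rGamma \<mu>)"
  have "order_bounded (\<lambda>s. Gamma (\<mu> + 1 * s)) {s. \<bar>Im s\<bar> \<le> 1}"
    by (rule order_bounded_affine[OF order_bounded_Gamma_off_axis[of 1]]) (auto simp: \<mu>_def)
  then have "order_bounded (\<lambda>s. of_real B * Gamma (\<mu> + s)) {s. \<bar>Im s\<bar> \<le> 1}"
    by (intro order_bounded_mult order_bounded_const) auto
  then obtain M2 where M2: "M2 \<ge> 0"
    "\<And>s. \<bar>Im s\<bar> \<le> 1 \<Longrightarrow> norm (of_real B * Gamma (\<mu> + s)) \<le> exp (M2 * (1 + norm s) powr (3/2))"
    unfolding order_bounded_def by auto
  show ?thesis
  proof (rule order_boundedI[where M = "max M1 M2"])
    fix s assume s: "s \<in> {s. Re s \<ge> e \<or> \<bar>Im s\<bar> \<ge> d}"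
    show "norm (Gamma s) \<le> exp (max M1 M2 * (1 + norm s) powr (3/2))"
    proof (cases "\<bar>Im s\<bar> \<ge> d'")
      case True
      then show ?thesis
        using M1(2)[OF True] by (rule_tac order_trans) (auto intro!: mult_right_mono)
    next
      case False
      then have s': "Re s \<ge> e" "\<bar>Im s\<bar> \<le> 1" using s d' by auto
      have "Re (s + \<mu>) > 0" using s' assms by (simp add: \<mu>_def)
      then have "Gamma s = (Gamma s * rGamma (s + \<mu>)) * Gamma (\<mu> + s)"
        by (simp add: rGamma_inverse_Gamma Gamma_eq_zero_iff not_nonpos_Ints_Re_pos add.commute)
      then have "norm (Gamma s) = norm (Gamma s * rGamma (s + \<mu>)) * norm (Gamma (\<mu> + s))"
        by (metis norm_mult)
      also have "\<dots> \<le> B * norm (Gamma (\<mu> + s))"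
        unfolding B_def using s' assms by (intro mult_right_mono norm_Gamma_ratio_le) (auto simp: \<mu>_def)
      also have "\<dots> \<le> norm (of_real B * Gamma (\<mu> + s))"
        by (simp add: norm_mult mult_right_mono)
      also have "\<dots> \<le> exp (M2 * (1 + norm s) powr (3/2))"
        using M2 s' by blast
      also have "\<dots> \<le> exp (max M1 M2 * (1 + norm s) powr (3/2))"
        by (auto intro!: mult_right_mono)
      finally show ?thesis .
    qed
  qed
qed

section \<open>A Phragmen-Lindeloef argument for contour tails\<close>

text \<open>The factor \<open>exp (- e \<zeta>\<^sup>7\<^sup>/\<^sup>4)\<close> with \<open>\<zeta> = (z - z0) e\<^sup>-\<^sup>i\<^sup>\<pi>\<^sup>/\<^sup>4\<close>: the exponent lies above \<open>3/2\<close>, and below \<open>2\<close> so that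
  \<open>Re \<zeta>\<^sup>7\<^sup>/\<^sup>4 > 0\<close> when \<open>z - z0\<close> is in the first quadrant.\<close>

definition regulator :: "complex \<Rightarrow> real \<Rightarrow> complex \<Rightarrow> complex" where
  "regulator z0 e z = exp (- (of_real e * exp (7/4 * (Ln (z - z0) - \<i> * of_real (pi / 4)))))"

lemma holomorphic_regulator: "regulator z0 e holomorphic_on {z. Re z > Re z0 \<and> Im z > Im z0}"
  unfolding regulator_def by (intro holomorphic_intros) (auto simp: complex_nonpos_Reals_iff)

text \<open>For z - z0 in the open first quadrant the rotated argument lies between -\<pi>/4 and
  \<pi>/4, and the power 7/4 keeps it within 7\<pi>/16 < \<pi>/2. The cosine of this extreme angle
  is the constant of the decay.\<close>

lemma norm_regulator_le:
  assumes "e \<ge> 0" "Re z > Re z0" "Im z > Im z0"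
  shows "norm (regulator z0 e z) \<le> exp (- (e * cos (7 * pi / 16) * norm (z - z0) powr (7/4)))"
proof -
  let ?w = "z - z0"
  have w: "Re ?w > 0" "Im ?w > 0" using assms by auto
  then have nz: "?w \<noteq> 0" by auto
  define \<theta> where "\<theta> = Im (Ln ?w)"
  have \<theta>: "0 < \<theta>" "\<theta> < pi / 2"
    using Re_Ln_pos_lt_imp[OF w(1)] Im_Ln_pos_lt_imp[OF w(2)] by (auto simp: \<theta>_def)
  let ?W = "exp (7/4 * (Ln ?w - \<i> * of_real (pi / 4)))"
  have "\<bar>7/4 * (\<theta> - pi/4)\<bar> \<le> 7 * pi / 16"
  proof -
    have "\<bar>\<theta> - pi/4\<bar> \<le> pi/4" using \<theta> by (intro abs_leI) linarith+
    then show ?thesis unfolding abs_mult by simp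
  qed
  then have "cos (7 * pi / 16) \<le> cos \<bar>7/4 * (\<theta> - pi/4)\<bar>"
    by (intro cos_monotone_0_pi_le) auto
  then have c: "cos (7 * pi / 16) \<le> cos (7/4 * (\<theta> - pi/4))"
    by (simp only: cos_abs_real)
  have "Re ?W = exp (7/4 * ln (norm ?w)) * cos (7/4 * (\<theta> - pi/4))"
    unfolding Re_exp using nz by (simp add: \<theta>_def)
  also have "exp (7/4 * ln (norm ?w)) = norm ?w powr (7/4)"
    using nz by (simp add: powr_def)
  finally have "norm ?w powr (7/4) * cos (7 * pi / 16) \<le> Re ?W"
    using c by (simp add: mult_left_mono)
  then have "e * (norm ?w powr (7/4) * cos (7 * pi / 16)) \<le> e * Re ?W"
    using assms(1) by (rule mult_left_mono)
  moreover have "norm (regulator z0 e z) = exp (- (e * Re ?W))"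
    unfolding regulator_def norm_exp_eq_Re by simp
  ultimately show ?thesis by (simp add: mult_ac)
qed

lemma cos_7pi16: "cos (7 * pi / 16) > 0"
  by (rule cos_gt_zero) auto

lemma norm_regulator_le_1:
  assumes "e \<ge> 0" "Re z > Re z0" "Im z > Im z0"
  shows "norm (regulator z0 e z) \<le> 1"
proof -
  have "0 \<le> e * cos (7 * pi / 16) * norm (z - z0) powr (7/4)"
    using assms(1) cos_7pi16 by simp
  then show ?thesis
    using norm_regulator_le[OF assms] by (smt (verit) exp_le_one_iff)
qed

lemma tendsto_regulator:
  assumes "X \<longlonglongrightarrow> 0"
  shows "(\<lambda>n. regulator z0 (X n) z) \<longlonglongrightarrow> 1"
proof -
  have "(\<lambda>n. regulator z0 (X n) z) \<longlonglongrightarrow> exp (- (of_real 0 * exp (7/4 * (Ln (z - z0) - \<i> * of_real (pi / 4)))))"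
    unfolding regulator_def by (intro tendsto_intros assms)
  then show ?thesis by simp
qed

text \<open>The exponent 7/4 exceeds both 3/2 and 1. The additional 2r pays for an exponential decay
  that is left over once the growth of the integrand has been absorbed.\<close>

lemma bdd_above_growth:
  fixes M a k :: real
  assumes "k > 0" "M \<ge> 0" "a \<ge> 0"
  shows "\<exists>C. \<forall>r\<ge>0. M * (1 + a + r) powr (3/2) + 2 * r - k * r powr (7/4) \<le> C"
proof -
  let ?f = "\<lambda>r. M * (1 + a + r) powr (3/2) + 2 * r - k * r powr (7/4)"
  have "((\<lambda>r. (M * (1 + a + r) powr (3/2) + 2 * r) / r powr (7/4)) \<longlongrightarrow> 0) at_top"
    by real_asymp
  then have "eventually (\<lambda>r. (M * (1 + a + r) powr (3/2) + 2 * r) / r powr (7/4) < k) at_top"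
    using assms by (intro order_tendstoD)
  then have "eventually (\<lambda>r. ?f r \<le> 0) at_top"
    using eventually_gt_at_top[of 0] by eventually_elim (auto simp: divide_simps)
  then obtain R where R: "\<And>r. r \<ge> R \<Longrightarrow> ?f r \<le> 0"
    by (auto simp: eventually_at_top_linorder)
  have cont: "continuous_on {0..max R 0} ?f"
    using assms by (intro continuous_intros continuous_on_powr') auto
  have "{0..max R 0} \<noteq> {}" by simp
  then obtain r0 where r0: "\<And>r. r \<in> {0..max R 0} \<Longrightarrow> ?f r \<le> ?f r0"
    using continuous_attains_sup[OF compact_Icc _ cont] by blast
  have "?f r \<le> max 0 (?f r0)" if "r \<ge> 0" for r
    using R[of r] r0[of r] that by (cases "r \<ge> R") auto
  then show ?thesis by blast
qed

text \<open>The decay is measured by Re + Im instead of the modulus because this sum is affine along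
  segments and can be integrated exactly. It is at most 2 |z - z0|, hence the term 2r in
  \<open>bdd_above_growth\<close>.\<close>

lemma regulated_decay:
  assumes "e > 0" and f: "order_bounded f U" and U: "U \<subseteq> {z. Re z > Re z0 \<and> Im z > Im z0}"
  shows "\<exists>C\<ge>0. \<forall>z\<in>U. norm (f z * regulator z0 e z) \<le> C * exp (- (Re (z - z0) + Im (z - z0)))"
proof -
  obtain M where M: "M \<ge> 0" "\<And>z. z \<in> U \<Longrightarrow> norm (f z) \<le> exp (M * (1 + norm z) powr (3/2))"
    using f unfolding order_bounded_def by metis
  obtain C where C: "\<And>r. r \<ge> 0 \<Longrightarrow>
      M * (1 + norm z0 + r) powr (3/2) + 2 * r - (e * cos (7 * pi / 16)) * r powr (7/4) \<le> C"
    using bdd_above_growth[of "e * cos (7 * pi / 16)" M "norm z0"] assms(1) cos_7pi16 M(1) by auto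
  have "norm (f z * regulator z0 e z) \<le> exp C * exp (- (Re (z - z0) + Im (z - z0)))" if "z \<in> U" for z
  proof -
    let ?r = "norm (z - z0)"
    have z: "Re z > Re z0" "Im z > Im z0" using that U by auto
    have "M * (1 + norm z) powr (3/2) \<le> M * (1 + norm z0 + ?r) powr (3/2)"
      using norm_triangle_ineq[of z0 "z - z0"] M(1) by (intro mult_left_mono powr_mono2) auto
    then have "norm (f z) \<le> exp (M * (1 + norm z0 + ?r) powr (3/2))"
      using M(2)[OF that] by (meson exp_le_cancel_iff order_trans)
    moreover have "norm (regulator z0 e z) \<le> exp (- (e * cos (7 * pi / 16) * ?r powr (7/4)))"
      using assms(1) z by (intro norm_regulator_le) auto
    ultimately have "norm (f z * regulator z0 e z) \<le>
        exp (M * (1 + norm z0 + ?r) powr (3/2)) * exp (- (e * cos (7 * pi / 16) * ?r powr (7/4)))"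
      unfolding norm_mult by (intro mult_mono) auto
    also have "\<dots> \<le> exp (C - 2 * ?r)"
      using C[of ?r] by (simp flip: exp_add)
    also have "\<dots> \<le> exp (C - (Re (z - z0) + Im (z - z0)))"
      using complex_Re_le_cmod[of "z - z0"] abs_Im_le_cmod[of "z - z0"] by simp
    finally show ?thesis by (simp only: diff_conv_add_uminus exp_add)
  qed
  then show ?thesis by (intro exI[of _ "exp C"]) auto
qed

section \<open>Tails of curves going up or to the right inside a quadrant\<close>

text \<open>Closure under moving up and to the right gives any two points a common successor that is
  reached by segments inside the domain, and starlikeness provides primitives. Convexity is not
  demanded, since the region that the poles leave free is L-shaped
  (\<open>upper_region\<close>).\<close>

definition quadrant_domain :: "complex \<Rightarrow> complex set \<Rightarrow> bool" where
  "quadrant_domain z0 U \<longleftrightarrow> open U \<and> starlike U \<and> U \<subseteq> {z. Re z > Re z0 \<and> Im z > Im z0} \<and>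
     (\<forall>p\<in>U. \<forall>q. Re p \<le> Re q \<longrightarrow> Im p \<le> Im q \<longrightarrow> q \<in> U)"

text \<open>Divergence of Re + Im is the common feature of a tail rising at bounded real part and of
  a tail running to the right at bounded height.\<close>

definition up_tail :: "complex set \<Rightarrow> (real \<Rightarrow> complex) \<Rightarrow> real \<Rightarrow> bool" where
  "up_tail U \<gamma> T \<longleftrightarrow> (\<forall>T'. \<gamma> piecewise_C1_differentiable_on {T..T'}) \<and> (\<forall>t\<ge>T. \<gamma> t \<in> U) \<and>
     filterlim (\<lambda>t. Re (\<gamma> t) + Im (\<gamma> t)) at_top at_top"

text \<open>The Fox integral is written with the two-sided derivative, the fundamental theorem with
  the derivative within the interval; inside the interval they agree, so only the two ends have to
  be discarded.\<close>

lemma has_integral_primitive_real: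
  fixes F f :: "complex \<Rightarrow> complex"
  assumes "a \<le> b" and F: "\<And>z. z \<in> S \<Longrightarrow> (F has_field_derivative f z) (at z within S)"
    and "\<gamma> piecewise_C1_differentiable_on {a..b}" "\<And>x. x \<in> {a..b} \<Longrightarrow> \<gamma> x \<in> S"
  shows "((\<lambda>x. f (\<gamma> x) * vector_derivative \<gamma> (at x)) has_integral (F (\<gamma> b) - F (\<gamma> a))) {a..b}"
proof (rule has_integral_spike_finite[of "{a, b}"])
  show "((\<lambda>x. f (\<gamma> x) * vector_derivative \<gamma> (at x within {a..b})) has_integral (F (\<gamma> b) - F (\<gamma> a))) {a..b}"
    using assms by (intro contour_integral_primitive_lemma[where S = S] piecewise_C1_imp_differentiable)
  fix x assume "x \<in> {a..b} - {a, b}"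
  then show "f (\<gamma> x) * vector_derivative \<gamma> (at x) = f (\<gamma> x) * vector_derivative \<gamma> (at x within {a..b})"
    by (auto simp: at_within_Icc_at)
qed auto

lemma tail_limit:
  assumes F: "\<And>z. z \<in> U \<Longrightarrow> (F has_field_derivative f z) (at z)"
    and \<gamma>: "up_tail U \<gamma> T"
    and int: "set_integrable lebesgue {T..} (\<lambda>t. f (\<gamma> t) * vector_derivative \<gamma> (at t))"
  shows "((\<lambda>\<tau>. F (\<gamma> \<tau>)) \<longlongrightarrow> F (\<gamma> T) + (LINT t:{T..}|lebesgue. f (\<gamma> t) * vector_derivative \<gamma> (at t))) at_top"
proof -
  let ?I = "\<lambda>S. LINT t:S|lebesgue. f (\<gamma> t) * vector_derivative \<gamma> (at t)"
  have "((\<lambda>b. ?I {T..b}) \<longlongrightarrow> ?I {T..}) at_top"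
    by (rule tendsto_set_lebesgue_integral_at_top[OF _ int]) auto
  then have "((\<lambda>b. F (\<gamma> T) + ?I {T..b}) \<longlongrightarrow> F (\<gamma> T) + ?I {T..}) at_top"
    by (intro tendsto_intros)
  moreover have "eventually (\<lambda>b. F (\<gamma> T) + ?I {T..b} = F (\<gamma> b)) at_top"
    using eventually_ge_at_top[of T]
  proof eventually_elim
    case (elim b)
    have "set_integrable lebesgue {T..b} (\<lambda>t. f (\<gamma> t) * vector_derivative \<gamma> (at t))"
      by (rule set_integrable_subset[OF int]) auto
    then have "((\<lambda>t. f (\<gamma> t) * vector_derivative \<gamma> (at t)) has_integral ?I {T..b}) {T..b}"
      by (rule has_integral_set_lebesgue)
    moreover have "((\<lambda>t. f (\<gamma> t) * vector_derivative \<gamma> (at t)) has_integral (F (\<gamma> b) - F (\<gamma> T))) {T..b}"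
      using \<gamma> elim F
      by (intro has_integral_primitive_real[where S = U])
         (auto simp: up_tail_def intro: has_field_derivative_at_within)
    ultimately have "?I {T..b} = F (\<gamma> b) - F (\<gamma> T)" by (rule has_integral_unique)
    then show ?case by simp
  qed
  ultimately show ?thesis by (rule Lim_transform_eventually)
qed

text \<open>On an ascending segment |m - p| <= h(m) - h(p) with h = Re + Im, so the derivative of
  \<open>F\<close> along it is dominated by that of -C exp (-h). The resulting bound depends on the
  starting point only, however long the segment is.\<close>

lemma primitive_decay_segment:
  fixes F f :: "complex \<Rightarrow> complex"
  assumes U: "\<And>q. Re p \<le> Re q \<Longrightarrow> Im p \<le> Im q \<Longrightarrow> q \<in> U"
    and F: "\<And>z. z \<in> U \<Longrightarrow> (F has_field_derivative f z) (at z)"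
    and C: "C \<ge> 0" "\<And>z. z \<in> U \<Longrightarrow> norm (f z) \<le> C * exp (- (Re (z - z0) + Im (z - z0)))"
    and m: "Re p \<le> Re m" "Im p \<le> Im m"
  shows "norm (F m - F p) \<le> C * exp (- (Re (p - z0) + Im (p - z0)))"
proof -
  let ?h = "\<lambda>z. Re (z - z0) + Im (z - z0)"
  let ?l = "\<lambda>s. p + of_real s * (m - p)"
  have lU: "?l s \<in> U" if "0 \<le> s" for s
    using m that by (intro U) auto
  have hl: "?h (?l s) = ?h p + s * (?h m - ?h p)" for s
    by (simp add: algebra_simps)
  have "norm ((F \<circ> ?l) 1 - (F \<circ> ?l) 0) \<le> - (C * exp (- ?h (?l 1))) - (- (C * exp (- ?h (?l 0))))"
  proof (rule differentiable_bound_general[where f' = "\<lambda>s. f (?l s) * (m - p)" and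
        \<phi>' = "\<lambda>s. (?h m - ?h p) * (C * exp (- ?h (?l s)))"])
    have der: "((F \<circ> ?l) has_vector_derivative f (?l s) * (m - p)) (at s)" if "s \<ge> 0" for s
    proof -
      have "(?l has_vector_derivative (m - p)) (at s)"
        by (auto intro!: derivative_eq_intros)
      from field_vector_diff_chain_at[OF this F[OF lU[OF that]]]
      show ?thesis by (simp add: mult.commute)
    qed
    then show "((F \<circ> ?l) has_vector_derivative f (?l s) * (m - p)) (at s)" if "0 < s" "s < 1" for s
      using that by simp
    show "continuous_on {0..1} (F \<circ> ?l)"
      using has_vector_derivative_continuous[OF der] by (intro continuous_at_imp_continuous_on) auto
    show "continuous_on {0..1} (\<lambda>s. - (C * exp (- ?h (?l s))))"
      by (intro continuous_intros)
    show "((\<lambda>s. - (C * exp (- ?h (?l s)))) has_vector_derivative (?h m - ?h p) * (C * exp (- ?h (?l s)))) (at s)" for s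
      unfolding hl has_real_derivative_iff_has_vector_derivative[symmetric]
      by (auto intro!: derivative_eq_intros simp: algebra_simps)
    show "norm (f (?l s) * (m - p)) \<le> (?h m - ?h p) * (C * exp (- ?h (?l s)))" if "0 < s" "s < 1" for s
    proof -
      have "norm (m - p) \<le> ?h m - ?h p"
        using cmod_le[of "m - p"] m by simp
      moreover have "norm (f (?l s)) \<le> C * exp (- ?h (?l s))"
        using that by (intro C(2) lU) auto
      ultimately show ?thesis
        using mult_mono[of "norm (m - p)" "?h m - ?h p" "norm (f (?l s))" "C * exp (- ?h (?l s))"] m
        by (simp add: norm_mult mult.commute)
    qed
  qed auto
  also have "\<dots> \<le> C * exp (- ?h p)"
    using C(1) by simp
  finally show ?thesis by simp
qed

text \<open>For a regulated integrand the primitive has a limit at infinity, the same along both tails.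
  Removing the regulator, whose norm is at most one, is a matter of dominated convergence.\<close>

theorem Phragmen_Lindeloef_tails:
  assumes U: "quadrant_domain z0 U"
    and f: "f holomorphic_on U" "order_bounded f U"
    and F: "\<And>z. z \<in> U \<Longrightarrow> (F has_field_derivative f z) (at z)"
    and \<gamma>: "up_tail U \<gamma>1 T1" "up_tail U \<gamma>2 T2"
    and int1: "set_integrable lebesgue {T1..} (\<lambda>t. f (\<gamma>1 t) * vector_derivative \<gamma>1 (at t))"
    and int2: "set_integrable lebesgue {T2..} (\<lambda>t. f (\<gamma>2 t) * vector_derivative \<gamma>2 (at t))"
  shows "F (\<gamma>1 T1) + (LINT t:{T1..}|lebesgue. f (\<gamma>1 t) * vector_derivative \<gamma>1 (at t)) =
         F (\<gamma>2 T2) + (LINT t:{T2..}|lebesgue. f (\<gamma>2 t) * vector_derivative \<gamma>2 (at t))"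
proof -
  have oU: "open U" and sU: "starlike U" and qU: "U \<subseteq> {z. Re z > Re z0 \<and> Im z > Im z0}"
    and uU: "\<And>p q. p \<in> U \<Longrightarrow> Re p \<le> Re q \<Longrightarrow> Im p \<le> Im q \<Longrightarrow> q \<in> U"
    using U by (auto simp: quadrant_domain_def)
  obtain E where E: "E \<in> U" "\<And>y. y \<in> U \<Longrightarrow> closed_segment E y \<subseteq> U"
    using sU by (auto simp: starlike_def)
  define fr where "fr n z = f z * regulator z0 (1 / real (Suc n)) z" for n z
  have reg1: "norm (regulator z0 (1 / real (Suc n)) z) \<le> 1" if "z \<in> U" for n z
    using that qU by (intro norm_regulator_le_1) auto
  have frle: "norm (fr n z) \<le> norm (f z)" if "z \<in> U" for n z
    using reg1[OF that] by (simp add: fr_def norm_mult mult_left_le)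
  have X0: "(\<lambda>n. 1 / real (Suc n)) \<longlonglongrightarrow> 0"
    using LIMSEQ_inverse_real_of_nat by (simp add: inverse_eq_divide)
  have frlim: "(\<lambda>n. fr n z) \<longlonglongrightarrow> f z" for z
    unfolding fr_def using tendsto_mult[OF tendsto_const tendsto_regulator[OF X0]] by simp
  have frhol: "fr n holomorphic_on U" for n
    unfolding fr_def using f(1) holomorphic_on_subset[OF holomorphic_regulator qU]
    by (intro holomorphic_intros)
  \<comment> \<open>Primitives of the regulated integrands vary with n and have no common
    normalisation. The integral over the segment from the fixed star centre \<open>E\<close>
    replaces them, and it does pass to the limit.\<close>
  have seg: "contour_integral (linepath E p) g = G p - G E"
    if "p \<in> U" "\<And>z. z \<in> U \<Longrightarrow> (G has_field_derivative g z) (at z)" for p g G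
    using contour_integral_primitive[of U G g "linepath E p"] that E
    by (intro contour_integral_unique) (auto intro: has_field_derivative_at_within)
  have segint: "g contour_integrable_on linepath E p" if "p \<in> U" "g holomorphic_on U" for p g
    using that E by (intro contour_integrable_continuous_linepath)
      (meson holomorphic_on_imp_continuous_on holomorphic_on_subset)
  have seglim: "(\<lambda>n. contour_integral (linepath E p) (fr n)) \<longlonglongrightarrow> contour_integral (linepath E p) f"
    if p: "p \<in> U" for p
  proof -
    have lp: "linepath E p x \<in> U" if "x \<in> {0..1}" for x
      using E(2)[OF p] that linepath_in_path[of x E p] by auto
    show ?thesis
      unfolding contour_integral_integral vector_derivative_linepath_at
    proof (rule dominated_convergence(2)[where h = "\<lambda>x. norm (f (linepath E p x) * (p - E))"])
      show "(\<lambda>x. fr k (linepath E p x) * (p - E)) integrable_on {0..1}" for k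
        using segint[OF p frhol] unfolding contour_integrable_on by simp
      have "continuous_on {0..1} (f \<circ> linepath E p)"
        using f(1) lp by (intro continuous_on_compose continuous_on_linepath)
          (meson holomorphic_on_imp_continuous_on continuous_on_subset image_subsetI)
      then show "(\<lambda>x. norm (f (linepath E p x) * (p - E))) integrable_on {0..1}"
        by (intro integrable_continuous_real continuous_intros) (simp add: o_def)
    qed (use lp frle frlim in \<open>auto simp: norm_mult intro!: mult_right_mono tendsto_intros\<close>)
  qed
  have tail_n: "set_integrable lebesgue {T..} (\<lambda>t. fr n (\<gamma> t) * vector_derivative \<gamma> (at t))"
      "(\<lambda>n. LINT t:{T..}|lebesgue. fr n (\<gamma> t) * vector_derivative \<gamma> (at t)) \<longlonglongrightarrow>
        (LINT t:{T..}|lebesgue. f (\<gamma> t) * vector_derivative \<gamma> (at t))"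
    if \<gamma>: "up_tail U \<gamma> T"
      and int: "set_integrable lebesgue {T..} (\<lambda>t. f (\<gamma> t) * vector_derivative \<gamma> (at t))" for \<gamma> T n
  proof -
    have \<gamma>U: "\<gamma> t \<in> U" if "t \<in> {T..}" for t using \<gamma> that by (auto simp: up_tail_def)
    have cont: "continuous_on {T..} \<gamma>"
    proof -
      have "continuous (at t within {T..}) \<gamma>" if "t \<in> {T..}" for t
      proof -
        have "continuous_on {T..t + 1} \<gamma>"
          using \<gamma> by (auto simp: up_tail_def piecewise_C1_differentiable_on_def)
        then have "continuous (at t within {T..t + 1}) \<gamma>"
          using that by (auto simp: continuous_on_eq_continuous_within)
        moreover have "at t within {T..t + 1} = at t within {T..}"
          by (rule at_within_nhd[where S = "{t - 1<..<t + 1}"]) (use that in auto)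
        ultimately show ?thesis by simp
      qed
      then show ?thesis by (simp add: continuous_on_eq_continuous_within)
    qed
    have contR: "continuous_on {T..} (\<lambda>t. regulator z0 (1 / real (Suc n)) (\<gamma> t))" for n
      by (rule continuous_on_compose2[OF holomorphic_on_imp_continuous_on[OF holomorphic_regulator] cont])
         (use \<gamma>U qU in auto)
    let ?d = "\<lambda>t. f (\<gamma> t) * vector_derivative \<gamma> (at t)"
    \<comment> \<open>Measurability of the velocity is available only inside the integrable product
      with \<open>f\<close>; the regulated integrand is therefore that product times a function
      continuous on the tail.\<close>
    have eq: "indicator {T..} t *\<^sub>R (fr n (\<gamma> t) * vector_derivative \<gamma> (at t)) =
        (indicator {T..} t *\<^sub>R regulator z0 (1 / real (Suc n)) (\<gamma> t)) * (indicator {T..} t *\<^sub>R ?d t)" for n t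
      by (auto simp: fr_def indicator_def)
    have meas: "(\<lambda>t. indicator {T..} t *\<^sub>R (fr n (\<gamma> t) * vector_derivative \<gamma> (at t))) \<in> borel_measurable lebesgue" for n
      unfolding eq
    proof (rule borel_measurable_times)
      show "(\<lambda>t. indicat_real {T..} t *\<^sub>R regulator z0 (1 / real (Suc n)) (\<gamma> t)) \<in> borel_measurable lebesgue"
        using borel_measurable_continuous_on_indicator[OF _ contR] by (intro measurable_completion) simp
      show "(\<lambda>t. indicat_real {T..} t *\<^sub>R ?d t) \<in> borel_measurable lebesgue"
        using int by (auto simp: set_integrable_def)
    qed
    have le: "norm (indicator {T..} t *\<^sub>R (fr n (\<gamma> t) * vector_derivative \<gamma> (at t))) \<le> norm (indicator {T..} t *\<^sub>R ?d t)" for n t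
      using frle[of "\<gamma> t" n] \<gamma>U[of t] by (auto simp: indicator_def norm_mult intro!: mult_right_mono)
    show "set_integrable lebesgue {T..} (\<lambda>t. fr n (\<gamma> t) * vector_derivative \<gamma> (at t))"
      using int meas le unfolding set_integrable_def
      by (intro Bochner_Integration.integrable_bound[OF _ meas AE_I2[OF le]]) auto
    show "(\<lambda>n. LINT t:{T..}|lebesgue. fr n (\<gamma> t) * vector_derivative \<gamma> (at t)) \<longlonglongrightarrow>
        (LINT t:{T..}|lebesgue. f (\<gamma> t) * vector_derivative \<gamma> (at t))"
      unfolding set_lebesgue_integral_def
    proof (rule integral_dominated_convergence[where w = "\<lambda>t. norm (indicator {T..} t *\<^sub>R ?d t)"])
      show "(\<lambda>t. indicator {T..} t *\<^sub>R ?d t) \<in> borel_measurable lebesgue"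
        "integrable lebesgue (\<lambda>t. norm (indicator {T..} t *\<^sub>R ?d t))"
        using int integrable_norm[OF int[unfolded set_integrable_def]] by (auto simp only: set_integrable_def intro: borel_measurable_integrable)
    qed (use meas le in \<open>auto intro!: AE_I2 tendsto_intros frlim\<close>)
  qed
  let ?J = "\<lambda>p g. contour_integral (linepath E p) g"
  let ?I = "\<lambda>\<gamma> T g. LINT t:{T..}|lebesgue. g (\<gamma> t) * vector_derivative \<gamma> (at t)"
  have \<gamma>U: "\<gamma>1 t \<in> U" if "t \<ge> T1" for t using \<gamma>(1) that by (auto simp: up_tail_def)
  have \<gamma>U2: "\<gamma>2 t \<in> U" if "t \<ge> T2" for t using \<gamma>(2) that by (auto simp: up_tail_def)
  have reg_eq: "?J (\<gamma>1 T1) (fr n) + ?I \<gamma>1 T1 (fr n) = ?J (\<gamma>2 T2) (fr n) + ?I \<gamma>2 T2 (fr n)" for n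
  proof -
    obtain G where G: "\<And>z. z \<in> U \<Longrightarrow> (G has_field_derivative fr n z) (at z)"
      using holomorphic_starlike_primitive[OF holomorphic_on_imp_continuous_on[OF frhol] sU oU, of "{}" n]
        holomorphic_on_imp_differentiable_at[OF frhol oU] by auto
    obtain C where C: "C \<ge> 0" "\<And>z. z \<in> U \<Longrightarrow> norm (fr n z) \<le> C * exp (- (Re (z - z0) + Im (z - z0)))"
      using regulated_decay[OF _ f(2) qU, of "1 / real (Suc n)"] unfolding fr_def by auto
    note l1 = tail_limit[OF G \<gamma>(1) tail_n(1)[OF \<gamma>(1) int1]]
    note l2 = tail_limit[OF G \<gamma>(2) tail_n(1)[OF \<gamma>(2) int2]]
    let ?h = "\<lambda>z. Re (z - z0) + Im (z - z0)"
    have dec: "((\<lambda>\<tau>. C * exp (- ?h (\<gamma> \<tau>))) \<longlongrightarrow> 0) at_top" if "up_tail U \<gamma> T" for \<gamma> T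
    proof -
      have "filterlim (\<lambda>t. (- Re z0 - Im z0) + (Re (\<gamma> t) + Im (\<gamma> t))) at_top at_top"
        using that by (intro filterlim_tendsto_add_at_top[OF tendsto_const]) (auto simp: up_tail_def)
      then have "filterlim (\<lambda>t. ?h (\<gamma> t)) at_top at_top" by (simp add: algebra_simps)
      then have "filterlim (\<lambda>t. - ?h (\<gamma> t)) at_bot at_top" by (simp only: filterlim_uminus_at_top)
      then have "((\<lambda>\<tau>. exp (- ?h (\<gamma> \<tau>))) \<longlongrightarrow> 0) at_top"
        by (rule filterlim_compose[OF exp_at_bot])
      then show ?thesis by (rule tendsto_mult_right_zero)
    qed
    have "((\<lambda>\<tau>. G (\<gamma>1 \<tau>) - G (\<gamma>2 \<tau>)) \<longlongrightarrow> 0) at_top"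
    proof (rule Lim_null_comparison)
      show "((\<lambda>\<tau>. C * exp (- ?h (\<gamma>1 \<tau>)) + C * exp (- ?h (\<gamma>2 \<tau>))) \<longlongrightarrow> 0) at_top"
        using tendsto_add[OF dec[OF \<gamma>(1)] dec[OF \<gamma>(2)]] by simp
      show "\<forall>\<^sub>F \<tau> in at_top. norm (G (\<gamma>1 \<tau>) - G (\<gamma>2 \<tau>)) \<le> C * exp (- ?h (\<gamma>1 \<tau>)) + C * exp (- ?h (\<gamma>2 \<tau>))"
        using eventually_ge_at_top[of "max T1 T2"]
      proof eventually_elim
        case (elim \<tau>)
        \<comment> \<open>The coordinatewise maximum lies up and to the right of both points, so
          each is joined to it by an ascending segment along which the primitive changes by an
          exponentially small amount.\<close>
        let ?m = "Complex (max (Re (\<gamma>1 \<tau>)) (Re (\<gamma>2 \<tau>))) (max (Im (\<gamma>1 \<tau>)) (Im (\<gamma>2 \<tau>)))"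
        have "norm (G ?m - G (\<gamma>1 \<tau>)) \<le> C * exp (- ?h (\<gamma>1 \<tau>))"
          using elim by (intro primitive_decay_segment[of "\<gamma>1 \<tau>" U, OF uU[OF \<gamma>U] G C]) auto
        moreover have "norm (G ?m - G (\<gamma>2 \<tau>)) \<le> C * exp (- ?h (\<gamma>2 \<tau>))"
          using elim by (intro primitive_decay_segment[of "\<gamma>2 \<tau>" U, OF uU[OF \<gamma>U2] G C]) auto
        moreover have "norm (G (\<gamma>1 \<tau>) - G (\<gamma>2 \<tau>)) \<le> norm (G ?m - G (\<gamma>2 \<tau>)) + norm (G ?m - G (\<gamma>1 \<tau>))"
          by (metis add.commute dist_norm dist_triangle3)
        ultimately show ?case by linarith
      qed
    qed
    moreover have "((\<lambda>\<tau>. G (\<gamma>1 \<tau>) - G (\<gamma>2 \<tau>)) \<longlongrightarrow>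
        (G (\<gamma>1 T1) + ?I \<gamma>1 T1 (fr n)) - (G (\<gamma>2 T2) + ?I \<gamma>2 T2 (fr n))) at_top"
      by (intro tendsto_diff l1 l2)
    ultimately have "(G (\<gamma>1 T1) + ?I \<gamma>1 T1 (fr n)) - (G (\<gamma>2 T2) + ?I \<gamma>2 T2 (fr n)) = 0"
      using tendsto_unique[OF trivial_limit_at_top_linorder] by blast
    then show ?thesis
      using seg[OF \<gamma>U[OF order_refl] G] seg[OF \<gamma>U2[OF order_refl] G] by simp
  qed
  have "?J (\<gamma>1 T1) f + ?I \<gamma>1 T1 f = ?J (\<gamma>2 T2) f + ?I \<gamma>2 T2 f"
  proof (rule LIMSEQ_unique)
    show "(\<lambda>n. ?J (\<gamma>1 T1) (fr n) + ?I \<gamma>1 T1 (fr n)) \<longlonglongrightarrow> ?J (\<gamma>1 T1) f + ?I \<gamma>1 T1 f"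
      by (intro tendsto_add seglim \<gamma>U tail_n(2)[OF \<gamma>(1) int1]) auto
    show "(\<lambda>n. ?J (\<gamma>1 T1) (fr n) + ?I \<gamma>1 T1 (fr n)) \<longlonglongrightarrow> ?J (\<gamma>2 T2) f + ?I \<gamma>2 T2 f"
      unfolding reg_eq by (intro tendsto_add seglim \<gamma>U2 tail_n(2)[OF \<gamma>(2) int2]) auto
  qed
  then show ?thesis
    using seg[OF \<gamma>U[OF order_refl] F] seg[OF \<gamma>U2[OF order_refl] F] by simp
qed

section \<open>Contours, winding numbers and residues\<close>

lemma finite_affine_vimage:
  fixes m c :: real
  assumes "finite K" "m \<noteq> 0"
  shows "finite ((\<lambda>s. m * s + c) -` K)"
  using assms by (intro finite_vimageI injI) auto

lemma convex_box_ge_ge: "convex {z. a \<le> Re z \<and> b \<le> Im z}"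
  using convex_Int[OF convex_halfspace_Re_ge convex_halfspace_Im_ge] by (simp add: Collect_conj_eq)

lemma convex_box_ge_le: "convex {z. a \<le> Re z \<and> Im z \<le> b}"
  using convex_Int[OF convex_halfspace_Re_ge convex_halfspace_Im_le] by (simp add: Collect_conj_eq)

lemma segment_up_right:
  assumes "z \<in> closed_segment a b" "Re a \<le> Re b" "Im a \<le> Im b"
  shows "Re a \<le> Re z" "Im a \<le> Im z"
  using assms closed_segment_subset[OF _ _ convex_box_ge_ge, of a "Re a" "Im a" b] by auto

lemma segment_down_right:
  assumes "z \<in> closed_segment b a" "Re a \<le> Re b" "Im b \<le> Im a"
  shows "Re a \<le> Re z" "Im z \<le> Im a"
  using assms closed_segment_subset[OF _ _ convex_box_ge_le, of b "Re a" "Im a" a] by auto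

lemma segment_vertical:
  assumes "z \<in> closed_segment (Complex k a) (Complex k b)"
  shows "Re z = k"
proof -
  obtain u where "z = (1 - u) *\<^sub>R Complex k a + u *\<^sub>R Complex k b"
    using assms by (auto simp: closed_segment_def)
  then have "Re z = (1 - u) * k + u * k" by simp
  then show ?thesis by (simp add: algebra_simps)
qed

lemma segment_Re_le:
  assumes "z \<in> closed_segment a b" "Re a \<le> k" "Re b \<le> k"
  shows "Re z \<le> k"
  using assms closed_segment_subset[OF _ _ convex_halfspace_Re_le[of k], of a b] by auto

lemma segment_Re_ge:
  assumes "z \<in> closed_segment a b" "k \<le> Re a" "k \<le> Re b"
  shows "k \<le> Re z"
  using assms closed_segment_subset[OF _ _ convex_halfspace_Re_ge[of k], of a b] by auto

section \<open>Closing a finite arc of the contour far to the right; winding numbers of the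
  cycle\<close>

text \<open>The common features of vertical contours and of loops around the right-hand poles: a
  real part bounded below, ends that leave every bounded set to the right, or upwards and downwards
  respectively, and a horizontal ray at height \<open>\<eta>\<close> that is free from the abscissa
  \<open>M\<close> on. The start of this ray serves as the base point of the right side.\<close>

locale escaping_contour =
  fixes L :: "real \<Rightarrow> complex" and C M \<eta> :: real
  assumes pwC1: "\<And>T. L piecewise_C1_differentiable_on {-T..T}"
    and Re_ge: "\<And>t. - C \<le> Re (L t)"
    and escape: "\<And>\<rho>. \<exists>T0. \<forall>T\<ge>T0. (\<rho> < Re (L T) \<or> \<rho> < Im (L T)) \<and>
                       (\<rho> < Re (L (- T)) \<or> Im (L (- T)) < - \<rho>)"
    and slit: "\<And>t. M \<le> Re (L t) \<Longrightarrow> Im (L t) \<noteq> \<eta>"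
    and ends: "\<exists>T0. \<forall>T\<ge>T0. \<eta> < Im (L T) \<and> Im (L (- T)) < \<eta>"
begin

definition finite_arc :: "real \<Rightarrow> real \<Rightarrow> complex" where
  "finite_arc T s = L (2 * T * s - T)"

text \<open>For large parameters this path stays above, to the right of or below any given bounded
  set. After the arc, which runs from the lower end to the upper one, it completes a clockwise
  cycle; hence the winding number -1 on the right side.\<close>

definition closing :: "real \<Rightarrow> real \<Rightarrow> real \<Rightarrow> real \<Rightarrow> complex" where
  "closing T K H = linepath (L T) (Complex K H) +++ linepath (Complex K H) (Complex K (- H)) +++
     linepath (Complex K (- H)) (L (- T))"

definition cycle :: "real \<Rightarrow> real \<Rightarrow> real \<Rightarrow> real \<Rightarrow> complex" where
  "cycle T K H = finite_arc T +++ closing T K H"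

lemma continuous_L: "continuous_on UNIV L"
proof (rule continuous_at_imp_continuous_on, rule ballI)
  fix t
  have "continuous_on {- (\<bar>t\<bar> + 1)..\<bar>t\<bar> + 1} L"
    using pwC1[of "\<bar>t\<bar> + 1"] by (simp add: piecewise_C1_differentiable_on_def)
  then show "isCont L t" by (rule continuous_on_interior) auto
qed

lemma arc_ends [simp]: "pathstart (finite_arc T) = L (- T)" "pathfinish (finite_arc T) = L T"
  by (auto simp: finite_arc_def pathstart_def pathfinish_def)

lemma closing_ends [simp]: "pathstart (closing T K H) = L T" "pathfinish (closing T K H) = L (- T)"
  by (auto simp: closing_def)

lemma arc_image_eq: "T > (0::real) \<Longrightarrow> (\<lambda>s. 2 * T * s - T) ` {0..1} = {- T..T}"
  by (simp add: image_affinity_atLeastAtMost_diff)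

lemma path_image_arc: "T > 0 \<Longrightarrow> path_image (finite_arc T) = L ` {- T..T}"
  unfolding path_image_def finite_arc_def[abs_def] using arc_image_eq[of T]
  by (metis (no_types, lifting) image_image image_cong)

lemma valid_path_arc: "T > 0 \<Longrightarrow> valid_path (finite_arc T)"
proof -
  assume T: "T > 0"
  have "(L \<circ> (\<lambda>x. (2 * T) *\<^sub>R x + - T)) piecewise_C1_differentiable_on {0..1}"
    using pwC1[of T] arc_image_eq[OF T] by (intro piecewise_C1_differentiable_affine) simp
  then show ?thesis by (simp add: valid_path_def finite_arc_def[abs_def] o_def)
qed

lemma valid_path_closing: "valid_path (closing T K H)"
  by (simp add: closing_def valid_path_join)

lemma valid_path_cycle: "T > 0 \<Longrightarrow> valid_path (cycle T K H)"
  by (simp add: cycle_def valid_path_arc valid_path_closing valid_path_join)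

lemma path_image_closing:
  "path_image (closing T K H) = closed_segment (L T) (Complex K H) \<union>
     closed_segment (Complex K H) (Complex K (- H)) \<union> closed_segment (Complex K (- H)) (L (- T))"
  by (auto simp: closing_def path_image_join)

lemma path_image_cycle:
  "T > 0 \<Longrightarrow> path_image (cycle T K H) = L ` {- T..T} \<union> path_image (closing T K H)"
  by (simp add: cycle_def path_image_join path_image_arc)

lemma cycle_loop: "pathfinish (cycle T K H) = pathstart (cycle T K H)"
  by (simp add: cycle_def)

lemma has_contour_integral_arc:
  assumes T: "T > 0"
    and I: "((\<lambda>t. f (L t) * vector_derivative L (at t)) has_integral I) {- T..T}"
  shows "(f has_contour_integral I) (finite_arc T)"
proof -
  let ?F = "\<lambda>t. f (L t) * vector_derivative L (at t)"
  have "((\<lambda>s. ?F ((2 * T) *\<^sub>R s + - T)) has_integral (I /\<^sub>R (2 * T) ^ DIM(real)))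
           (cbox ((- T - - T) /\<^sub>R (2 * T)) ((T - - T) /\<^sub>R (2 * T)))"
    using I T by (intro has_integral_affinity') auto
  then have "((\<lambda>s. ?F (2 * T * s - T)) has_integral (I /\<^sub>R (2 * T))) {0..1}"
    using T by simp
  then have *: "((\<lambda>s. (2 * T) *\<^sub>R ?F (2 * T * s - T)) has_integral (2 * T) *\<^sub>R (I /\<^sub>R (2 * T))) {0..1}"
    by (rule has_integral_cmul)
  obtain S where S: "finite S" "L C1_differentiable_on {- T..T} - S"
    using pwC1[of T] by (auto simp: piecewise_C1_differentiable_on_def)
  \<comment> \<open>Away from the two end points and the preimages of the exceptional points of
    \<open>L\<close>, the reparametrised arc is differentiable and the chain rule gives its
    derivative within the unit interval.\<close>
  let ?N = "{0, 1} \<union> (\<lambda>s. 2 * T * s + - T) -` S"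
  have "((\<lambda>s. f (finite_arc T s) * vector_derivative (finite_arc T) (at s within {0..1})) has_integral I) {0..1}"
  proof (rule has_integral_spike_finite[of ?N])
    show "finite ?N" using finite_affine_vimage[OF S(1), of "2 * T" "- T"] T by simp
    show "((\<lambda>s. (2 * T) *\<^sub>R ?F (2 * T * s - T)) has_integral I) {0..1}"
      using * T by simp
    fix s assume s: "s \<in> {0..1} - ?N"
    have sT: "2 * T * s - T \<in> {- T<..<T} - S"
    proof -
      have "0 < s" "s < 1" "2 * T * s - T \<notin> S" using s by auto
      moreover have "T * 0 < T * s" "T * s < T * 1"
        using \<open>0 < s\<close> \<open>s < 1\<close> T by (intro mult_strict_left_mono; simp)+
      ultimately show ?thesis by auto
    qed
    have dL: "L differentiable at (2 * T * s - T)"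
    proof -
      have "\<forall>y\<in>{- T..T} - S. L differentiable at y"
        using S(2) unfolding C1_differentiable_on_eq by blast
      moreover have "{- T<..<T} - S \<subseteq> {- T..T} - S" by auto
      ultimately show ?thesis using sT by blast
    qed
    have "(finite_arc T has_vector_derivative (2 * T) *\<^sub>R vector_derivative L (at (2 * T * s - T))) (at s)"
    proof -
      have "((\<lambda>s. 2 * T * s - T) has_vector_derivative (2 * T)) (at s)"
        by (auto intro!: derivative_eq_intros)
      from vector_diff_chain_at[OF this dL[unfolded vector_derivative_works]]
      show ?thesis by (simp add: finite_arc_def[abs_def] o_def)
    qed
    then have "vector_derivative (finite_arc T) (at s within {0..1}) = (2 * T) *\<^sub>R vector_derivative L (at (2 * T * s - T))"
      using s by (intro vector_derivative_at_within_ivl) auto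
    then show "f (finite_arc T s) * vector_derivative (finite_arc T) (at s within {0..1}) = (2 * T) *\<^sub>R ?F (2 * T * s - T)"
      by (simp add: finite_arc_def)
  qed
  then show ?thesis by (simp add: has_contour_integral_def)
qed

lemma bounded_arc: "\<exists>B. \<forall>t\<in>{- T..T}. norm (L t) \<le> B"
proof -
  have "compact (L ` {- T..T})"
    by (intro compact_continuous_image continuous_on_subset[OF continuous_L]) auto
  then show ?thesis by (auto dest!: compact_imp_bounded simp: bounded_iff)
qed

text \<open>Both ends escape, so near a given point only a compact arc matters. An open complement
  is what allows two points of one component to be joined by a path.\<close>

lemma closed_range: "closed (range L)"
proof -
  have "open (- range L)"
  proof (rule openI)
    fix x assume x: "x \<in> - range L"
    obtain T0 where T0: "\<And>T. T \<ge> T0 \<Longrightarrow> (norm x + 1 < Re (L T) \<or> norm x + 1 < Im (L T)) \<and>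
                       (norm x + 1 < Re (L (- T)) \<or> Im (L (- T)) < - (norm x + 1))"
      using escape[of "norm x + 1"] by blast
    define T where "T = max T0 0"
    have "compact (L ` {- T..T})"
      by (intro compact_continuous_image continuous_on_subset[OF continuous_L]) auto
    then have "open (- L ` {- T..T})" by (simp add: compact_imp_closed open_Compl)
    moreover have "x \<in> - L ` {- T..T}" using x by auto
    ultimately obtain e where e: "e > 0" "ball x e \<subseteq> - L ` {- T..T}"
      using open_contains_ball by blast
    have "ball x (min e 1) \<subseteq> - range L"
    proof clarsimp
      fix t assume t: "dist x (L t) < e" "dist x (L t) < 1"
      then have "t \<notin> {- T..T}" using e(2) by auto
      then have "norm (L t) > norm x + 1"
      proof (cases "t \<ge> T")
        case True
        then show ?thesis
          using T0[of t] complex_Re_le_cmod[of "L t"] abs_Im_le_cmod[of "L t"] by (auto simp: T_def)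
      next
        case False
        with \<open>t \<notin> _\<close> have "- t \<ge> T0" by (auto simp: T_def)
        then show ?thesis
          using T0[of "- t"] complex_Re_le_cmod[of "L t"] abs_Im_le_cmod[of "L t"] by auto
      qed
      then show False
        using t(2) norm_triangle_ineq2[of "L t" x] by (simp add: dist_norm norm_minus_commute)
    qed
    then show "\<exists>e>0. ball x e \<subseteq> - range L"
      using e(1) by (intro exI[of _ "min e 1"]) auto
  qed
  then show ?thesis by (simp add: closed_def)
qed

text \<open>A path from p to q off the contour is bounded. Once the closing part runs outside a disc
  containing it, the path misses the whole cycle, and the winding number is constant along it.
  \<open>T\<close> is fixed before \<open>K\<close> and \<open>H\<close> because the corners have to
  lie beyond the ends of the arc, which move with \<open>T\<close>.\<close>

lemma cycle_separates:
  assumes "connected_component (- range L) p q"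
  shows "\<exists>T0>0. \<forall>T\<ge>T0. \<exists>K0. \<forall>K\<ge>K0. \<forall>H\<ge>K0.
           p \<notin> path_image (cycle T K H) \<and> q \<notin> path_image (cycle T K H) \<and>
           winding_number (cycle T K H) p = winding_number (cycle T K H) q"
proof -
  have "open (- range L)" using closed_range by (simp add: open_Compl)
  then have "path_component (- range L) p q"
    using assms by (simp add: open_path_connected_component)
  then obtain g where g: "path g" "path_image g \<subseteq> - range L" "pathstart g = p" "pathfinish g = q"
    by (auto simp: path_component_def)
  obtain \<rho> where \<rho>: "\<rho> > 0" "path_image g \<subseteq> ball 0 \<rho>"
    using bounded_path_image[OF g(1)] bounded_subset_ballD by blast
  obtain T0 where T0: "\<And>T. T \<ge> T0 \<Longrightarrow> (\<rho> < Re (L T) \<or> \<rho> < Im (L T)) \<and>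
                       (\<rho> < Re (L (- T)) \<or> Im (L (- T)) < - \<rho>)"
    using escape by blast
  show ?thesis
  proof (rule exI[of _ "max T0 1"], intro conjI allI impI)
    fix T assume T: "T \<ge> max T0 1"
    let ?K0 = "max (\<rho> + 1) (max (norm (L T)) (norm (L (- T))))"
    show "\<exists>K0. \<forall>K\<ge>K0. \<forall>H\<ge>K0.
           p \<notin> path_image (cycle T K H) \<and> q \<notin> path_image (cycle T K H) \<and>
           winding_number (cycle T K H) p = winding_number (cycle T K H) q"
    proof (intro exI[of _ ?K0] allI impI)
      fix K H assume K: "K \<ge> ?K0" and H: "H \<ge> ?K0"
      have A: "Re (L T) \<le> K" "Im (L T) \<le> H" "Re (L (- T)) \<le> K" "- H \<le> Im (L (- T))"
        using K H complex_Re_le_cmod[of "L T"] complex_Re_le_cmod[of "L (- T)"]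
          abs_Im_le_cmod[of "L T"] abs_Im_le_cmod[of "L (- T)"] by auto
      have out: "norm z > \<rho>" if "z \<in> path_image (closing T K H)" for z
      proof -
        have "\<rho> < Re z \<or> \<rho> < Im z \<or> Im z < - \<rho>"
          using that unfolding path_image_closing Un_iff
        proof (elim disjE)
          assume "z \<in> closed_segment (L T) (Complex K H)"
          then show ?thesis using segment_up_right[of z "L T" "Complex K H"] A T0[of T] T by auto
        next
          assume "z \<in> closed_segment (Complex K H) (Complex K (- H))"
          then show ?thesis using segment_vertical K by auto
        next
          assume "z \<in> closed_segment (Complex K (- H)) (L (- T))"
          then show ?thesis using segment_down_right[of z "Complex K (- H)" "L (- T)"] A T0[of T] T by auto
        qed
        then show ?thesis
          using complex_Re_le_cmod[of z] abs_Im_le_cmod[of z] by auto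
      qed
      have disj: "path_image g \<inter> path_image (cycle T K H) = {}"
        using g(2) \<rho>(2) out T by (fastforce simp: path_image_cycle)
      have pq: "p \<in> path_image g" "q \<in> path_image g"
        using g pathstart_in_path_image pathfinish_in_path_image by auto
      have "winding_number (cycle T K H) p = winding_number (cycle T K H) q"
        using T by (intro winding_number_eq[OF _ cycle_loop pq connected_path_image[OF g(1)] disj]
              valid_path_imp_path valid_path_cycle) auto
      then show "p \<notin> path_image (cycle T K H) \<and> q \<notin> path_image (cycle T K H) \<and>
           winding_number (cycle T K H) p = winding_number (cycle T K H) q"
        using disj pq by auto
    qed
  qed auto
qed

lemma cycle_winding_left:
  assumes "T > 0" "- C \<le> K" "Re p < - C"
  shows "p \<notin> path_image (cycle T K H)" "winding_number (cycle T K H) p = 0"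
proof -
  have sub: "path_image (cycle T K H) \<subseteq> {z. - C \<le> Re z}"
    unfolding path_image_cycle[OF assms(1)] path_image_closing
    using Re_ge assms(2) segment_Re_ge[of _ _ _ "- C"] by fastforce
  then show "p \<notin> path_image (cycle T K H)" using assms by auto
  show "winding_number (cycle T K H) p = 0"
    by (rule winding_number_zero_outside[OF _ convex_halfspace_Re_ge[of "- C"] cycle_loop _ sub])
       (use assms in \<open>auto intro: valid_path_imp_path valid_path_cycle\<close>)
qed

lemma cycle_winding_right:
  assumes "T > 0" "\<And>t. t \<in> {- T..T} \<Longrightarrow> Re (L t) \<le> K" "K < Re p"
  shows "p \<notin> path_image (cycle T K H)" "winding_number (cycle T K H) p = 0"
proof -
  have "Re (L T) \<le> K" "Re (L (- T)) \<le> K" using assms by auto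
  then have sub: "path_image (cycle T K H) \<subseteq> {z. Re z \<le> K}"
    unfolding path_image_cycle[OF assms(1)] path_image_closing
    using assms(2) segment_Re_le[of _ _ _ K] by fastforce
  then show "p \<notin> path_image (cycle T K H)" using assms by auto
  show "winding_number (cycle T K H) p = 0"
    by (rule winding_number_zero_outside[OF _ convex_halfspace_Re_le[of K] cycle_loop _ sub])
       (use assms in \<open>auto intro: valid_path_imp_path valid_path_cycle\<close>)
qed

text \<open>The arc misses the ray from the base point to the right, the closing path the opposite
  ray, so each part carries a branch of the logarithm as a primitive of 1/(z - q). The branches
  differ by -\<pi>i at the upper end and by \<pi>i at the lower one, which adds up to
  -2\<pi>i.\<close>

lemma cycle_winding_base:
  "\<exists>T0>0. \<forall>T\<ge>T0. \<exists>K0. \<forall>K\<ge>K0. \<forall>H\<ge>K0.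
     Complex M \<eta> \<notin> path_image (cycle T K H) \<and> winding_number (cycle T K H) (Complex M \<eta>) = -1"
proof -
  obtain T0 where T0: "\<And>T. T \<ge> T0 \<Longrightarrow> \<eta> < Im (L T) \<and> Im (L (- T)) < \<eta>"
    using ends by blast
  let ?q = "Complex M \<eta>"
  show ?thesis
  proof (rule exI[of _ "max T0 1"], intro conjI allI impI)
    fix T assume T: "T \<ge> max T0 1"
    let ?K0 = "max (\<bar>M\<bar> + 1) (max (norm (L T)) (norm (L (- T))))"
    show "\<exists>K0. \<forall>K\<ge>K0. \<forall>H\<ge>K0. ?q \<notin> path_image (cycle T K H) \<and> winding_number (cycle T K H) ?q = -1"
    proof (intro exI[of _ ?K0] allI impI)
      fix K H assume K: "K \<ge> ?K0" and H: "H \<ge> ?K0"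
      have Tpos: "T > 0" using T by auto
      have A: "Re (L T) \<le> K" "Im (L T) \<le> H" "Re (L (- T)) \<le> K" "- H \<le> Im (L (- T))"
        using K H complex_Re_le_cmod[of "L T"] complex_Re_le_cmod[of "L (- T)"]
          abs_Im_le_cmod[of "L T"] abs_Im_le_cmod[of "L (- T)"] by auto
      have AB: "\<eta> < Im (L T)" "Im (L (- T)) < \<eta>" using T0[of T] T by auto
      define S1 where "S1 = {z. - (z - ?q) \<notin> \<real>\<^sub>\<le>\<^sub>0}"
      define S2 where "S2 = {z. z - ?q \<notin> \<real>\<^sub>\<le>\<^sub>0}"
      have im1: "path_image (finite_arc T) \<subseteq> S1"
        unfolding path_image_arc[OF Tpos] S1_def using slit by (fastforce simp: complex_nonpos_Reals_iff)
      have im2: "path_image (closing T K H) \<subseteq> S2"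
      proof
        fix z assume "z \<in> path_image (closing T K H)"
        then have "\<eta> < Im z \<or> Im z < \<eta> \<or> M < Re z"
          unfolding path_image_closing Un_iff
        proof (elim disjE)
          assume "z \<in> closed_segment (L T) (Complex K H)"
          then show ?thesis using segment_up_right[of z "L T" "Complex K H"] A AB by auto
        next
          assume "z \<in> closed_segment (Complex K H) (Complex K (- H))"
          then show ?thesis using segment_vertical K by auto
        next
          assume "z \<in> closed_segment (Complex K (- H)) (L (- T))"
          then show ?thesis using segment_down_right[of z "Complex K (- H)" "L (- T)"] A AB by auto
        qed
        then show "z \<in> S2" by (auto simp: S2_def complex_nonpos_Reals_iff)
      qed
      have d1: "((\<lambda>z. Ln (- (z - ?q))) has_field_derivative 1 / (z - ?q)) (at z within S1)" if "z \<in> S1" for z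
      proof -
        have "z - ?q \<noteq> 0" using that by (auto simp: S1_def)
        with that show ?thesis
          unfolding S1_def by (auto intro!: derivative_eq_intros simp: field_simps)
      qed
      have d2: "((\<lambda>z. Ln (z - ?q)) has_field_derivative 1 / (z - ?q)) (at z within S2)" if "z \<in> S2" for z
        using that unfolding S2_def by (auto intro!: derivative_eq_intros simp: field_simps)
      have i1: "((\<lambda>z. 1 / (z - ?q)) has_contour_integral (Ln (- (L T - ?q)) - Ln (- (L (- T) - ?q)))) (finite_arc T)"
        using contour_integral_primitive[OF d1 valid_path_arc[OF Tpos] im1] by simp
      have i2: "((\<lambda>z. 1 / (z - ?q)) has_contour_integral (Ln (L (- T) - ?q) - Ln (L T - ?q))) (closing T K H)"
        using contour_integral_primitive[OF d2 valid_path_closing im2] by simp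
      have "L T - ?q \<noteq> 0" "L (- T) - ?q \<noteq> 0" using AB by auto
      then have "Ln (- (L T - ?q)) = Ln (L T - ?q) - \<i> * pi" "Ln (- (L (- T) - ?q)) = Ln (L (- T) - ?q) + \<i> * pi"
        using AB by (subst Ln_minus; simp)+
      then have tot: "((\<lambda>z. 1 / (z - ?q)) has_contour_integral (- (2 * pi * \<i>))) (cycle T K H)"
        using has_contour_integral_join[OF i1 i2 valid_path_arc[OF Tpos] valid_path_closing]
        by (simp add: cycle_def mult_ac)
      have q: "?q \<notin> path_image (cycle T K H)"
        using im1 im2 unfolding path_image_cycle[OF Tpos] path_image_arc[OF Tpos] by (auto simp: S1_def S2_def)
      show "?q \<notin> path_image (cycle T K H) \<and> winding_number (cycle T K H) ?q = -1"
        using q winding_number_valid_path[OF valid_path_cycle[OF Tpos] q] contour_integral_unique[OF tot] by simp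
    qed
  qed auto
qed

text \<open>The quantifier pattern means: for all large T and then, depending on T, for all large K
  and H. Like a filter it is closed under conjunction.\<close>

lemma eventually_all2:
  assumes "\<exists>T0>0. \<forall>T\<ge>T0. \<exists>K0. \<forall>K\<ge>K0. \<forall>H\<ge>K0. P T K H"
    and "\<exists>T0>0. \<forall>T\<ge>T0. \<exists>K0. \<forall>K\<ge>K0. \<forall>H\<ge>K0. Q T K H"
  shows "\<exists>T0>(0::real). \<forall>T\<ge>T0. \<exists>K0::real. \<forall>K\<ge>K0. \<forall>H\<ge>K0. P T K H \<and> Q T K (H::real)"
proof -
  obtain T1 where T1: "T1 > 0" "\<And>T. T \<ge> T1 \<Longrightarrow> \<exists>K0. \<forall>K\<ge>K0. \<forall>H\<ge>K0. P T K H" using assms(1) by blast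
  obtain T2 where T2: "\<And>T. T \<ge> T2 \<Longrightarrow> \<exists>K0. \<forall>K\<ge>K0. \<forall>H\<ge>K0. Q T K H" using assms(2) by blast
  have "\<exists>K0. \<forall>K\<ge>K0. \<forall>H\<ge>K0. P T K H \<and> Q T K H" if T: "T \<ge> max T1 T2" for T
  proof -
    obtain K1 K2 where "\<And>K H. K \<ge> K1 \<Longrightarrow> H \<ge> K1 \<Longrightarrow> P T K H" "\<And>K H. K \<ge> K2 \<Longrightarrow> H \<ge> K2 \<Longrightarrow> Q T K H"
      using T1(2)[of T] T2[of T] T by (metis max.bounded_iff)
    then show ?thesis by (intro exI[of _ "max K1 K2"]) auto
  qed
  then show ?thesis using T1(1) by (intro exI[of _ "max T1 T2"]) auto
qed

lemma slit_connected:
  assumes "M \<le> r"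
  shows "connected_component (- range L) (Complex r \<eta>) (Complex M \<eta>)"
  unfolding connected_component_def
proof (intro exI[of _ "closed_segment (Complex M \<eta>) (Complex r \<eta>)"] conjI)
  show "closed_segment (Complex M \<eta>) (Complex r \<eta>) \<subseteq> - range L"
  proof
    fix z assume z: "z \<in> closed_segment (Complex M \<eta>) (Complex r \<eta>)"
    then have "M \<le> Re z" "\<eta> \<le> Im z" "Im z \<le> \<eta>"
      using segment_up_right[of z "Complex M \<eta>" "Complex r \<eta>"]
        segment_down_right[of z "Complex r \<eta>" "Complex M \<eta>"] assms by (auto simp: closed_segment_commute)
    then show "z \<in> - range L" using slit by fastforce
  qed
qed auto

lemma right_of_contour_connected:
  assumes "right_of_contour L \<eta> p"
  shows "connected_component (- range L) p (Complex M \<eta>)"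
proof -
  obtain r0 where "\<And>r. r \<ge> r0 \<Longrightarrow> connected_component (- range L) p (Complex r \<eta>)"
    using assms by (auto simp: right_of_contour_def eventually_at_top_linorder)
  then show ?thesis
    using slit_connected[of "max r0 M"] connected_component_trans by (metis max.cobounded1 max.cobounded2)
qed

lemma left_of_contour_connected:
  assumes "left_of_contour L \<eta> p"
  shows "\<exists>q. connected_component (- range L) p q \<and> Re q < - C"
proof -
  obtain r0 where "\<And>r. r \<le> r0 \<Longrightarrow> connected_component (- range L) p (Complex r \<eta>)"
    using assms by (auto simp: left_of_contour_def eventually_at_bot_linorder)
  then show ?thesis
    by (intro exI[of _ "Complex (min r0 (- C - 1)) \<eta>"]) auto
qed

lemma right_winding:
  assumes "connected_component (- range L) p (Complex M \<eta>)"
  shows "\<exists>T0>0. \<forall>T\<ge>T0. \<exists>K0. \<forall>K\<ge>K0. \<forall>H\<ge>K0.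
     p \<notin> path_image (cycle T K H) \<and> winding_number (cycle T K H) p = -1"
  using eventually_all2[OF cycle_separates[OF assms] cycle_winding_base]
  by (rule ex_forward) (simp, metis)

lemma left_winding:
  assumes "connected_component (- range L) p q" "Re q < - C"
  shows "\<exists>T0>0. \<forall>T\<ge>T0. \<exists>K0. \<forall>K\<ge>K0. \<forall>H\<ge>K0.
     p \<notin> path_image (cycle T K H) \<and> winding_number (cycle T K H) p = 0"
proof -
  obtain T0 where T0: "T0 > 0" "\<And>T. T \<ge> T0 \<Longrightarrow> \<exists>K0. \<forall>K\<ge>K0. \<forall>H\<ge>K0.
           p \<notin> path_image (cycle T K H) \<and> q \<notin> path_image (cycle T K H) \<and>
           winding_number (cycle T K H) p = winding_number (cycle T K H) q"
    using cycle_separates[OF assms(1)] by blast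
  have "\<exists>K0. \<forall>K\<ge>K0. \<forall>H\<ge>K0. p \<notin> path_image (cycle T K H) \<and> winding_number (cycle T K H) p = 0"
    if T: "T \<ge> T0" for T
  proof -
    obtain K0 where K0: "\<And>K H. K \<ge> K0 \<Longrightarrow> H \<ge> K0 \<Longrightarrow> p \<notin> path_image (cycle T K H) \<and>
           winding_number (cycle T K H) p = winding_number (cycle T K H) q"
      using T0(2)[OF T] by metis
    have "winding_number (cycle T K H) q = 0" if "K \<ge> - C" for K H
      using cycle_winding_left(2)[of T K q H] that T T0(1) assms(2) by auto
    with K0 show ?thesis by (intro exI[of _ "max K0 (- C)"]) auto
  qed
  with T0(1) show ?thesis by blast
qed

text \<open>The winding number of the cycle around p would be both -1 and 0. This is what shows that
  no right-hand pole lies outside a loop.\<close>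

lemma sides_disjoint:
  assumes "connected_component (- range L) p (Complex M \<eta>)" "connected_component (- range L) p q" "Re q < - C"
  shows False
proof -
  obtain T0 where T0: "\<And>T. T \<ge> T0 \<Longrightarrow> \<exists>K0. \<forall>K\<ge>K0. \<forall>H\<ge>K0.
     (p \<notin> path_image (cycle T K H) \<and> winding_number (cycle T K H) p = -1) \<and>
     (p \<notin> path_image (cycle T K H) \<and> winding_number (cycle T K H) p = 0)"
    using eventually_all2[OF right_winding[OF assms(1)] left_winding[OF assms(2,3)]] by blast
  show False using T0[OF order_refl] by (metis order_refl zero_neq_neg_one)
qed

end

section \<open>Contours separating two infinite sets of poles, and the residue evaluation\<close>

text \<open>Only finitely many right-hand poles lie to the left of any abscissa, and only finitely
  many left-hand poles to the right of it. The last two conditions treat the infinitely many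
  right-hand poles beyond \<open>M\<close> uniformly: each is joined to the base point by a segment
  off the contour, and from one threshold on the two ends pass above and below all of them.\<close>

locale separating_contour = escaping_contour +
  fixes PR PL :: "complex set"
  assumes finite_PR: "\<And>x. finite {p \<in> PR. Re p \<le> x}"
    and finite_PL: "\<And>x. finite {p \<in> PL. x \<le> Re p}"
    and PR_right: "\<And>p. p \<in> PR \<Longrightarrow> connected_component (- range L) p (Complex M \<eta>)"
    and PL_left: "\<And>p. p \<in> PL \<Longrightarrow> \<exists>q. connected_component (- range L) p q \<and> Re q < - C"
    and PR_segment: "\<And>p. p \<in> PR \<Longrightarrow> M \<le> Re p \<Longrightarrow> closed_segment p (Complex M \<eta>) \<inter> range L = {}"
    and PR_ends: "\<exists>T0. \<forall>T\<ge>T0. \<forall>p\<in>PR. M \<le> Re p \<longrightarrow> Im p < Im (L T) \<and> Im (L (- T)) < Im p"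
begin

lemma eventually_all_finite:
  assumes "finite F" "\<And>p. p \<in> F \<Longrightarrow> \<exists>T0>0. \<forall>T\<ge>T0. \<exists>K0. \<forall>K\<ge>K0. \<forall>H\<ge>K0. P p T K H"
  shows "\<exists>T0>(0::real). \<forall>T\<ge>T0. \<exists>K0::real. \<forall>K\<ge>K0. \<forall>H\<ge>K0. \<forall>p\<in>F. P p T K (H::real)"
  using assms
proof (induction F rule: finite_induct)
  case empty
  show ?case by (rule exI[of _ 1]) auto
next
  case (insert p F)
  have "\<exists>T0>0. \<forall>T\<ge>T0. \<exists>K0. \<forall>K\<ge>K0. \<forall>H\<ge>K0. P p T K H \<and> (\<forall>p\<in>F. P p T K H)"
    using insert by (intro eventually_all2) auto
  then show ?case by simp
qed

lemma closing_avoids_far_right: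
  assumes p: "p \<in> PR" "M \<le> Re p" "Re p < K" and K: "M < K"
    and A: "Re (L T) \<le> K" "Im (L T) \<le> H" "Re (L (- T)) \<le> K" "- H \<le> Im (L (- T))"
    and AB: "\<eta> < Im (L T)" "Im (L (- T)) < \<eta>" "Im p < Im (L T)" "Im (L (- T)) < Im p"
  shows "closed_segment p (Complex M \<eta>) \<inter> path_image (closing T K H) = {}"
proof -
  have "z \<notin> path_image (closing T K H)" if z: "z \<in> closed_segment p (Complex M \<eta>)" for z
  proof
    have z_Re: "Re z < K"
      using segment_Re_le[OF z, of "max M (Re p)"] p K by auto
    have z_up: "Im z < Im (L T)"
      using z closed_segment_subset[OF _ _ convex_halfspace_Im_lt[of "Im (L T)"], of p "Complex M \<eta>"] AB by auto
    have z_down: "Im (L (- T)) < Im z"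
      using z closed_segment_subset[OF _ _ convex_halfspace_Im_gt[of "Im (L (- T))"], of p "Complex M \<eta>"] AB by auto
    assume "z \<in> path_image (closing T K H)"
    then show False
      unfolding path_image_closing Un_iff
    proof (elim disjE)
      assume "z \<in> closed_segment (L T) (Complex K H)"
      then show False using segment_up_right[of z "L T" "Complex K H"] A z_up by auto
    next
      assume "z \<in> closed_segment (Complex K H) (Complex K (- H))"
      then show False using segment_vertical z_Re by auto
    next
      assume "z \<in> closed_segment (Complex K (- H)) (L (- T))"
      then show False using segment_down_right[of z "Complex K (- H)" "L (- T)"] A z_down by auto
    qed
  qed
  then show ?thesis by blast
qed

text \<open>The threshold for \<open>T\<close> must not depend on the pole. Left-hand poles with Re
  >= -C and right-hand poles with Re <= M are finitely many and may have thresholds of their own.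
  Left-hand poles further left and right-hand poles beyond \<open>K\<close> lie outside a half-plane
  that contains the cycle, and right-hand poles between \<open>M\<close> and \<open>K\<close> are
  joined to the base point by a segment.\<close>

theorem cycle_winding:
  "\<exists>T0>0. \<forall>T\<ge>T0. \<exists>K0. \<forall>K\<ge>K0. \<forall>H\<ge>K0. norm (L T) \<le> K \<and> norm (L (- T)) \<le> K \<and>
     (\<forall>p\<in>PL. p \<notin> path_image (cycle T K H) \<and> winding_number (cycle T K H) p = 0) \<and>
     (\<forall>p\<in>PR. Re p \<noteq> K \<longrightarrow> p \<notin> path_image (cycle T K H) \<and>
        winding_number (cycle T K H) p = (if Re p < K then -1 else 0))"
proof -
  let ?FL = "{p \<in> PL. - C \<le> Re p}"
  let ?FR = "{p \<in> PR. Re p \<le> M}"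
  have wFL: "\<exists>T0>0. \<forall>T\<ge>T0. \<exists>K0. \<forall>K\<ge>K0. \<forall>H\<ge>K0. \<forall>p\<in>?FL.
      p \<notin> path_image (cycle T K H) \<and> winding_number (cycle T K H) p = 0"
    by (rule eventually_all_finite[OF finite_PL]) (use PL_left left_winding in blast)
  have wFR: "\<exists>T0>0. \<forall>T\<ge>T0. \<exists>K0. \<forall>K\<ge>K0. \<forall>H\<ge>K0. \<forall>p\<in>?FR.
      p \<notin> path_image (cycle T K H) \<and> winding_number (cycle T K H) p = -1"
    by (rule eventually_all_finite[OF finite_PR]) (use PR_right right_winding in blast)
  define W where "W T K H \<longleftrightarrow>
      (\<forall>p\<in>?FL. p \<notin> path_image (cycle T K H) \<and> winding_number (cycle T K H) p = 0) \<and>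
      (\<forall>p\<in>?FR. p \<notin> path_image (cycle T K H) \<and> winding_number (cycle T K H) p = -1) \<and>
      Complex M \<eta> \<notin> path_image (cycle T K H) \<and> winding_number (cycle T K H) (Complex M \<eta>) = -1" for T K H
  have "\<exists>T0>0. \<forall>T\<ge>T0. \<exists>K0. \<forall>K\<ge>K0. \<forall>H\<ge>K0. W T K H"
    unfolding W_def by (rule eventually_all2[OF wFL eventually_all2[OF wFR cycle_winding_base]])
  then obtain T1 where T1: "T1 > 0" "\<And>T. T \<ge> T1 \<Longrightarrow> \<exists>K0. \<forall>K\<ge>K0. \<forall>H\<ge>K0. W T K H"
    by blast
  obtain T2 where T2: "\<And>T p. T \<ge> T2 \<Longrightarrow> p \<in> PR \<Longrightarrow> M \<le> Re p \<Longrightarrow> Im p < Im (L T) \<and> Im (L (- T)) < Im p"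
    using PR_ends by blast
  obtain T3 where T3: "\<And>T. T \<ge> T3 \<Longrightarrow> \<eta> < Im (L T) \<and> Im (L (- T)) < \<eta>"
    using ends by blast
  show ?thesis
  proof (rule exI[of _ "max T1 (max T2 T3)"], intro conjI allI impI)
    fix T assume T: "T \<ge> max T1 (max T2 T3)"
    then have Tpos: "T > 0" using T1(1) by auto
    have "T \<ge> T1" using T by simp
    from T1(2)[OF this] obtain K1 where K1: "\<And>K H. K \<ge> K1 \<Longrightarrow> H \<ge> K1 \<Longrightarrow> W T K H"
      by blast
    obtain B where B: "\<And>t. t \<in> {- T..T} \<Longrightarrow> norm (L t) \<le> B"
      using bounded_arc by blast
    let ?K0 = "max K1 (max B (max (M + 1) (- C)))"
    show "\<exists>K0. \<forall>K\<ge>K0. \<forall>H\<ge>K0. norm (L T) \<le> K \<and> norm (L (- T)) \<le> K \<and>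
     (\<forall>p\<in>PL. p \<notin> path_image (cycle T K H) \<and> winding_number (cycle T K H) p = 0) \<and>
     (\<forall>p\<in>PR. Re p \<noteq> K \<longrightarrow> p \<notin> path_image (cycle T K H) \<and>
        winding_number (cycle T K H) p = (if Re p < K then -1 else 0))"
    proof (rule exI[of _ ?K0], intro allI impI)
      fix K H assume K: "K \<ge> ?K0" and H: "H \<ge> ?K0"
      have KH: "K1 \<le> K" "K1 \<le> H" and KB: "B \<le> K" "B \<le> H" and KM: "M < K" and KC: "- C \<le> K"
        using K H unfolding max.bounded_iff by simp_all
      have nA: "norm (L T) \<le> B" "norm (L (- T)) \<le> B" using B Tpos by simp_all
      have A: "Re (L T) \<le> K" "Im (L T) \<le> H" "Re (L (- T)) \<le> K" "- H \<le> Im (L (- T))"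
        using KB nA complex_Re_le_cmod[of "L T"] complex_Re_le_cmod[of "L (- T)"]
          abs_Im_le_cmod[of "L T"] abs_Im_le_cmod[of "L (- T)"] by linarith+
      have ReB: "Re (L t) \<le> K" if "t \<in> {- T..T}" for t
        using B[OF that] KB complex_Re_le_cmod[of "L t"] by linarith
      have WT: "W T K H" by (rule K1[OF KH])
      then have k1: "\<forall>p\<in>?FL. p \<notin> path_image (cycle T K H) \<and> winding_number (cycle T K H) p = 0"
        "\<forall>p\<in>?FR. p \<notin> path_image (cycle T K H) \<and> winding_number (cycle T K H) p = -1"
        "winding_number (cycle T K H) (Complex M \<eta>) = -1"
        unfolding W_def by blast+
      have PLw: "p \<notin> path_image (cycle T K H) \<and> winding_number (cycle T K H) p = 0" if "p \<in> PL" for p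
      proof (cases "- C \<le> Re p")
        case True
        with that have "p \<in> ?FL" by simp
        then show ?thesis by (rule bspec[OF k1(1)])
      next
        case False
        then show ?thesis using cycle_winding_left[OF Tpos KC, of p H] by simp
      qed
      have PRw: "p \<notin> path_image (cycle T K H) \<and> winding_number (cycle T K H) p = (if Re p < K then -1 else 0)"
        if p: "p \<in> PR" "Re p \<noteq> K" for p
      proof -
        consider "Re p \<le> M" | "M < Re p" "Re p < K" | "K < Re p" using p by linarith
        then show ?thesis
        proof cases
          case 1
          with p have "p \<in> ?FR" by simp
          moreover have "Re p < K" using 1 KM by simp
          ultimately show ?thesis using bspec[OF k1(2)] by simp
        next
          case 2
          have "closed_segment p (Complex M \<eta>) \<inter> path_image (closing T K H) = {}"
            using T2[of T p, OF _ p(1)] T3[of T] T 2 by (intro closing_avoids_far_right p(1) A KM) simp_all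
          then have disj: "closed_segment p (Complex M \<eta>) \<inter> path_image (cycle T K H) = {}"
            using PR_segment[OF p(1)] 2 by (auto simp: path_image_cycle[OF Tpos])
          have "winding_number (cycle T K H) p = winding_number (cycle T K H) (Complex M \<eta>)"
            by (rule winding_number_eq[OF valid_path_imp_path[OF valid_path_cycle[OF Tpos]] cycle_loop _ _ _ disj]) auto
          moreover have "p \<notin> path_image (cycle T K H)" using disj by auto
          ultimately show ?thesis using 2 k1(3) by simp
        next
          case 3
          then show ?thesis using cycle_winding_right[OF Tpos ReB 3] 3 by simp
        qed
      qed
      show "norm (L T) \<le> K \<and> norm (L (- T)) \<le> K \<and>
       (\<forall>p\<in>PL. p \<notin> path_image (cycle T K H) \<and> winding_number (cycle T K H) p = 0) \<and>
       (\<forall>p\<in>PR. Re p \<noteq> K \<longrightarrow> p \<notin> path_image (cycle T K H) \<and>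
          winding_number (cycle T K H) p = (if Re p < K then -1 else 0))"
      proof (intro conjI ballI impI)
        show "norm (L T) \<le> K" "norm (L (- T)) \<le> K" using nA KB by linarith+
      qed (use PLw PRw in blast)+
    qed
  qed (use T1 in auto)
qed

lemma contour_integral_cycle:
  assumes f: "f holomorphic_on - (PR \<union> PL)" and T: "T > 0"
    and wL: "\<And>p. p \<in> PL \<Longrightarrow> p \<notin> path_image (cycle T K H) \<and> winding_number (cycle T K H) p = 0"
    and wR: "\<And>p. p \<in> PR \<Longrightarrow> p \<notin> path_image (cycle T K H) \<and>
        winding_number (cycle T K H) p = (if Re p < K then -1 else 0)"
  shows "f contour_integrable_on cycle T K H"
    "contour_integral (cycle T K H) f = - (2 * pi * \<i> * (\<Sum>p | p \<in> PR \<and> Re p < K. residue f p))"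
proof -
  have vp: "valid_path (cycle T K H)" using T by (rule valid_path_cycle)
  have finK: "finite {p \<in> PR. Re p < K}"
    by (rule finite_subset[OF _ finite_PR[of K]]) auto
  have "bounded (path_image (cycle T K H) \<union> {p \<in> PR. Re p < K})"
    using vp finK by (simp add: bounded_path_image finite_imp_bounded valid_path_imp_path)
  then obtain R where R: "path_image (cycle T K H) \<subseteq> ball 0 R" "{p \<in> PR. Re p < K} \<subseteq> ball 0 R"
    by (meson bounded_subset_ballD le_sup_iff)
  \<comment> \<open>The residue theorem is applied in a disc that contains the cycle and the
    enclosed poles. It meets only finitely many poles, and points outside it have winding number
    0.\<close>
  define pts where "pts = (PR \<union> PL) \<inter> ball 0 R"
  have fin: "finite pts"
  proof (rule finite_subset)
    show "pts \<subseteq> {p \<in> PR. Re p \<le> R} \<union> {p \<in> PL. - R \<le> Re p}"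
    proof
      fix p assume "p \<in> pts"
      then show "p \<in> {p \<in> PR. Re p \<le> R} \<union> {p \<in> PL. - R \<le> Re p}"
        using abs_Re_le_cmod[of p] by (auto simp: pts_def)
    qed
  qed (use finite_PR finite_PL in auto)
  have hol: "f holomorphic_on ball 0 R - pts"
    by (rule holomorphic_on_subset[OF f]) (auto simp: pts_def)
  have im: "path_image (cycle T K H) \<subseteq> ball 0 R - pts"
    using R wL wR by (auto simp: pts_def)
  show "f contour_integrable_on cycle T K H"
    using hol im vp fin by (intro contour_integrable_holomorphic_simple[where S = "ball 0 R - pts"])
      (auto intro!: open_Diff finite_imp_closed)
  have "contour_integral (cycle T K H) f = 2 * pi * \<i> * (\<Sum>p\<in>pts. winding_number (cycle T K H) p * residue f p)"
  proof (rule Residue_theorem[OF _ _ fin hol vp cycle_loop im])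
    show "\<forall>z. z \<notin> ball 0 R \<longrightarrow> winding_number (cycle T K H) z = 0"
      using vp R(1) cycle_loop
      by (auto intro!: winding_number_zero_outside[where s = "ball 0 R"] valid_path_imp_path)
  qed auto
  also have "(\<Sum>p\<in>pts. winding_number (cycle T K H) p * residue f p) =
             (\<Sum>p | p \<in> PR \<and> Re p < K. winding_number (cycle T K H) p * residue f p)"
    by (rule sum.mono_neutral_right[OF fin]) (use R(2) wL wR in \<open>auto simp: pts_def split: if_splits\<close>)
  also have "\<dots> = (\<Sum>p | p \<in> PR \<and> Re p < K. - residue f p)"
    by (rule sum.cong) (use wR in auto)
  finally show "contour_integral (cycle T K H) f = - (2 * pi * \<i> * (\<Sum>p | p \<in> PR \<and> Re p < K. residue f p))"
    by (simp add: sum_negf)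
qed

text \<open>The integrand is quantified inside because a single choice of \<open>T\<close>,
  \<open>K\<close>, \<open>H\<close> has to serve a whole family of integrands f(\<xi>) (w
  u^\<alpha>)^\<xi> with varying u.\<close>

definition evaluates :: "real \<Rightarrow> real \<Rightarrow> real \<Rightarrow> bool" where
  "evaluates T K H \<longleftrightarrow> path_image (closing T K H) \<inter> (PR \<union> PL) = {} \<and>
      (\<forall>f. f holomorphic_on - (PR \<union> PL) \<longrightarrow>
        (\<lambda>t. f (L t) * vector_derivative L (at t)) integrable_on {- T..T} \<longrightarrow>
        integral {- T..T} (\<lambda>t. f (L t) * vector_derivative L (at t)) +
        (contour_integral (linepath (L T) (Complex K H)) f +
         contour_integral (linepath (Complex K H) (Complex K (- H))) f +
         contour_integral (linepath (Complex K (- H)) (L (- T))) f) =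
        - (2 * pi * \<i> * (\<Sum>p | p \<in> PR \<and> Re p < K. residue f p)))"

lemma evaluatesI:
  assumes T: "T > 0"
    and w: "\<forall>p\<in>PL. p \<notin> path_image (cycle T K H) \<and> winding_number (cycle T K H) p = 0"
      "\<forall>p\<in>PR. p \<notin> path_image (cycle T K H) \<and> winding_number (cycle T K H) p = (if Re p < K then -1 else 0)"
  shows "evaluates T K H"
  unfolding evaluates_def
proof (intro conjI allI impI)
  have Tpos: "T > 0" using T .
  show "path_image (closing T K H) \<inter> (PR \<union> PL) = {}"
    using w by (auto simp: path_image_cycle[OF Tpos])
  fix f assume f: "f holomorphic_on - (PR \<union> PL)"
    and int: "(\<lambda>t. f (L t) * vector_derivative L (at t)) integrable_on {- T..T}"
  have w': "p \<in> PL \<Longrightarrow> p \<notin> path_image (cycle T K H) \<and> winding_number (cycle T K H) p = 0"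
    "p \<in> PR \<Longrightarrow> p \<notin> path_image (cycle T K H) \<and> winding_number (cycle T K H) p = (if Re p < K then -1 else 0)" for p
    using w by blast+
  note I = contour_integral_cycle[OF f Tpos w']
  have arcI: "(f has_contour_integral integral {- T..T} (\<lambda>t. f (L t) * vector_derivative L (at t))) (finite_arc T)"
    using int by (intro has_contour_integral_arc[OF Tpos]) (rule integrable_integral)
  have clI: "f contour_integrable_on closing T K H"
    using I(1) valid_path_arc[OF Tpos] valid_path_closing unfolding cycle_def
    by (meson contour_integrable_joinD2)
  have parts: "f contour_integrable_on linepath (L T) (Complex K H)"
    "f contour_integrable_on linepath (Complex K H) (Complex K (- H))"
    "f contour_integrable_on linepath (Complex K (- H)) (L (- T))"
    using clI unfolding closing_def by (auto simp: valid_path_join)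
  have "contour_integral (cycle T K H) f = contour_integral (finite_arc T) f + contour_integral (closing T K H) f"
    unfolding cycle_def using arcI clI valid_path_arc[OF Tpos] valid_path_closing
    by (intro contour_integral_join) (auto intro: has_contour_integral_integrable)
  also have "contour_integral (finite_arc T) f = integral {- T..T} (\<lambda>t. f (L t) * vector_derivative L (at t))"
    using arcI by (rule contour_integral_unique)
  also have "contour_integral (closing T K H) f =
      contour_integral (linepath (L T) (Complex K H)) f +
       contour_integral (linepath (Complex K H) (Complex K (- H))) f +
       contour_integral (linepath (Complex K (- H)) (L (- T))) f"
    unfolding closing_def using parts by (simp add: valid_path_join)
  finally show "integral {- T..T} (\<lambda>t. f (L t) * vector_derivative L (at t)) +
      (contour_integral (linepath (L T) (Complex K H)) f +
       contour_integral (linepath (Complex K H) (Complex K (- H))) f +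
       contour_integral (linepath (Complex K (- H)) (L (- T))) f) =
      - (2 * pi * \<i> * (\<Sum>p | p \<in> PR \<and> Re p < K. residue f p))"
    using I(2) by simp
qed

text \<open>The condition on the abscissae stands under the quantifiers over \<open>K\<close> and
  \<open>H\<close>, so that two contours can later be given one common generic
  \<open>K\<close>.\<close>

theorem residue_evaluation:
  "\<exists>T0>0. \<forall>T\<ge>T0. \<exists>K0. \<forall>K\<ge>K0. \<forall>H\<ge>K0. norm (L T) \<le> K \<and> norm (L (- T)) \<le> K \<and>
    ((\<forall>p\<in>PR. Re p \<noteq> K) \<longrightarrow> evaluates T K H)"
proof -
  obtain T0 where T0: "T0 > 0" "\<And>T. T \<ge> T0 \<Longrightarrow> \<exists>K0. \<forall>K\<ge>K0. \<forall>H\<ge>K0. norm (L T) \<le> K \<and> norm (L (- T)) \<le> K \<and>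
     (\<forall>p\<in>PL. p \<notin> path_image (cycle T K H) \<and> winding_number (cycle T K H) p = 0) \<and>
     (\<forall>p\<in>PR. Re p \<noteq> K \<longrightarrow> p \<notin> path_image (cycle T K H) \<and>
        winding_number (cycle T K H) p = (if Re p < K then -1 else 0))"
    using cycle_winding by blast
  have "\<exists>K0. \<forall>K\<ge>K0. \<forall>H\<ge>K0. norm (L T) \<le> K \<and> norm (L (- T)) \<le> K \<and>
    ((\<forall>p\<in>PR. Re p \<noteq> K) \<longrightarrow> evaluates T K H)" if T: "T \<ge> T0" for T
  proof -
    have "T > 0" using T T0(1) by simp
    from T0(2)[OF T] obtain K0 where K0: "\<forall>K\<ge>K0. \<forall>H\<ge>K0. norm (L T) \<le> K \<and> norm (L (- T)) \<le> K \<and>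
     (\<forall>p\<in>PL. p \<notin> path_image (cycle T K H) \<and> winding_number (cycle T K H) p = 0) \<and>
     (\<forall>p\<in>PR. Re p \<noteq> K \<longrightarrow> p \<notin> path_image (cycle T K H) \<and>
        winding_number (cycle T K H) p = (if Re p < K then -1 else 0))" ..
    show ?thesis
    proof (rule exI[of _ K0], intro allI impI)
      fix K H assume KH: "K \<ge> K0" "H \<ge> K0"
      note k = K0[rule_format, OF KH]
      have "evaluates T K H" if "\<forall>p\<in>PR. Re p \<noteq> K"
        using that k by (intro evaluatesI[OF \<open>T > 0\<close>]) blast+
      then show "norm (L T) \<le> K \<and> norm (L (- T)) \<le> K \<and> ((\<forall>p\<in>PR. Re p \<noteq> K) \<longrightarrow> evaluates T K H)"
        using k by blast
    qed
  qed
  with T0(1) show ?thesis by blast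
qed

end

section \<open>Vertical contours and right-hand loops as separating contours\<close>

text \<open>Covers the upper ends of both shapes: the curve gets above every height, or beyond every
  abscissa while staying at height at least \<open>d\<close>. Lower ends are described by the same
  predicate for the reversed and reflected curve \<open>cnj (L (- t))\<close>.\<close>

definition rises :: "(real \<Rightarrow> complex) \<Rightarrow> real \<Rightarrow> bool" where
  "rises L d \<longleftrightarrow>
     (\<forall>c h. eventually (\<lambda>t. h < Im (L t) \<or> c < Re (L t) \<and> d \<le> Im (L t)) at_top)"

lemma rises_mono: "rises L d \<Longrightarrow> d' \<le> d \<Longrightarrow> rises L d'"
  unfolding rises_def by (fast elim: eventually_mono intro: order_trans)

lemma rises_escape:
  assumes "rises L d" "rises (\<lambda>t. cnj (L (- t))) d'"
  shows "\<exists>T0. \<forall>T\<ge>T0. (\<rho> < Re (L T) \<or> \<rho> < Im (L T)) \<and> (\<rho> < Re (L (- T)) \<or> Im (L (- T)) < - \<rho>)"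
proof -
  have "eventually (\<lambda>T. \<rho> < Re (L T) \<or> \<rho> < Im (L T)) at_top"
    using assms(1)[unfolded rises_def, rule_format, of \<rho> \<rho>] by (rule eventually_mono) auto
  moreover have "eventually (\<lambda>T. \<rho> < Re (L (- T)) \<or> Im (L (- T)) < - \<rho>) at_top"
    using assms(2)[unfolded rises_def, rule_format, of \<rho> \<rho>] by (rule eventually_mono) auto
  ultimately have "eventually (\<lambda>T. (\<rho> < Re (L T) \<or> \<rho> < Im (L T)) \<and> (\<rho> < Re (L (- T)) \<or> Im (L (- T)) < - \<rho>)) at_top"
    by (rule eventually_conj)
  then show ?thesis by (simp add: eventually_at_top_linorder)
qed

lemma filterlim_at_bot_reflect:
  "filterlim f at_bot at_bot \<Longrightarrow> filterlim (\<lambda>t::real. - f (- t) :: real) at_top at_top"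
proof -
  assume "filterlim f at_bot at_bot"
  then have "filterlim (\<lambda>t. - f t) at_top at_bot" by (simp add: filterlim_uminus_at_bot)
  then have "filterlim (\<lambda>t. - f t) at_top (filtermap uminus at_top)" by (simp only: at_bot_mirror)
  then show "filterlim (\<lambda>t::real. - f (- t) :: real) at_top at_top" by (simp only: filterlim_filtermap)
qed

text \<open>The contour stays in the strip |Re| < M, so everything to the right of the strip is free
  and the base ray can have any height. Both ends eventually pass the bound \<open>Y\<close> for the
  heights of the right-hand poles.\<close>

lemma vertical_shape_separating:
  fixes L :: "real \<Rightarrow> complex"
  assumes pw: "\<And>T. L piecewise_C1_differentiable_on {-T..T}" and shape: "vertical_shape L"
    and finR: "\<And>x. finite {p \<in> PR. Re p \<le> x}" and finL: "\<And>x. finite {p \<in> PL. x \<le> Re p}"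
    and Y: "\<And>p. p \<in> PR \<Longrightarrow> \<bar>Im p\<bar> \<le> Y"
    and right: "\<And>p. p \<in> PR \<Longrightarrow> right_of_contour L \<eta> p"
    and left: "\<And>p. p \<in> PL \<Longrightarrow> left_of_contour L \<eta> p"
  shows "\<exists>C M \<eta>. separating_contour L C M \<eta> PR PL"
    "\<exists>d. (\<forall>p\<in>PR. Im p < d) \<and> rises L d"
    "\<exists>d. (\<forall>p\<in>PR. Im p > d) \<and> rises (\<lambda>t. cnj (L (- t))) (- d)"
proof -
  obtain M where M: "\<And>t. \<bar>Re (L t)\<bar> < M"
  proof -
    obtain B where "\<And>t. \<bar>Re (L t)\<bar> \<le> B"
      using shape by (auto simp: vertical_shape_def bounded_iff)
    then have "\<bar>Re (L t)\<bar> < B + 1" for t by (meson less_add_one order_le_less_trans)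
    then show ?thesis by (rule that)
  qed
  have up: "filterlim (\<lambda>t. Im (L t)) at_top at_top" "filterlim (\<lambda>t. - Im (L (- t))) at_top at_top"
    using shape filterlim_at_bot_reflect[of "\<lambda>t. Im (L t)"] by (auto simp: vertical_shape_def)
  have up1: "eventually (\<lambda>t. h < Im (L t)) at_top" and up2: "eventually (\<lambda>t. h < - Im (L (- t))) at_top" for h
    using up by (auto simp: filterlim_at_top_dense)
  have r1: "rises L d" for d
    unfolding rises_def by (intro allI) (rule eventually_mono[OF up1], blast)
  have r2: "rises (\<lambda>t. cnj (L (- t))) d" for d
    unfolding rises_def
  proof (intro allI)
    fix c h
    show "eventually (\<lambda>t. h < Im (cnj (L (- t))) \<or> c < Re (cnj (L (- t))) \<and> d \<le> Im (cnj (L (- t)))) at_top"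
      using up2[of h] by eventually_elim simp
  qed
  interpret escaping_contour L M M \<eta>
  proof
    show "- M \<le> Re (L t)" for t using M[of t] by (simp add: abs_less_iff)
    show "M \<le> Re (L t) \<Longrightarrow> Im (L t) \<noteq> \<eta>" for t using M[of t] by (simp add: abs_less_iff)
    have "eventually (\<lambda>T. \<eta> < Im (L T) \<and> - \<eta> < - Im (L (- T))) at_top"
      using up1 up2 by (intro eventually_conj)
    then show "\<exists>T0. \<forall>T\<ge>T0. \<eta> < Im (L T) \<and> Im (L (- T)) < \<eta>"
      by (simp add: eventually_at_top_linorder)
  qed (use pw rises_escape[OF r1 r2] in auto)
  have "separating_contour L M M \<eta> PR PL"
  proof unfold_locales
    show "p \<in> PR \<Longrightarrow> connected_component (- range L) p (Complex M \<eta>)" for p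
      using right right_of_contour_connected by blast
    show "p \<in> PL \<Longrightarrow> \<exists>q. connected_component (- range L) p q \<and> Re q < - M" for p
      using left left_of_contour_connected by blast
    show "closed_segment p (Complex M \<eta>) \<inter> range L = {}" if "M \<le> Re p" for p
    proof -
      have "z \<notin> range L" if "z \<in> closed_segment p (Complex M \<eta>)" for z
        using segment_Re_ge[OF that, of M] \<open>M \<le> Re p\<close> M by (auto simp: abs_less_iff dest: leD)
      then show ?thesis by blast
    qed
    have "eventually (\<lambda>T. Y < Im (L T) \<and> Y < - Im (L (- T))) at_top"
      using up1 up2 by (intro eventually_conj)
    then obtain T0 where T0: "\<And>T. T \<ge> T0 \<Longrightarrow> Y < Im (L T) \<and> Y < - Im (L (- T))"
      by (auto simp: eventually_at_top_linorder)
    have "Im p < Im (L T) \<and> Im (L (- T)) < Im p" if "T \<ge> T0" "p \<in> PR" for T p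
      using T0[OF that(1)] Y[OF that(2)] by linarith
    then show "\<exists>T0. \<forall>T\<ge>T0. \<forall>p\<in>PR. M \<le> Re p \<longrightarrow> Im p < Im (L T) \<and> Im (L (- T)) < Im p"
      by blast
  qed (use finR finL in auto)
  then show "\<exists>C M \<eta>. separating_contour L C M \<eta> PR PL" by blast
  have "Im p < Y + 1" if "p \<in> PR" for p using Y[OF that] by linarith
  then show "\<exists>d. (\<forall>p\<in>PR. Im p < d) \<and> rises L d" using r1 by blast
  have "- (Y + 1) < Im p" if "p \<in> PR" for p using Y[OF that] by linarith
  then show "\<exists>d. (\<forall>p\<in>PR. Im p > d) \<and> rises (\<lambda>t. cnj (L (- t))) (- d)" using r2 by blast
qed

text \<open>Beyond \<open>M\<close> the contour consists of pieces of its two horizontal ends. A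
  right-hand pole in that range lies strictly between them, for otherwise it could be moved around
  the outside of the loop to the far left, against \<open>sides_disjoint\<close>. Since each
  right-hand pole has companions of the same height arbitrarily far to the right, this locates the
  heights of all of them.\<close>

lemma right_loop_shape_separating:
  fixes L :: "real \<Rightarrow> complex"
  assumes pw: "\<And>T. L piecewise_C1_differentiable_on {-T..T}" and shape: "right_loop_shape L \<eta>"
    and bdd: "bdd_below (range (\<lambda>t. Re (L t)))"
    and finR: "\<And>x. finite {p \<in> PR. Re p \<le> x}" and finL: "\<And>x. finite {p \<in> PL. x \<le> Re p}"
    and repeat: "\<And>p x. p \<in> PR \<Longrightarrow> \<exists>p'\<in>PR. Im p' = Im p \<and> x \<le> Re p'"
    and right: "\<And>p. p \<in> PR \<Longrightarrow> right_of_contour L \<eta> p"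
    and left: "\<And>p. p \<in> PL \<Longrightarrow> left_of_contour L \<eta> p"
  shows "\<exists>C M \<eta>. separating_contour L C M \<eta> PR PL"
    "\<exists>d. (\<forall>p\<in>PR. Im p < d) \<and> rises L d"
    "\<exists>d. (\<forall>p\<in>PR. Im p > d) \<and> rises (\<lambda>t. cnj (L (- t))) (- d)"
proof -
  obtain \<phi>1 \<phi>2 where \<phi>: "\<phi>1 < \<eta>" "\<eta> < \<phi>2"
    "eventually (\<lambda>t. Im (L t) = \<phi>1) at_bot" "eventually (\<lambda>t. Im (L t) = \<phi>2) at_top"
    "filterlim (\<lambda>t. Re (L t)) at_top at_bot" "filterlim (\<lambda>t. Re (L t)) at_top at_top"
    using shape by (auto simp: right_loop_shape_def)
  obtain t1 t2 where t1: "\<And>t. t \<le> t1 \<Longrightarrow> Im (L t) = \<phi>1" and t2: "\<And>t. t \<ge> t2 \<Longrightarrow> Im (L t) = \<phi>2"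
    using \<phi>(3,4) by (auto simp: eventually_at_bot_linorder eventually_at_top_linorder)
  define T1 where "T1 = max \<bar>t1\<bar> \<bar>t2\<bar>"
  have T1: "Im (L t) = \<phi>2" if "t \<ge> T1" for t using t2[of t] that by (auto simp: T1_def)
  have T1': "Im (L t) = \<phi>1" if "t \<le> - T1" for t using t1[of t] that by (auto simp: T1_def)
  have T1pos: "T1 \<ge> 0" by (simp add: T1_def)
  have contL: "continuous_on {- T..T} L" for T
    using pw[of T] by (simp add: piecewise_C1_differentiable_on_def)
  obtain B where B: "\<And>t. t \<in> {- T1..T1} \<Longrightarrow> norm (L t) \<le> B"
  proof -
    have "bounded (L ` {- T1..T1})"
      using contL by (intro compact_imp_bounded compact_continuous_image) auto
    then obtain B where "\<forall>x\<in>L ` {- T1..T1}. norm x \<le> B" by (auto simp: bounded_iff)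
    then show ?thesis by (intro that[of B]) blast
  qed
  \<comment> \<open>The arc between \<open>- T1\<close> and \<open>T1\<close> has norm at most
    \<open>B\<close>, so at abscissae from B + 1 on only the horizontal ends are met.\<close>
  define M where "M = B + 1"
  have ReM: "Re (L t) < M" if "t \<in> {- T1..T1}" for t
    using B[OF that] complex_Re_le_cmod[of "L t"] by (simp add: M_def)
  obtain C where C: "\<And>t. - C \<le> Re (L t)"
    using bdd by (auto simp: bdd_below_def) (metis minus_minus)
  define Y where "Y = max B (max \<bar>\<phi>1\<bar> \<bar>\<phi>2\<bar>)"
  have cases3: "t \<in> {- T1..T1} \<or> t \<ge> T1 \<or> t \<le> - T1" for t by auto
  have ImY: "Im (L t) \<le> Y \<and> - Y \<le> Im (L t)" for t
  proof -
    have "\<bar>Im (L t)\<bar> \<le> Y"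
      using cases3[of t] B[of t] abs_Im_le_cmod[of "L t"] T1[of t] T1'[of t] by (auto simp: Y_def)
    then show ?thesis by linarith
  qed
  have ReTop: "eventually (\<lambda>t. c < Re (L t)) at_top" "eventually (\<lambda>t. c < Re (L (- t))) at_top" for c
  proof -
    show "eventually (\<lambda>t. c < Re (L t)) at_top" using \<phi>(6) by (simp add: filterlim_at_top_dense)
    have "eventually (\<lambda>t. c < Re (L t)) at_bot" using \<phi>(5) by (simp add: filterlim_at_top_dense)
    then show "eventually (\<lambda>t. c < Re (L (- t))) at_top" by (simp add: at_bot_mirror eventually_filtermap)
  qed
  have r1: "rises L \<phi>2"
    unfolding rises_def
  proof (intro allI)
    fix c h
    show "eventually (\<lambda>t. h < Im (L t) \<or> c < Re (L t) \<and> \<phi>2 \<le> Im (L t)) at_top"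
      using ReTop(1)[of c] eventually_ge_at_top[of T1] by eventually_elim (auto simp: T1)
  qed
  have r2: "rises (\<lambda>t. cnj (L (- t))) (- \<phi>1)"
    unfolding rises_def
  proof (intro allI)
    fix c h
    show "eventually (\<lambda>t. h < Im (cnj (L (- t))) \<or> c < Re (cnj (L (- t))) \<and> - \<phi>1 \<le> Im (cnj (L (- t)))) at_top"
      using ReTop(2)[of c] eventually_ge_at_top[of T1] by eventually_elim (auto simp: T1')
  qed
  have far: "Im (L t) = \<phi>1 \<or> Im (L t) = \<phi>2" if "M \<le> Re (L t)" for t
    using cases3[of t] ReM[of t] T1 T1' that by fastforce
  interpret escaping_contour L C M \<eta>
  proof
    show "M \<le> Re (L t) \<Longrightarrow> Im (L t) \<noteq> \<eta>" for t using far \<phi>(1,2) by fastforce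
    show "\<exists>T0. \<forall>T\<ge>T0. \<eta> < Im (L T) \<and> Im (L (- T)) < \<eta>"
      using T1 T1' \<phi>(1,2) by (intro exI[of _ T1]) auto
  qed (use pw C rises_escape[OF r1 r2] in auto)
  have strip: "\<phi>1 < Im p \<and> Im p < \<phi>2" if p: "p \<in> PR" "M \<le> Re p" for p
  proof (rule ccontr)
    assume neg: "\<not> (\<phi>1 < Im p \<and> Im p < \<phi>2)"
    note cc = right_of_contour_connected[OF right[OF p(1)]]
    then have pr: "p \<notin> range L" by (auto simp: connected_component_def)
    \<comment> \<open>By the intermediate value theorem the end covers the whole ray, so a point off
      the contour beyond \<open>M\<close> cannot have exactly this height.\<close>
    have ray2: "Complex r \<phi>2 \<in> range L" if "M \<le> r" for r
    proof -
      obtain b where b: "b \<ge> T1" "r \<le> Re (L b)"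
        using eventually_conj[OF ReTop(1)[of r] eventually_ge_at_top[of T1]]
        by (metis (no_types, lifting) eventually_at_top_linorder less_imp_le order_refl)
      have "continuous_on {T1..b} L" using continuous_L continuous_on_subset by blast
      then have "continuous_on {T1..b} (\<lambda>t. Re (L t))" by (intro continuous_intros)
      moreover have "Re (L T1) \<le> r" using ReM[of T1] T1pos that by simp
      ultimately obtain t where "T1 \<le> t" "Re (L t) = r"
        using IVT'[of "\<lambda>t. Re (L t)" T1 r b] b by auto
      then have "L t = Complex r \<phi>2" using T1 by (simp add: complex_eq_iff)
      then show ?thesis by (metis rangeI)
    qed
    have ray1: "Complex r \<phi>1 \<in> range L" if "M \<le> r" for r
    proof -
      obtain b where b: "b \<ge> T1" "r \<le> Re (L (- b))"
        using eventually_conj[OF ReTop(2)[of r] eventually_ge_at_top[of T1]]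
        by (metis (no_types, lifting) eventually_at_top_linorder less_imp_le order_refl)
      have "continuous_on {T1..b} (\<lambda>t. L (- t))"
        by (rule continuous_on_compose2[OF continuous_L]) (auto intro!: continuous_intros)
      then have "continuous_on {T1..b} (\<lambda>t. Re (L (- t)))" by (intro continuous_intros)
      moreover have "Re (L (- T1)) \<le> r" using ReM[of "- T1"] T1pos that by simp
      ultimately obtain t where "T1 \<le> t" "Re (L (- t)) = r"
        using IVT'[of "\<lambda>t. Re (L (- t))" T1 r b] b by auto
      then have "L (- t) = Complex r \<phi>1" using T1' by (simp add: complex_eq_iff)
      then show ?thesis by (metis rangeI)
    qed
    have ne: "Im p \<noteq> \<phi>2" "Im p \<noteq> \<phi>1"
      using pr ray1[OF p(2)] ray2[OF p(2)] by (metis complex_surj)+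
    define q where "q = Complex (- C - 1) 0"
    have conn: "connected (S \<union> {z. Re z < - C})" if "convex S" "S \<inter> {z. Re z < - C} \<noteq> {}" for S
      using that by (intro connected_Un convex_connected convex_halfspace_Re_lt)
    have "connected_component (- range L) p q"
    proof (cases "\<phi>2 < Im p")
      case True
      \<comment> \<open>A connected set off the contour: from p upwards past the bound
        \<open>Y\<close> of all heights on the contour, and from there to the left of
        \<open>- C\<close>.\<close>
      let ?V = "{z. M \<le> Re z \<and> Im p \<le> Im z} \<union> ({z. Y < Im z} \<union> {z. Re z < - C})"
      have "Complex M (max (Im p) (Y + 1)) \<in> {z. M \<le> Re z \<and> Im p \<le> Im z} \<inter> ({z. Y < Im z} \<union> {z. Re z < - C})"
        by (simp add: less_max_iff_disj)
      moreover have "Complex (- C - 1) (Y + 1) \<in> {z. Y < Im z} \<inter> {z. Re z < - C}" by simp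
      ultimately have "connected ?V"
        by (intro connected_Un conn convex_connected convex_box_ge_ge convex_halfspace_Im_gt) blast+
      moreover have "z \<notin> range L" if "z \<in> ?V" for z
      proof
        assume "z \<in> range L"
        then obtain t where t: "z = L t" by blast
        show False
          using that far[of t] ImY[of t] C[of t] True \<phi>(1,2) unfolding t by fastforce
      qed
      moreover have "p \<in> ?V" "q \<in> ?V" using p by (auto simp: q_def)
      ultimately show ?thesis unfolding connected_component_def by blast
    next
      case False
      then have lt: "Im p < \<phi>1" using neg ne by linarith
      let ?V = "{z. M \<le> Re z \<and> Im z \<le> Im p} \<union> ({z. Im z < - Y} \<union> {z. Re z < - C})"
      have "Complex M (min (Im p) (- Y - 1)) \<in> {z. M \<le> Re z \<and> Im z \<le> Im p} \<inter> ({z. Im z < - Y} \<union> {z. Re z < - C})"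
        by (simp add: min_less_iff_disj)
      moreover have "Complex (- C - 1) (- Y - 1) \<in> {z. Im z < - Y} \<inter> {z. Re z < - C}" by simp
      ultimately have "connected ?V"
        by (intro connected_Un conn convex_connected convex_box_ge_le convex_halfspace_Im_lt) blast+
      moreover have "z \<notin> range L" if "z \<in> ?V" for z
      proof
        assume "z \<in> range L"
        then obtain t where t: "z = L t" by blast
        show False
          using that far[of t] ImY[of t] C[of t] lt \<phi>(1,2) unfolding t by fastforce
      qed
      moreover have "p \<in> ?V" "q \<in> ?V" using p by (auto simp: q_def)
      ultimately show ?thesis unfolding connected_component_def by blast
    qed
    then show False by (rule sides_disjoint[OF cc]) (simp add: q_def)
  qed
  have strip': "\<phi>1 < Im p \<and> Im p < \<phi>2" if "p \<in> PR" for p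
    using repeat[OF that, of M] strip by metis
  have "separating_contour L C M \<eta> PR PL"
  proof unfold_locales
    show "p \<in> PR \<Longrightarrow> connected_component (- range L) p (Complex M \<eta>)" for p
      using right right_of_contour_connected by blast
    show "p \<in> PL \<Longrightarrow> \<exists>q. connected_component (- range L) p q \<and> Re q < - C" for p
      using left left_of_contour_connected by blast
    show "closed_segment p (Complex M \<eta>) \<inter> range L = {}" if "p \<in> PR" "M \<le> Re p" for p
    proof -
      have "z \<notin> range L" if z: "z \<in> closed_segment p (Complex M \<eta>)" for z
      proof
        assume "z \<in> range L"
        moreover have "M \<le> Re z" using segment_Re_ge[OF z, of M] \<open>M \<le> Re p\<close> by simp
        moreover have "\<phi>1 < Im z"
          using z closed_segment_subset[OF _ _ convex_halfspace_Im_gt[of \<phi>1], of p "Complex M \<eta>"]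
            strip'[OF \<open>p \<in> PR\<close>] \<phi>(1) by auto
        moreover have "Im z < \<phi>2"
          using z closed_segment_subset[OF _ _ convex_halfspace_Im_lt[of \<phi>2], of p "Complex M \<eta>"]
            strip'[OF \<open>p \<in> PR\<close>] \<phi>(2) by auto
        ultimately show False using far by fastforce
      qed
      then show ?thesis by blast
    qed
    show "\<exists>T0. \<forall>T\<ge>T0. \<forall>p\<in>PR. M \<le> Re p \<longrightarrow> Im p < Im (L T) \<and> Im (L (- T)) < Im p"
      using strip' T1 T1' by (intro exI[of _ T1]) auto
  qed (use finR finL in auto)
  then show "\<exists>C M \<eta>. separating_contour L C M \<eta> PR PL" by blast
  show "\<exists>d. (\<forall>p\<in>PR. Im p < d) \<and> rises L d" using strip' r1 by blast
  show "\<exists>d. (\<forall>p\<in>PR. Im p > d) \<and> rises (\<lambda>t. cnj (L (- t))) (- d)" using strip' r2 by blast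
qed

section \<open>Beta transforms of contour integrals\<close>

lemma sigma_finite_lebesgue: "sigma_finite_measure (lebesgue :: 'a::euclidean_space measure)"
proof
  obtain A :: "'a set set" where A: "countable A" "A \<subseteq> sets lborel" "\<Union>A = space lborel" "\<forall>a\<in>A. emeasure lborel a \<noteq> \<infinity>"
    using sigma_finite_lborel[where ?'a = 'a] unfolding sigma_finite_measure_def by metis
  then have "\<forall>a\<in>A. emeasure lebesgue a \<noteq> \<infinity>"
    by (auto simp: emeasure_completion)
  with A show "\<exists>A :: 'a set set. countable A \<and> A \<subseteq> sets lebesgue \<and> \<Union>A = space lebesgue \<and> (\<forall>a\<in>A. emeasure lebesgue a \<noteq> \<infinity>)"
    by (intro exI[of _ A]) auto
qed

lemma tendsto_inverse_Suc_complex: "(\<lambda>n. complex_of_real (1 / real (Suc n))) \<longlonglongrightarrow> 0"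
proof -
  have "(\<lambda>n. 1 / real (Suc n)) \<longlonglongrightarrow> 0"
    using LIMSEQ_inverse_real_of_nat by (simp only: inverse_eq_divide)
  from tendsto_of_real[OF this, where 'a = complex] show ?thesis by (simp only: of_real_0)
qed

lemma set_integrable_Beta_scaled:
  fixes a b :: complex
  assumes "Re a > 0" "Re b > 0" "v > 0"
  shows "set_integrable lborel {0<..<v} (\<lambda>u. of_real u powr (a - 1) * of_real (v - u) powr (b - 1))"
    and "(LINT u:{0<..<v}|lborel. of_real u powr (a - 1) * of_real (v - u) powr (b - 1)) =
           of_real v powr (a + b - 1) * Beta a b"
proof -
  let ?f = "\<lambda>u. indicator {0<..<v} u *\<^sub>R (complex_of_real u powr (a - 1) * of_real (v - u) powr (b - 1))"
  let ?g = "\<lambda>t. indicator {0<..<1} t *\<^sub>R (complex_of_real t powr (a - 1) * of_real (1 - t) powr (b - 1))"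
  have eq: "?f (0 + v * t) = of_real v powr (a + b - 2) * ?g t" for t
  proof (cases "t \<in> {0<..<1}")
    case True
    then have "v * t \<in> {0<..<v}" using assms by auto
    moreover have "v - v * t = v * (1 - t)" by (simp add: algebra_simps)
    moreover have "complex_of_real (v * t) powr (a - 1) = of_real v powr (a - 1) * of_real t powr (a - 1)"
      using True assms by (simp add: powr_times_real)
    moreover have "complex_of_real (v * (1 - t)) powr (b - 1) = of_real v powr (b - 1) * of_real (1 - t) powr (b - 1)"
      using True assms by (simp add: powr_times_real del: of_real_diff)
    moreover have "complex_of_real v powr (a + b - 2) = of_real v powr (a - 1) * of_real v powr (b - 1)"
      by (simp flip: powr_add add: algebra_simps)
    ultimately show ?thesis using True by simp
  next
    case False
    then have "v * t \<notin> {0<..<v}" using assms by (auto simp: zero_less_mult_iff)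
    with False show ?thesis by simp
  qed
  have gi: "integrable lborel ?g"
    using set_integrable_Beta_complex[OF assms(1,2)] by (simp add: set_integrable_def)
  have "integrable lborel (\<lambda>t. ?f (0 + v * t))"
    unfolding eq using gi by (intro integrable_mult_right) auto
  then show "set_integrable lborel {0<..<v} (\<lambda>u. of_real u powr (a - 1) * of_real (v - u) powr (b - 1))"
    unfolding set_integrable_def using assms lborel_integrable_real_affine_iff[of v ?f 0] by simp
  have "(LINT u:{0<..<v}|lborel. of_real u powr (a - 1) * of_real (v - u) powr (b - 1)) =
      \<bar>v\<bar> *\<^sub>R (\<integral>t. ?f (0 + v * t) \<partial>lborel)"
    unfolding set_lebesgue_integral_def using assms by (intro lborel_integral_real_affine) auto
  also have "\<dots> = of_real v * (of_real v powr (a + b - 2) * (\<integral>t. ?g t \<partial>lborel))"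
    unfolding eq using assms by (simp add: scaleR_conv_of_real)
  also have "(\<integral>t. ?g t \<partial>lborel) = Beta a b"
    using LINT_Beta_complex[OF assms(1,2)] by (simp add: set_lebesgue_integral_def)
  also have "of_real v * (of_real v powr (a + b - 2) * Beta a b) = of_real v powr (a + b - 1) * Beta a b"
  proof -
    have "of_real v powr (a + b - 1) = complex_of_real v powr (1 + (a + b - 2))" by (simp add: algebra_simps)
    also have "\<dots> = of_real v * of_real v powr (a + b - 2)" using assms by (subst powr_add) simp
    finally show ?thesis by simp
  qed
  finally show "(LINT u:{0<..<v}|lborel. of_real u powr (a - 1) * of_real (v - u) powr (b - 1)) =
           of_real v powr (a + b - 1) * Beta a b" .
qed

lemma LINT_norm_Beta_scaled:
  fixes a b :: complex
  assumes "Re a > 0" "Re b > 0" "v > 0"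
  shows "(LINT u:{0<..<v}|lborel. norm (of_real u powr (a - 1) * of_real (v - u) powr (b - 1))) =
           v powr (Re a + Re b - 1) * Beta (Re a) (Re b)"
proof -
  let ?N = "\<lambda>u. norm (complex_of_real u powr (a - 1) * of_real (v - u) powr (b - 1))"
  have "complex_of_real (LINT u:{0<..<v}|lborel. ?N u) = (LINT u:{0<..<v}|lborel. complex_of_real (?N u))"
    by (simp add: set_lebesgue_integral_def scaleR_conv_of_real flip: of_real_mult)
  also have "\<dots> = (LINT u:{0<..<v}|lborel. of_real u powr (of_real (Re a) - 1) * of_real (v - u) powr (of_real (Re b) - 1))"
  proof (intro set_lebesgue_integral_cong ballI allI impI)
    fix u assume "u \<in> {0<..<v}"
    then have u: "u > 0" "v - u > 0" by auto
    have "complex_of_real u powr (of_real (Re a) - 1) = of_real (u powr (Re a - 1))"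
      using u powr_of_real[of u "Re a - 1"] by simp
    moreover have "complex_of_real (v - u) powr (of_real (Re b) - 1) = of_real ((v - u) powr (Re b - 1))"
      using u powr_of_real[of "v - u" "Re b - 1"] by simp
    moreover have "?N u = u powr (Re a - 1) * (v - u) powr (Re b - 1)"
      unfolding norm_mult norm_of_real_powr[OF u(1)] norm_of_real_powr[OF u(2)] by simp
    ultimately show "complex_of_real (?N u) = of_real u powr (of_real (Re a) - 1) * of_real (v - u) powr (of_real (Re b) - 1)"
      by simp
  qed simp
  also have "\<dots> = of_real v powr (of_real (Re a) + of_real (Re b) - 1) * Beta (of_real (Re a)) (of_real (Re b))"
    using assms by (intro set_integrable_Beta_scaled(2)) auto
  also have "\<dots> = of_real (v powr (Re a + Re b - 1) * Beta (Re a) (Re b))"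
    using assms powr_of_real[of v "Re a + Re b - 1"] by (simp add: Beta_complex_of_real)
  finally show ?thesis by (simp only: of_real_eq_iff)
qed

section \<open>Kernel integrals and their analytic continuation in the exponent\<close>

locale Beta_transform =
  fixes v :: real and \<mu> \<beta> :: complex and \<alpha> \<delta> :: real
  assumes v: "v > 0" and mu: "Re \<mu> > 0" and alpha: "\<alpha> > 0" and delta: "\<delta> > 0"
begin

text \<open>A half-strip that has 0 in its interior and contains all nonnegative reals. The bound on
  Im l prevents the shift by l from bringing points of height at least 2 close to the real
  axis.\<close>

definition D :: "complex set" where
  "D = {l. Re l > - \<delta> \<and> \<bar>Im l\<bar> < 1}"

definition ratio :: "complex \<Rightarrow> complex" where
  "ratio s = Gamma s * rGamma (s + \<mu>)"

definition kernel :: "complex \<Rightarrow> real \<Rightarrow> complex" where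
  "kernel l u = of_real u powr (\<beta> + l - 1) * of_real (v - u) powr (\<mu> - 1)"

text \<open>\<open>\<Phi>\<close> plays the role of an analytic continuation of the kernel integral
  of \<open>P\<close>, whose convergence is demanded for large real l only. The notion is thus
  additive over the pieces of a contour, although the kernel integral of a single piece may diverge
  at l = 0.\<close>

definition transforms :: "(real \<Rightarrow> complex) \<Rightarrow> (complex \<Rightarrow> complex) \<Rightarrow> bool" where
  "transforms P \<Phi> \<longleftrightarrow> \<Phi> holomorphic_on D \<and>
     (\<exists>\<Lambda>. \<forall>l::real. l \<ge> \<Lambda> \<longrightarrow> set_integrable lborel {0<..<v} (\<lambda>u. kernel (of_real l) u * P u) \<and>
        (LINT u:{0<..<v}|lborel. kernel (of_real l) u * P u) = \<Phi> (of_real l))"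

lemma open_D: "open D"
proof -
  have "D = {l. - \<delta> < Re l} \<inter> ({l. Im l < 1} \<inter> {l. - 1 < Im l})"
    by (auto simp: D_def)
  then show ?thesis
    by (simp add: open_Int open_halfspace_Re_gt open_halfspace_Im_lt open_halfspace_Im_gt)
qed

lemma transforms_add:
  assumes "transforms P1 \<Phi>1" "transforms P2 \<Phi>2"
  shows "transforms (\<lambda>u. P1 u + P2 u) (\<lambda>l. \<Phi>1 l + \<Phi>2 l)"
proof -
  obtain \<Lambda>1 where 1: "\<Phi>1 holomorphic_on D" "\<And>l::real. l \<ge> \<Lambda>1 \<Longrightarrow> set_integrable lborel {0<..<v} (\<lambda>u. kernel (of_real l) u * P1 u) \<and>
        (LINT u:{0<..<v}|lborel. kernel (of_real l) u * P1 u) = \<Phi>1 (of_real l)"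
    using assms(1) unfolding transforms_def by blast
  obtain \<Lambda>2 where 2: "\<Phi>2 holomorphic_on D" "\<And>l::real. l \<ge> \<Lambda>2 \<Longrightarrow> set_integrable lborel {0<..<v} (\<lambda>u. kernel (of_real l) u * P2 u) \<and>
        (LINT u:{0<..<v}|lborel. kernel (of_real l) u * P2 u) = \<Phi>2 (of_real l)"
    using assms(2) unfolding transforms_def by blast
  show ?thesis
    unfolding transforms_def distrib_left
  proof (intro conjI exI[of _ "max \<Lambda>1 \<Lambda>2"] allI impI)
    fix l :: real assume l: "max \<Lambda>1 \<Lambda>2 \<le> l"
    note a = 1(2)[of l] 2(2)[of l]
    show "set_integrable lborel {0<..<v} (\<lambda>u. kernel (of_real l) u * P1 u + kernel (of_real l) u * P2 u)"
      "(LINT u:{0<..<v}|lborel. kernel (of_real l) u * P1 u + kernel (of_real l) u * P2 u) = \<Phi>1 l + \<Phi>2 l"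
      using a l by (simp_all add: set_integral_add)
  qed (use 1 2 in \<open>auto intro: holomorphic_intros\<close>)
qed

lemma transforms_cmult:
  assumes "transforms P \<Phi>"
  shows "transforms (\<lambda>u. c * P u) (\<lambda>l. c * \<Phi> l)"
proof -
  obtain \<Lambda> where 1: "\<Phi> holomorphic_on D" "\<And>l::real. l \<ge> \<Lambda> \<Longrightarrow> set_integrable lborel {0<..<v} (\<lambda>u. kernel (of_real l) u * P u) \<and>
        (LINT u:{0<..<v}|lborel. kernel (of_real l) u * P u) = \<Phi> (of_real l)"
    using assms(1) unfolding transforms_def by blast
  show ?thesis
    unfolding transforms_def mult.left_commute[of _ c]
  proof (intro conjI exI[of _ \<Lambda>] allI impI)
    fix l :: real assume l: "\<Lambda> \<le> l"
    show "set_integrable lborel {0<..<v} (\<lambda>u. c * (kernel (of_real l) u * P u))"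
      "(LINT u:{0<..<v}|lborel. c * (kernel (of_real l) u * P u)) = c * \<Phi> l"
      using 1(2)[OF l] by simp_all
  qed (use 1 in \<open>auto intro: holomorphic_intros\<close>)
qed

lemma transforms_zero: "transforms (\<lambda>_. 0) (\<lambda>_. 0)"
  by (simp add: transforms_def set_integrable_def set_lebesgue_integral_def)

lemma transforms_sum:
  assumes "finite A" "\<And>i. i \<in> A \<Longrightarrow> transforms (P i) (\<Phi> i)"
  shows "transforms (\<lambda>u. \<Sum>i\<in>A. P i u) (\<lambda>l. \<Sum>i\<in>A. \<Phi> i l)"
  using assms by (induction A rule: finite_induct) (auto intro: transforms_zero transforms_add)

lemma kernel_split: "u > 0 \<Longrightarrow> kernel l u = of_real u powr l * kernel 0 u"
  using powr_add[of "complex_of_real u" l "\<beta> - 1"] by (simp add: kernel_def algebra_simps)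

text \<open>On (0, v) the factor u^l with Re l > 0 is bounded, locally uniformly in l, so
  integrability of \<open>f\<close> is enough. The boundary point l = 0 is left to
  \<open>tendsto_powr_integral\<close>.\<close>

lemma holomorphic_powr_integral:
  assumes f: "set_integrable lborel {0<..<v} f"
  shows "(\<lambda>l. LINT u:{0<..<v}|lborel. complex_of_real u powr l * f u) holomorphic_on {l. Re l > 0}"
  unfolding set_lebesgue_integral_def
proof (rule holomorphic_on_lebesgue_integral)
  show "open {l. 0 < Re l}" by (rule open_halfspace_Re_gt)
  fix u :: real
  show "(\<lambda>l. indicat_real {0<..<v} u *\<^sub>R (complex_of_real u powr l * f u)) holomorphic_on {l. 0 < Re l}"
    by (cases "u \<in> {0<..<v}") (auto intro!: holomorphic_intros)
next
  fix l :: complex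
  have "(\<lambda>u. indicator {0<..<v} u *\<^sub>R (complex_of_real u powr l * f u)) =
        (\<lambda>u. complex_of_real u powr l * (indicator {0<..<v} u *\<^sub>R f u))"
    by (auto simp: indicator_def)
  moreover have [measurable]: "(\<lambda>u. indicator {0<..<v} u *\<^sub>R f u) \<in> borel_measurable lborel"
    using f by (auto simp: set_integrable_def)
  have "(\<lambda>u. complex_of_real u powr l * (indicator {0<..<v} u *\<^sub>R f u)) \<in> borel_measurable lborel"
    by measurable
  ultimately show "(\<lambda>u. indicator {0<..<v} u *\<^sub>R (complex_of_real u powr l * f u)) \<in> borel_measurable lborel"
    by (simp only:)
next
  fix l0 :: complex assume "l0 \<in> {l. 0 < Re l}"
  then have l0: "Re l0 > 0" by simp
  define r where "r = Re l0 / 2"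
  have R: "r > 0" "Re l0 - r > 0" using l0 by (auto simp: r_def)
  have Rl: "0 < Re l" "Re l \<le> Re l0 + r" if "l \<in> cball l0 r" for l
    using abs_Re_le_cmod[of "l0 - l"] that R by (auto simp: dist_norm)
  let ?c = "1 + v powr (Re l0 + r)"
  let ?g = "\<lambda>u. ?c * norm (indicator {0<..<v} u *\<^sub>R f u)"
  have "norm (indicator {0<..<v} u *\<^sub>R (complex_of_real u powr l * f u)) \<le> ?g u" if l: "l \<in> cball l0 r" for l u
  proof (cases "u \<in> {0<..<v}")
    case True
    then have "u powr Re l \<le> u powr 0 + u powr (Re l0 + r)"
      using Rl[OF l] by (intro powr_le_powr_add_powr) auto
    also have "u powr (Re l0 + r) \<le> v powr (Re l0 + r)"
      using True R by (intro powr_mono2) auto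
    finally have "u powr Re l \<le> ?c" using True by simp
    then have "u powr Re l * norm (f u) \<le> ?c * norm (f u)" by (intro mult_right_mono) auto
    then show ?thesis using True by (simp add: norm_mult norm_of_real_powr)
  qed auto
  moreover have "integrable lborel ?g"
    using f unfolding set_integrable_def by (intro integrable_mult_right integrable_norm) auto
  moreover have "cball l0 r \<subseteq> {l. Re l > 0}" using Rl by auto
  ultimately show "\<exists>r>0. \<exists>g. cball l0 r \<subseteq> {l. 0 < Re l} \<and> integrable lborel g \<and>
      (\<forall>l\<in>cball l0 r. \<forall>u\<in>space lborel. norm (indicat_real {0<..<v} u *\<^sub>R (complex_of_real u powr l * f u)) \<le> g u)"
    using R(1) by blast
qed

lemma tendsto_powr_integral:
  assumes f: "set_integrable lborel {0<..<v} f"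
  shows "(\<lambda>n. LINT u:{0<..<v}|lborel. complex_of_real u powr of_real (1 / real (Suc n)) * f u)
           \<longlonglongrightarrow> (LINT u:{0<..<v}|lborel. f u)"
  unfolding set_lebesgue_integral_def
proof (rule integral_dominated_convergence[where w = "\<lambda>u. (1 + v) * norm (indicator {0<..<v} u *\<^sub>R f u)"])
  have fm [measurable]: "(\<lambda>u. indicator {0<..<v} u *\<^sub>R f u) \<in> borel_measurable lborel"
    using f by (auto simp: set_integrable_def)
  then show "(\<lambda>u. indicator {0<..<v} u *\<^sub>R f u) \<in> borel_measurable lborel" .
  show "(\<lambda>u. indicator {0<..<v} u *\<^sub>R (complex_of_real u powr of_real (1 / real (Suc n)) * f u)) \<in> borel_measurable lborel" for n
  proof -
    have "(\<lambda>u. indicator {0<..<v} u *\<^sub>R (complex_of_real u powr of_real (1 / real (Suc n)) * f u)) =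
        (\<lambda>u. complex_of_real u powr of_real (1 / real (Suc n)) * (indicator {0<..<v} u *\<^sub>R f u))"
      by (auto simp: indicator_def)
    moreover have "(\<lambda>u. complex_of_real u powr of_real (1 / real (Suc n)) * (indicator {0<..<v} u *\<^sub>R f u)) \<in> borel_measurable lborel"
      by measurable
    ultimately show ?thesis by (simp only:)
  qed
  show "integrable lborel (\<lambda>u. (1 + v) * norm (indicator {0<..<v} u *\<^sub>R f u))"
    using f unfolding set_integrable_def by (intro integrable_mult_right integrable_norm) auto
  show "AE u in lborel. (\<lambda>n. indicator {0<..<v} u *\<^sub>R (complex_of_real u powr of_real (1 / real (Suc n)) * f u)) \<longlonglongrightarrow>
      indicator {0<..<v} u *\<^sub>R f u"
  proof (rule AE_I2)
    fix u :: real
    show "(\<lambda>n. indicator {0<..<v} u *\<^sub>R (complex_of_real u powr of_real (1 / real (Suc n)) * f u)) \<longlonglongrightarrow>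
      indicator {0<..<v} u *\<^sub>R f u"
    proof (cases "u \<in> {0<..<v}")
      case True
      have "(\<lambda>n. exp (complex_of_real (1 / real (Suc n)) * Ln (of_real u)) * f u) \<longlonglongrightarrow> exp (0 * Ln (of_real u)) * f u"
        by (intro tendsto_intros tendsto_inverse_Suc_complex)
      then show ?thesis using True by (simp add: powr_def)
    qed auto
  qed
  show "AE u in lborel. norm (indicator {0<..<v} u *\<^sub>R (complex_of_real u powr of_real (1 / real (Suc n)) * f u)) \<le>
      (1 + v) * norm (indicator {0<..<v} u *\<^sub>R f u)" for n
  proof (rule AE_I2)
    fix u :: real
    show "norm (indicator {0<..<v} u *\<^sub>R (complex_of_real u powr of_real (1 / real (Suc n)) * f u)) \<le>
      (1 + v) * norm (indicator {0<..<v} u *\<^sub>R f u)"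
    proof (cases "u \<in> {0<..<v}")
      case True
      then have "u powr (1 / real (Suc n)) \<le> u powr 0 + u powr 1"
        by (intro powr_le_powr_add_powr) auto
      also have "\<dots> \<le> 1 + v" using True by simp
      finally have "u powr (1 / real (Suc n)) * norm (f u) \<le> (1 + v) * norm (f u)" by (intro mult_right_mono) auto
      then show ?thesis using True norm_of_real_powr[of u "of_real (1 / real (Suc n))"] by (simp add: norm_mult)
    qed auto
  qed
qed

text \<open>Analytic continuation in the parameter of the kernel from large real values down to \<open>0\<close>.\<close>

theorem transforms_at_0:
  assumes T: "transforms P \<Phi>" and int: "set_integrable lborel {0<..<v} (\<lambda>u. kernel 0 u * P u)"
  shows "(LINT u:{0<..<v}|lborel. kernel 0 u * P u) = \<Phi> 0"
proof -
  let ?f = "\<lambda>u. kernel 0 u * P u"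
  define A where "A l = (LINT u:{0<..<v}|lborel. complex_of_real u powr l * ?f u)" for l
  obtain \<Lambda> where \<Phi>: "\<Phi> holomorphic_on D"
    and \<Lambda>: "\<And>l::real. l \<ge> \<Lambda> \<Longrightarrow> (LINT u:{0<..<v}|lborel. kernel (of_real l) u * P u) = \<Phi> (of_real l)"
    using T unfolding transforms_def by blast
  have A_kernel: "A l = (LINT u:{0<..<v}|lborel. kernel l u * P u)" for l
    unfolding A_def by (intro set_lebesgue_integral_cong) (auto simp: kernel_split[of _ l] mult.assoc)
  let ?E = "{l. Re l > 0} \<inter> ({l. Im l < 1} \<inter> {l. - 1 < Im l})"
  have ED: "?E \<subseteq> D" using delta by (auto simp: D_def)
  have eq: "A l - \<Phi> l = 0" if "l \<in> ?E" for l
  proof (rule analytic_continuation[where f = "\<lambda>l. A l - \<Phi> l" and S = ?E and U = "of_real ` {max \<Lambda> 1<..}"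
        and \<xi> = "of_real (max \<Lambda> 1 + 1)"])
    have "A holomorphic_on {l. Re l > 0}"
      using holomorphic_powr_integral[OF int] by (simp add: A_def[abs_def])
    then show "(\<lambda>l. A l - \<Phi> l) holomorphic_on ?E"
      using holomorphic_on_subset[OF \<Phi> ED] by (intro holomorphic_intros) (auto elim: holomorphic_on_subset)
    show "open ?E" by (intro open_Int open_halfspace_Re_gt open_halfspace_Im_lt open_halfspace_Im_gt)
    show "connected ?E"
      by (intro convex_connected convex_Int convex_halfspace_Re_gt convex_halfspace_Im_lt convex_halfspace_Im_gt)
    show "complex_of_real (max \<Lambda> 1 + 1) islimpt complex_of_real ` {max \<Lambda> 1<..}" by (rule of_real_greaterThan_islimpt)
    show "A z - \<Phi> z = 0" if "z \<in> complex_of_real ` {max \<Lambda> 1<..}" for z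
      using that \<Lambda> by (auto simp: A_kernel)
  qed (use that in auto)
  \<comment> \<open>The point 0 lies on the boundary of the half-plane where \<open>A\<close> is
    holomorphic and is reached only as a limit through positive reals; for \<open>\<Phi>\<close> it
    is an interior point of \<open>D\<close>.\<close>
  have "(\<lambda>n. A (of_real (1 / real (Suc n)))) \<longlonglongrightarrow> (LINT u:{0<..<v}|lborel. ?f u)"
    unfolding A_def by (rule tendsto_powr_integral[OF int])
  moreover have "A (of_real (1 / real (Suc n))) = \<Phi> (of_real (1 / real (Suc n)))" for n
    using eq[of "of_real (1 / real (Suc n))"] by (simp del: of_real_divide)
  moreover have "(\<lambda>n. \<Phi> (of_real (1 / real (Suc n)))) \<longlonglongrightarrow> \<Phi> 0"
  proof -
    have "isCont \<Phi> 0"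
      using holomorphic_on_imp_continuous_on[OF \<Phi>] open_D delta
      by (auto simp: continuous_on_eq_continuous_at D_def)
    then show ?thesis
      using tendsto_inverse_Suc_complex by (rule isCont_tendsto_compose)
  qed
  ultimately show ?thesis
    by (simp add: LIMSEQ_unique)
qed

section \<open>The quotient of Gamma functions along pieces of a contour\<close>

text \<open>The margins 2\<delta> and 2 are such that after the shift by any l in \<open>D\<close>
  the real part still exceeds \<delta> or the height still exceeds 1, away from the poles of
  \<Gamma>. The lower bound -N limits how often the functional equation has to be used.\<close>

definition region :: "real \<Rightarrow> complex set" where
  "region N = {\<xi>. - N \<le> Re (\<beta> + of_real \<alpha> * \<xi>) \<and>
     (2 * \<delta> \<le> Re (\<beta> + of_real \<alpha> * \<xi>) \<or> 2 \<le> \<bar>Im (\<beta> + of_real \<alpha> * \<xi>)\<bar>)}"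

lemma ratio_bounded:
  "\<exists>B\<ge>0. \<forall>l\<in>D. \<forall>\<xi>\<in>region N. norm (ratio (\<beta> + l + of_real \<alpha> * \<xi>)) \<le> B"
proof -
  \<comment> \<open>From Re s >= -N - \<delta> >= 1 - n it follows that n steps of the functional
    equation suffice.\<close>
  define n where "n = nat \<lceil>N + \<delta> + 1\<rceil>"
  define B1 where "B1 = Beta \<delta> (Re \<mu>) * norm (rGamma \<mu>)"
  define B2 where "B2 = (1 + norm \<mu>) ^ n * (Beta 1 (Re \<mu>) * norm (rGamma \<mu>))"
  have "norm (ratio (\<beta> + l + of_real \<alpha> * \<xi>)) \<le> max 0 (max B1 B2)" if l: "l \<in> D" and \<xi>: "\<xi> \<in> region N" for l \<xi>
  proof -
    let ?s = "\<beta> + l + of_real \<alpha> * \<xi>"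
    have Re_s: "Re ?s = Re (\<beta> + of_real \<alpha> * \<xi>) + Re l" and Im_s: "Im ?s = Im (\<beta> + of_real \<alpha> * \<xi>) + Im l" by simp_all
    have ll: "Re l > - \<delta>" "\<bar>Im l\<bar> < 1" using l by (simp_all add: D_def)
    have low: "Re ?s \<ge> - N - \<delta>" using \<xi> ll Re_s unfolding region_def by simp
    have "N + \<delta> + 1 \<le> real n" unfolding n_def by linarith
    then have low': "Re ?s \<ge> 1 - real n" using low by linarith
    consider "\<delta> \<le> Re ?s" | "1 \<le> \<bar>Im ?s\<bar>"
      using \<xi> ll Re_s Im_s unfolding region_def by fastforce
    then show ?thesis
    proof cases
      case 1
      then have "norm (ratio ?s) \<le> B1"
        unfolding ratio_def B1_def using delta mu by (intro norm_Gamma_ratio_le)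
      then show ?thesis by simp
    next
      case 2
      then have "norm (ratio ?s) \<le> B2"
        unfolding ratio_def B2_def using mu low' by (intro norm_Gamma_ratio_le_off_axis)
      then show ?thesis by simp
    qed
  qed
  then show ?thesis by (intro exI[of _ "max 0 (max B1 B2)"]) auto
qed

lemma ratio_holomorphic:
  assumes "\<xi> \<in> region N"
  shows "(\<lambda>l. ratio (\<beta> + l + of_real \<alpha> * \<xi>)) holomorphic_on D"
proof -
  have "\<beta> + l + of_real \<alpha> * \<xi> \<notin> \<int>\<^sub>\<le>\<^sub>0" if l: "l \<in> D" for l
  proof
    let ?s = "\<beta> + l + of_real \<alpha> * \<xi>"
    assume "?s \<in> \<int>\<^sub>\<le>\<^sub>0"
    then obtain n :: int where n: "?s = of_int n" "n \<le> 0" by (auto elim!: nonpos_Ints_cases)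
    have "Re ?s \<le> 0" "Im ?s = 0" unfolding n(1) using n(2) by simp_all
    moreover have "Re ?s = Re (\<beta> + of_real \<alpha> * \<xi>) + Re l" "Im ?s = Im (\<beta> + of_real \<alpha> * \<xi>) + Im l" by simp_all
    moreover have "Re l > - \<delta>" "\<bar>Im l\<bar> < 1" using l by (simp_all add: D_def)
    moreover have "2 * \<delta> \<le> Re (\<beta> + of_real \<alpha> * \<xi>) \<or> 2 \<le> \<bar>Im (\<beta> + of_real \<alpha> * \<xi>)\<bar>"
      using assms by (simp add: region_def)
    ultimately show False using delta by linarith
  qed
  then show ?thesis unfolding ratio_def by (intro holomorphic_intros) auto
qed

lemma measurable_Gamma_complex [measurable]: "(Gamma :: complex \<Rightarrow> complex) \<in> borel_measurable borel"
proof -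
  have "(\<lambda>z::complex. inverse (rGamma z)) \<in> borel_measurable borel"
    by (intro borel_measurable_inverse borel_measurable_continuous_onI continuous_on_rGamma)
  then show ?thesis by (simp add: rGamma_inverse_Gamma)
qed

lemma measurable_rGamma_complex [measurable]: "(rGamma :: complex \<Rightarrow> complex) \<in> borel_measurable borel"
  by (intro borel_measurable_continuous_onI continuous_on_rGamma)

lemma measurable_ratio [measurable]: "ratio \<in> borel_measurable borel"
  unfolding ratio_def[abs_def] by measurable

lemma ratio_times_integrable:
  assumes S: "S \<in> sets lebesgue"
    and h: "set_integrable lebesgue S h"
    and \<gamma>: "(\<lambda>t. indicator S t *\<^sub>R \<gamma> t) \<in> borel_measurable lebesgue"
    and R: "\<And>t. t \<in> S \<Longrightarrow> \<gamma> t \<in> region N"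
    and l: "l \<in> D"
  shows "set_integrable lebesgue S (\<lambda>t. h t * ratio (\<beta> + l + of_real \<alpha> * \<gamma> t))"
    "(\<lambda>t. indicator S t *\<^sub>R (h t * ratio (\<beta> + l + of_real \<alpha> * \<gamma> t))) \<in> borel_measurable lebesgue"
proof -
  obtain B where B: "B \<ge> 0" "\<And>l \<xi>. l \<in> D \<Longrightarrow> \<xi> \<in> region N \<Longrightarrow> norm (ratio (\<beta> + l + of_real \<alpha> * \<xi>)) \<le> B"
    using ratio_bounded by blast
  note \<gamma>[measurable]
  have hm[measurable]: "(\<lambda>t. indicator S t *\<^sub>R h t) \<in> borel_measurable lebesgue"
    using h by (auto simp: set_integrable_def)
  have "(\<lambda>t. indicator S t *\<^sub>R (h t * ratio (\<beta> + l + of_real \<alpha> * \<gamma> t))) =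
    (\<lambda>t. (indicator S t *\<^sub>R h t) * ratio (\<beta> + l + of_real \<alpha> * (indicator S t *\<^sub>R \<gamma> t)))"
    by (auto simp: indicator_def)
  moreover have "(\<lambda>t. (indicator S t *\<^sub>R h t) * ratio (\<beta> + l + of_real \<alpha> * (indicator S t *\<^sub>R \<gamma> t))) \<in> borel_measurable lebesgue"
    by measurable
  ultimately show m: "(\<lambda>t. indicator S t *\<^sub>R (h t * ratio (\<beta> + l + of_real \<alpha> * \<gamma> t))) \<in> borel_measurable lebesgue"
    by (simp only:)
  show "set_integrable lebesgue S (\<lambda>t. h t * ratio (\<beta> + l + of_real \<alpha> * \<gamma> t))"
    unfolding set_integrable_def
  proof (rule Bochner_Integration.integrable_bound[OF _ m AE_I2])
    show "integrable lebesgue (\<lambda>t. B * norm (indicator S t *\<^sub>R h t))"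
      using h unfolding set_integrable_def by (intro integrable_mult_right integrable_norm) auto
    show "norm (indicator S t *\<^sub>R (h t * ratio (\<beta> + l + of_real \<alpha> * \<gamma> t))) \<le> norm (B * norm (indicator S t *\<^sub>R h t))" for t
      using B(1) mult_left_mono[OF B(2)[OF l R[of t]], of "norm (h t)"]
      by (cases "t \<in> S") (simp_all add: norm_mult mult.commute)
  qed
qed

text \<open>The factor \<open>h\<close> contains the velocity of the curve, and its measurability
  comes only through an integrable product at the one value v. Division by the nowhere vanishing
  power of v recovers \<open>h\<close>, which can then be multiplied by powers of any u.\<close>

lemma measurable_indicator_powr:
  fixes h \<gamma> :: "real \<Rightarrow> complex"
  assumes [measurable]: "(\<lambda>t. indicator S t *\<^sub>R \<gamma> t) \<in> borel_measurable M"
    and [measurable]: "(\<lambda>t. indicator S t *\<^sub>R (h t * of_real v powr (of_real \<alpha> * \<gamma> t))) \<in> borel_measurable M"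
  shows "(\<lambda>t. indicator S t *\<^sub>R h t) \<in> borel_measurable M"
proof -
  have "(\<lambda>t. indicator S t *\<^sub>R h t) = (\<lambda>t. (indicator S t *\<^sub>R (h t * of_real v powr (of_real \<alpha> * \<gamma> t))) *
      of_real v powr (- of_real \<alpha> * (indicator S t *\<^sub>R \<gamma> t)))"
    using v by (auto simp: indicator_def fun_eq_iff powr_minus field_simps)
  moreover have "(\<lambda>t. (indicator S t *\<^sub>R (h t * of_real v powr (of_real \<alpha> * \<gamma> t))) *
      of_real v powr (- of_real \<alpha> * (indicator S t *\<^sub>R \<gamma> t))) \<in> borel_measurable M"
    by measurable
  ultimately show ?thesis by (simp only:)
qed

text \<open>For l >= N + 1 the exponent satisfies Re (\<beta> + l + \<alpha>\<gamma>(t)) >= 1 on the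
  whole piece, so Fubini applies and the inner u-integral is a Beta function. The outcome is
  holomorphic on all of \<open>D\<close>, because the quotient of Gamma functions is bounded there
  and keeps the majorant integrable.\<close>

lemma transforms_contour_piece:
  fixes h \<gamma> :: "real \<Rightarrow> complex"
  assumes S: "S \<in> sets lebesgue"
    and h: "set_integrable lebesgue S (\<lambda>t. h t * of_real v powr (of_real \<alpha> * \<gamma> t))"
    and \<gamma>: "(\<lambda>t. indicator S t *\<^sub>R \<gamma> t) \<in> borel_measurable lebesgue"
    and R: "\<And>t. t \<in> S \<Longrightarrow> \<gamma> t \<in> region N"
  shows "transforms (\<lambda>u. LINT t:S|lebesgue. h t * of_real u powr (of_real \<alpha> * \<gamma> t))
     (\<lambda>l. Gamma \<mu> * of_real v powr (\<beta> + l + \<mu> - 1) *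
       (LINT t:S|lebesgue. h t * of_real v powr (of_real \<alpha> * \<gamma> t) * ratio (\<beta> + l + of_real \<alpha> * \<gamma> t)))"
  unfolding transforms_def
proof (intro conjI exI[of _ "N + 1"] allI impI)
  let ?h = "\<lambda>t. h t * of_real v powr (of_real \<alpha> * \<gamma> t)"
  obtain B where B: "B \<ge> 0" "\<And>l \<xi>. l \<in> D \<Longrightarrow> \<xi> \<in> region N \<Longrightarrow> norm (ratio (\<beta> + l + of_real \<alpha> * \<xi>)) \<le> B"
    using ratio_bounded by blast
  have "(\<lambda>l. LINT t:S|lebesgue. ?h t * ratio (\<beta> + l + of_real \<alpha> * \<gamma> t)) holomorphic_on D"
    unfolding set_lebesgue_integral_def
  proof (rule holomorphic_on_lebesgue_integral[OF open_D])
    fix t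
    show "(\<lambda>l. indicat_real S t *\<^sub>R (?h t * ratio (\<beta> + l + of_real \<alpha> * \<gamma> t))) holomorphic_on D"
      using ratio_holomorphic[OF R] by (cases "t \<in> S") (auto intro!: holomorphic_intros)
  next
    fix l assume "l \<in> D"
    then show "(\<lambda>t. indicator S t *\<^sub>R (?h t * ratio (\<beta> + l + of_real \<alpha> * \<gamma> t))) \<in> borel_measurable lebesgue"
      using ratio_times_integrable(2)[OF S h \<gamma> R] by blast
  next
    fix l0 assume "l0 \<in> D"
    then obtain r where r: "r > 0" "cball l0 r \<subseteq> D" using open_D open_contains_cball by blast
    have "integrable lebesgue (\<lambda>t. B * norm (indicator S t *\<^sub>R ?h t))"
      using h unfolding set_integrable_def by (intro integrable_mult_right integrable_norm) auto
    moreover have "norm (indicator S t *\<^sub>R (?h t * ratio (\<beta> + l + of_real \<alpha> * \<gamma> t))) \<le> B * norm (indicator S t *\<^sub>R ?h t)"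
      if "l \<in> cball l0 r" for l t
    proof (cases "t \<in> S")
      case True
      have "l \<in> D" using that r by blast
      from mult_left_mono[OF B(2)[OF this R[OF True]], of "norm (?h t)"] show ?thesis
        using True by (simp add: norm_mult mult_ac)
    qed auto
    ultimately show "\<exists>r>0. \<exists>g. cball l0 r \<subseteq> D \<and> integrable lebesgue g \<and> (\<forall>l\<in>cball l0 r. \<forall>t\<in>space lebesgue.
        norm (indicat_real S t *\<^sub>R (?h t * ratio (\<beta> + l + of_real \<alpha> * \<gamma> t))) \<le> g t)"
      using r by (intro exI[of _ r] conjI exI[of _ "\<lambda>t. B * norm (indicator S t *\<^sub>R ?h t)"]) auto
  qed
  then show "(\<lambda>l. Gamma \<mu> * of_real v powr (\<beta> + l + \<mu> - 1) *
       (LINT t:S|lebesgue. ?h t * ratio (\<beta> + l + of_real \<alpha> * \<gamma> t))) holomorphic_on D"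
    using v by (intro holomorphic_intros) auto
  fix l :: real assume l: "N + 1 \<le> l"
  let ?s = "\<lambda>t. \<beta> + of_real l + of_real \<alpha> * \<gamma> t"
  have s1: "Re (?s t) \<ge> 1" if "t \<in> S" for t
    using R[OF that] l by (simp add: region_def)
  interpret pair_sigma_finite "lebesgue :: real measure" "lborel :: real measure"
    unfolding pair_sigma_finite_def using sigma_finite_lebesgue sigma_finite_lborel by blast
  let ?b = "\<lambda>t u. indicator {0<..<v} u *\<^sub>R (complex_of_real u powr (?s t - 1) * of_real (v - u) powr (\<mu> - 1))"
  \<comment> \<open>The curve is cut off by the indicator also inside the exponent, since its
    measurability is given only in this form; for t outside \<open>S\<close> the factor with
    \<open>h\<close> makes the product zero.\<close>
  let ?F = "\<lambda>t u. (indicator S t *\<^sub>R h t) *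
       (indicator {0<..<v} u *\<^sub>R (complex_of_real u powr (\<beta> + of_real l + of_real \<alpha> * (indicator S t *\<^sub>R \<gamma> t) - 1) * of_real (v - u) powr (\<mu> - 1)))"
  have F_in: "?F t u = h t * ?b t u" if "t \<in> S" for t u using that by simp
  have F_out: "?F t u = 0" if "t \<notin> S" for t u using that by simp
  have hm[measurable]: "(\<lambda>t. indicator S t *\<^sub>R h t) \<in> borel_measurable lebesgue"
    by (rule measurable_indicator_powr[OF \<gamma>]) (use h in \<open>auto simp: set_integrable_def\<close>)
  note \<gamma>[measurable]
  have bint: "integrable lborel (?b t)" "(\<integral>u. ?b t u \<partial>lborel) = of_real v powr (?s t + \<mu> - 1) * Beta (?s t) \<mu>"
    "(\<integral>u. norm (?b t u) \<partial>lborel) = v powr (Re (?s t) + Re \<mu> - 1) * Beta (Re (?s t)) (Re \<mu>)" if "t \<in> S" for t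
  proof -
    have p: "Re (?s t) > 0" using s1[OF that] by simp
    show "integrable lborel (?b t)" "(\<integral>u. ?b t u \<partial>lborel) = of_real v powr (?s t + \<mu> - 1) * Beta (?s t) \<mu>"
      using set_integrable_Beta_scaled[OF p mu v] by (simp_all only: set_integrable_def set_lebesgue_integral_def)
    have "(\<integral>u. norm (?b t u) \<partial>lborel) = (LINT u:{0<..<v}|lborel. norm (complex_of_real u powr (?s t - 1) * of_real (v - u) powr (\<mu> - 1)))"
      unfolding set_lebesgue_integral_def by (simp add: norm_mult)
    also have "\<dots> = v powr (Re (?s t) + Re \<mu> - 1) * Beta (Re (?s t)) (Re \<mu>)"
      by (rule LINT_norm_Beta_scaled[OF p mu v])
    finally show "(\<integral>u. norm (?b t u) \<partial>lborel) = v powr (Re (?s t) + Re \<mu> - 1) * Beta (Re (?s t)) (Re \<mu>)" .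
  qed
  have Fint: "integrable (lebesgue \<Otimes>\<^sub>M lborel) (case_prod ?F)"
  proof (rule Fubini_integrable)
    show "case_prod ?F \<in> borel_measurable (lebesgue \<Otimes>\<^sub>M lborel)" by measurable
    show "AE t in lebesgue. integrable lborel (\<lambda>u. case_prod ?F (t, u))"
    proof (rule AE_I2)
      fix t show "integrable lborel (\<lambda>u. case_prod ?F (t, u))"
      proof (cases "t \<in> S")
        case True
        show ?thesis unfolding prod.case F_in[OF True] using bint(1)[OF True] by (intro integrable_mult_right) auto
      qed simp
    qed
    show "integrable lebesgue (\<lambda>t. \<integral>u. norm (case_prod ?F (t, u)) \<partial>lborel)"
    proof (rule Bochner_Integration.integrable_bound)
      let ?c = "v powr (Re \<beta> + l + Re \<mu> - 1) * Beta 1 (Re \<mu>)"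
      show "integrable lebesgue (\<lambda>t. ?c * norm (indicator S t *\<^sub>R ?h t))"
        using h unfolding set_integrable_def by (intro integrable_mult_right integrable_norm) auto
      show "(\<lambda>t. \<integral>u. norm (case_prod ?F (t, u)) \<partial>lborel) \<in> borel_measurable lebesgue"
        by measurable
      show "AE t in lebesgue. norm (\<integral>u. norm (case_prod ?F (t, u)) \<partial>lborel) \<le> norm (?c * norm (indicator S t *\<^sub>R ?h t))"
      proof (rule AE_I2)
        fix t
        show "norm (\<integral>u. norm (case_prod ?F (t, u)) \<partial>lborel) \<le> norm (?c * norm (indicator S t *\<^sub>R ?h t))"
        proof (cases "t \<in> S")
          case True
          have "(\<integral>u. norm (case_prod ?F (t, u)) \<partial>lborel) = norm (h t) * (\<integral>u. norm (?b t u) \<partial>lborel)"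
            unfolding prod.case F_in[OF True] norm_mult[of "h t"] by (rule integral_mult_right_zero)
          also have "\<dots> = norm (h t) * (v powr (Re (?s t) + Re \<mu> - 1) * Beta (Re (?s t)) (Re \<mu>))"
            unfolding bint(3)[OF True] ..
          also have "\<dots> \<le> norm (h t) * (v powr (Re (?s t) + Re \<mu> - 1) * Beta 1 (Re \<mu>))"
            using s1[OF True] mu by (intro mult_left_mono Beta_real_mono) auto
          also have "v powr (Re (?s t) + Re \<mu> - 1) = v powr (Re \<beta> + l + Re \<mu> - 1) * v powr (\<alpha> * Re (\<gamma> t))"
            by (simp add: algebra_simps flip: powr_add)
          also have "norm (h t) * (v powr (Re \<beta> + l + Re \<mu> - 1) * v powr (\<alpha> * Re (\<gamma> t)) * Beta 1 (Re \<mu>)) =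
              ?c * norm (indicator S t *\<^sub>R ?h t)"
            using True v by (simp add: norm_mult norm_of_real_powr)
          finally have "(\<integral>u. norm (case_prod ?F (t, u)) \<partial>lborel) \<le> ?c * norm (indicator S t *\<^sub>R ?h t)" .
          moreover have "0 \<le> (\<integral>u. norm (case_prod ?F (t, u)) \<partial>lborel)" by simp
          ultimately show ?thesis
            using abs_ge_self[of "?c * norm (indicator S t *\<^sub>R ?h t)"] unfolding real_norm_def by linarith
        next
          case False
          show ?thesis unfolding prod.case F_out[OF False] by simp
        qed
      qed
    qed
  qed
  have inner: "(\<integral>t. ?F t u \<partial>lebesgue) = indicator {0<..<v} u *\<^sub>R (kernel (of_real l) u *
      (LINT t:S|lebesgue. h t * of_real u powr (of_real \<alpha> * \<gamma> t)))" for u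
  proof (cases "u \<in> {0<..<v}")
    case True
    have *: "?F t u = kernel (of_real l) u * (indicator S t *\<^sub>R (h t * of_real u powr (of_real \<alpha> * \<gamma> t)))" for t
    proof (cases "t \<in> S")
      case inS: True
      have "complex_of_real u powr (?s t - 1) = of_real u powr (\<beta> + of_real l - 1) * of_real u powr (of_real \<alpha> * \<gamma> t)"
        using True by (simp add: algebra_simps flip: powr_add)
      then show ?thesis using inS True by (simp add: kernel_def)
    qed simp
    have "(\<integral>t. ?F t u \<partial>lebesgue) = kernel (of_real l) u * (LINT t:S|lebesgue. h t * of_real u powr (of_real \<alpha> * \<gamma> t))"
      unfolding * set_lebesgue_integral_def by (rule integral_mult_right_zero)
    then show ?thesis using True by simp
  qed simp
  have outer: "(\<integral>u. ?F t u \<partial>lborel) = Gamma \<mu> * of_real v powr (\<beta> + of_real l + \<mu> - 1) *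
      (indicator S t *\<^sub>R (?h t * ratio (?s t)))" for t
  proof (cases "t \<in> S")
    case True
    have "(\<integral>u. ?F t u \<partial>lborel) = h t * (\<integral>u. ?b t u \<partial>lborel)"
      unfolding F_in[OF True] by (rule integral_mult_right_zero)
    also have "\<dots> = h t * (of_real v powr (?s t + \<mu> - 1) * Beta (?s t) \<mu>)"
      unfolding bint(2)[OF True] ..
    also have "complex_of_real v powr (?s t + \<mu> - 1) = of_real v powr (\<beta> + of_real l + \<mu> - 1) * of_real v powr (of_real \<alpha> * \<gamma> t)"
      by (simp add: algebra_simps flip: powr_add)
    finally show ?thesis using True by (simp add: Beta_altdef ratio_def)
  qed (simp add: F_out)
  have "integrable lborel (\<lambda>u. \<integral>t. ?F t u \<partial>lebesgue)"
    by (rule integrable_snd[OF Fint])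
  then show "set_integrable lborel {0<..<v} (\<lambda>u. kernel (of_real l) u * (LINT t:S|lebesgue. h t * of_real u powr (of_real \<alpha> * \<gamma> t)))"
    unfolding inner set_integrable_def .
  have "(\<integral>u. (\<integral>t. ?F t u \<partial>lebesgue) \<partial>lborel) = (\<integral>t. (\<integral>u. ?F t u \<partial>lborel) \<partial>lebesgue)"
    by (rule Fubini_integral[OF Fint])
  then show "(LINT u:{0<..<v}|lborel. kernel (of_real l) u * (LINT t:S|lebesgue. h t * of_real u powr (of_real \<alpha> * \<gamma> t))) =
     Gamma \<mu> * of_real v powr (\<beta> + of_real l + \<mu> - 1) *
       (LINT t:S|lebesgue. ?h t * ratio (\<beta> + of_real l + of_real \<alpha> * \<gamma> t))"
    unfolding inner outer unfolding integral_mult_right_zero set_lebesgue_integral_def .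
qed

end

section \<open>Comparison of the tails of two contours; reflection in the real axis\<close>

text \<open>A tail integral minus the segment from its starting point to \<open>E\<close> equals the
  limit of a primitive at infinity minus its value at \<open>E\<close>. The starting point drops
  out, and the limit is the same for both curves.\<close>

lemma up_tail_difference:
  assumes U: "quadrant_domain z0 U"
    and f: "f holomorphic_on U" "order_bounded f U"
    and \<gamma>: "up_tail U \<gamma>1 T1" "up_tail U \<gamma>2 T2"
    and int1: "set_integrable lebesgue {T1..} (\<lambda>t. f (\<gamma>1 t) * vector_derivative \<gamma>1 (at t))"
    and int2: "set_integrable lebesgue {T2..} (\<lambda>t. f (\<gamma>2 t) * vector_derivative \<gamma>2 (at t))"
    and E: "Re (\<gamma>1 T1) \<le> Re E" "Im (\<gamma>1 T1) \<le> Im E" "Re (\<gamma>2 T2) \<le> Re E" "Im (\<gamma>2 T2) \<le> Im E"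
  shows "(LINT t:{T1..}|lebesgue. f (\<gamma>1 t) * vector_derivative \<gamma>1 (at t)) - contour_integral (linepath (\<gamma>1 T1) E) f =
         (LINT t:{T2..}|lebesgue. f (\<gamma>2 t) * vector_derivative \<gamma>2 (at t)) - contour_integral (linepath (\<gamma>2 T2) E) f"
proof -
  have oU: "open U" and sU: "starlike U" and uU: "\<And>p q. p \<in> U \<Longrightarrow> Re p \<le> Re q \<Longrightarrow> Im p \<le> Im q \<Longrightarrow> q \<in> U"
    using U by (auto simp: quadrant_domain_def)
  obtain F where F: "\<And>z. z \<in> U \<Longrightarrow> (F has_field_derivative f z) (at z)"
    using holomorphic_starlike_primitive[OF holomorphic_on_imp_continuous_on[OF f(1)] sU oU, of "{}"]
      holomorphic_on_imp_differentiable_at[OF f(1) oU] by auto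
  have seg: "contour_integral (linepath p E) f = F E - F p" if p: "p \<in> U" "Re p \<le> Re E" "Im p \<le> Im E" for p
  proof -
    have "closed_segment p E \<subseteq> U"
      using segment_up_right[of _ p E] p uU[OF p(1)] by blast
    then show ?thesis
      using contour_integral_primitive[of U F f "linepath p E"] F
      by (intro contour_integral_unique) (auto intro: has_field_derivative_at_within)
  qed
  have "\<gamma>1 T1 \<in> U" "\<gamma>2 T2 \<in> U" using \<gamma> by (auto simp: up_tail_def)
  then have "contour_integral (linepath (\<gamma>1 T1) E) f = F E - F (\<gamma>1 T1)"
    "contour_integral (linepath (\<gamma>2 T2) E) f = F E - F (\<gamma>2 T2)"
    using E seg by blast+
  then show ?thesis
    using Phragmen_Lindeloef_tails[OF U f F \<gamma> int1 int2] by (simp add: diff_diff_eq2 add.commute)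
qed

lemma piecewise_C1_cnj_reflect:
  assumes "\<gamma> piecewise_C1_differentiable_on {- b..- a}"
  shows "(\<lambda>t. cnj (\<gamma> (- t))) piecewise_C1_differentiable_on {a..b}"
    and "finite {t \<in> {a<..<b}. vector_derivative (\<lambda>t. cnj (\<gamma> (- t))) (at t) \<noteq> - cnj (vector_derivative \<gamma> (at (- t)))}"
proof -
  obtain S where S: "finite S" "\<gamma> C1_differentiable_on {- b..- a} - S" and cont: "continuous_on {- b..- a} \<gamma>"
    using assms by (auto simp: piecewise_C1_differentiable_on_def)
  obtain d where d: "\<And>t. t \<in> {- b..- a} - S \<Longrightarrow> (\<gamma> has_vector_derivative d t) (at t)"
    and dc: "continuous_on ({- b..- a} - S) d"
    using S(2) unfolding C1_differentiable_on_def by blast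
  have der: "((\<lambda>t. cnj (\<gamma> (- t))) has_vector_derivative - cnj (d (- t))) (at t)"
    if "- t \<in> {- b..- a} - S" for t
  proof -
    have "((\<lambda>t. - t) has_vector_derivative (-1::real)) (at t)"
      by (auto intro!: derivative_eq_intros)
    from vector_diff_chain_at[OF this d[OF that]]
    have "((\<lambda>t. \<gamma> (- t)) has_vector_derivative - d (- t)) (at t)" by (simp add: o_def)
    from has_vector_derivative_cnj[OF this] show ?thesis by simp
  qed
  have neg: "- t \<in> {- b..- a} - S" if "t \<in> {a..b} - uminus ` S" for t
    using that by (auto simp: image_iff)
  show "(\<lambda>t. cnj (\<gamma> (- t))) piecewise_C1_differentiable_on {a..b}"
    unfolding piecewise_C1_differentiable_on_def
  proof (intro conjI exI[of _ "uminus ` S"])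
    show "continuous_on {a..b} (\<lambda>t. cnj (\<gamma> (- t)))"
      by (intro continuous_on_cnj continuous_on_compose2[OF cont]) (auto intro!: continuous_intros)
    show "(\<lambda>t. cnj (\<gamma> (- t))) C1_differentiable_on {a..b} - uminus ` S"
      unfolding C1_differentiable_on_def
    proof (intro exI[of _ "\<lambda>t. - cnj (d (- t))"] conjI ballI)
      show "continuous_on ({a..b} - uminus ` S) (\<lambda>t. - cnj (d (- t)))"
        using neg by (intro continuous_on_minus continuous_on_cnj continuous_on_compose2[OF dc])
          (auto intro!: continuous_intros)
    qed (use neg der in blast)
  qed (use S in auto)
  have "{t \<in> {a<..<b}. vector_derivative (\<lambda>t. cnj (\<gamma> (- t))) (at t) \<noteq> - cnj (vector_derivative \<gamma> (at (- t)))} \<subseteq> uminus ` S"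
  proof (rule subsetI, rule ccontr)
    fix t assume t: "t \<in> {t \<in> {a<..<b}. vector_derivative (\<lambda>t. cnj (\<gamma> (- t))) (at t) \<noteq> - cnj (vector_derivative \<gamma> (at (- t)))}"
      and "t \<notin> uminus ` S"
    then have "- t \<in> {- b..- a} - S" by (intro neg) auto
    from vector_derivative_at[OF der[OF this]] vector_derivative_at[OF d[OF this]] t show False by simp
  qed
  then show "finite {t \<in> {a<..<b}. vector_derivative (\<lambda>t. cnj (\<gamma> (- t))) (at t) \<noteq> - cnj (vector_derivative \<gamma> (at (- t)))}"
    using S(1) finite_subset by blast
qed

text \<open>Reversal of the parameter produces the minus sign. The formula for the derivative of the
  reflected curve may fail at finitely many points of each bounded interval, altogether on a
  countable and hence negligible set.\<close>

lemma lower_tail_reflect: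
  assumes pw: "\<And>T. \<gamma> piecewise_C1_differentiable_on {- T..T}"
    and int: "set_integrable lebesgue {..- T} (\<lambda>t. f (\<gamma> t) * vector_derivative \<gamma> (at t))"
  defines "\<gamma>' \<equiv> \<lambda>t. cnj (\<gamma> (- t))" and "f' \<equiv> \<lambda>z. cnj (f (cnj z))"
  shows "set_integrable lebesgue {T..} (\<lambda>t. f' (\<gamma>' t) * vector_derivative \<gamma>' (at t))"
    and "(LINT t:{T..}|lebesgue. f' (\<gamma>' t) * vector_derivative \<gamma>' (at t)) =
         - cnj (LINT t:{..- T}|lebesgue. f (\<gamma> t) * vector_derivative \<gamma> (at t))"
proof -
  let ?g = "\<lambda>t. f (\<gamma> t) * vector_derivative \<gamma> (at t)"
  let ?h = "\<lambda>t. - cnj (?g (- t))"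
  define N where "N = (\<Union>n::nat. {t \<in> {- real n<..<real n}. vector_derivative \<gamma>' (at t) \<noteq> - cnj (vector_derivative \<gamma> (at (- t)))})"
  have N: "negligible N"
  proof -
    have "countable N"
      unfolding N_def \<gamma>'_def
    proof (rule countable_UN)
      fix n :: nat
      have "finite {t \<in> {- real n<..<real n}. vector_derivative (\<lambda>t. cnj (\<gamma> (- t))) (at t) \<noteq> - cnj (vector_derivative \<gamma> (at (- t)))}"
        using piecewise_C1_cnj_reflect(2)[of \<gamma> "real n" "- real n"] pw[of "real n"] by simp
      then show "countable {t \<in> {- real n<..<real n}. vector_derivative (\<lambda>t. cnj (\<gamma> (- t))) (at t) \<noteq> - cnj (vector_derivative \<gamma> (at (- t)))}"
        by (rule countable_finite)
    qed simp
    then show ?thesis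
      unfolding negligible_iff_null_sets by (intro null_sets_completionI countable_imp_null_set_lborel)
  qed
  have eq: "f' (\<gamma>' t) * vector_derivative \<gamma>' (at t) = ?h t" if "t \<in> {T..} - N" for t
  proof -
    obtain n :: nat where "\<bar>t\<bar> < real n" using reals_Archimedean2 by blast
    then have "vector_derivative \<gamma>' (at t) = - cnj (vector_derivative \<gamma> (at (- t)))"
      using that unfolding N_def by (auto simp: abs_less_iff)
    then show ?thesis by (simp add: f'_def \<gamma>'_def)
  qed
  let ?G = "\<lambda>t. indicator {..- T} t *\<^sub>R ?g t"
  have G: "integrable lebesgue ?G" using int by (simp add: set_integrable_def)
  have GG: "indicator {T..} t *\<^sub>R ?h t = - cnj (?G (0 + - 1 * t))" for t
    by (auto simp: indicator_def)
  have "integrable lebesgue (\<lambda>t. ?G (0 + - 1 * t))"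
    using G lebesgue_integrable_real_affine_iff[of "- 1" ?G 0] by simp
  then have "integrable lebesgue (\<lambda>t. - cnj (?G (0 + - 1 * t)))"
    by (intro integrable_minus integrable_cnj)
  then have hint: "set_integrable lebesgue {T..} ?h"
    unfolding set_integrable_def GG .
  show *: "set_integrable lebesgue {T..} (\<lambda>t. f' (\<gamma>' t) * vector_derivative \<gamma>' (at t))"
    by (rule absolutely_integrable_spike[OF hint N eq])
  have "(LINT t:{T..}|lebesgue. f' (\<gamma>' t) * vector_derivative \<gamma>' (at t)) = integral {T..} (\<lambda>t. f' (\<gamma>' t) * vector_derivative \<gamma>' (at t))"
    by (rule set_lebesgue_integral_eq_integral(2)[OF *])
  also have "\<dots> = integral {T..} ?h"
    by (rule integral_spike[OF N]) (rule eq[symmetric])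
  also have "\<dots> = (LINT t:{T..}|lebesgue. ?h t)"
    by (rule set_lebesgue_integral_eq_integral(2)[OF hint, symmetric])
  also have "\<dots> = (\<integral>t. - cnj (?G (0 + - 1 * t)) \<partial>lebesgue)"
    unfolding set_lebesgue_integral_def GG ..
  also have "\<dots> = - cnj (\<integral>t. ?G (0 + - 1 * t) \<partial>lebesgue)"
    by (simp only: integral_minus Bochner_Integration.integral_cnj)
  also have "(\<integral>t. ?G (0 + - 1 * t) \<partial>lebesgue) = (\<integral>t. ?G t \<partial>lebesgue)"
    using lebesgue_integral_real_affine[of "- 1" ?G 0] by simp
  finally show "(LINT t:{T..}|lebesgue. f' (\<gamma>' t) * vector_derivative \<gamma>' (at t)) =
         - cnj (LINT t:{..- T}|lebesgue. f (\<gamma> t) * vector_derivative \<gamma> (at t))"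
    by (simp only: set_lebesgue_integral_def)
qed

lemma contour_integral_linepath_cnj:
  "contour_integral (linepath (cnj a) (cnj b)) f = cnj (contour_integral (linepath a b) (\<lambda>z. cnj (f (cnj z))))"
proof -
  have "cnj (linepath a b t) = linepath (cnj a) (cnj b) t" for t
    by (simp add: linepath_def)
  then have "contour_integral (linepath (cnj a) (cnj b)) f = integral {0..1} (\<lambda>t. cnj (cnj (f (cnj (linepath a b t))) * (b - a)))"
    unfolding contour_integral_integral by simp
  also have "\<dots> = cnj (integral {0..1} (\<lambda>t. cnj (f (cnj (linepath a b t))) * (b - a)))"
    by (rule integral_cnj[symmetric])
  finally show ?thesis unfolding contour_integral_integral by simp
qed

text \<open>Schwarz reflection of the integrand together with reversal of the curve makes upper
  tails out of lower ones, so the growth argument is carried out only once.\<close>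

lemma lower_tail_difference:
  fixes f :: "complex \<Rightarrow> complex"
  assumes U: "quadrant_domain z0 U"
    and f: "(\<lambda>z. cnj (f (cnj z))) holomorphic_on U" "order_bounded (\<lambda>z. cnj (f (cnj z))) U"
    and pw: "\<And>T. \<gamma>1 piecewise_C1_differentiable_on {- T..T}" "\<And>T. \<gamma>2 piecewise_C1_differentiable_on {- T..T}"
    and \<gamma>: "up_tail U (\<lambda>t. cnj (\<gamma>1 (- t))) T1" "up_tail U (\<lambda>t. cnj (\<gamma>2 (- t))) T2"
    and int1: "set_integrable lebesgue {..- T1} (\<lambda>t. f (\<gamma>1 t) * vector_derivative \<gamma>1 (at t))"
    and int2: "set_integrable lebesgue {..- T2} (\<lambda>t. f (\<gamma>2 t) * vector_derivative \<gamma>2 (at t))"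
    and E: "Re (\<gamma>1 (- T1)) \<le> Re E" "Im E \<le> Im (\<gamma>1 (- T1))" "Re (\<gamma>2 (- T2)) \<le> Re E" "Im E \<le> Im (\<gamma>2 (- T2))"
  shows "(LINT t:{..- T1}|lebesgue. f (\<gamma>1 t) * vector_derivative \<gamma>1 (at t)) - contour_integral (linepath E (\<gamma>1 (- T1))) f =
         (LINT t:{..- T2}|lebesgue. f (\<gamma>2 t) * vector_derivative \<gamma>2 (at t)) - contour_integral (linepath E (\<gamma>2 (- T2))) f"
proof -
  note r1 = lower_tail_reflect[OF pw(1) int1] and r2 = lower_tail_reflect[OF pw(2) int2]
  have rev: "contour_integral (linepath (cnj p) (cnj E)) (\<lambda>z. cnj (f (cnj z))) = - cnj (contour_integral (linepath E p) f)" for p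
  proof -
    have "contour_integral (linepath (cnj p) (cnj E)) (\<lambda>z. cnj (f (cnj z))) = cnj (contour_integral (linepath p E) f)"
      by (subst contour_integral_linepath_cnj) simp
    also have "contour_integral (linepath p E) f = - contour_integral (linepath E p) f"
      using contour_integral_reversepath[of "linepath E p" f] by simp
    finally show ?thesis by simp
  qed
  have "- cnj (LINT t:{..- T1}|lebesgue. f (\<gamma>1 t) * vector_derivative \<gamma>1 (at t)) - - cnj (contour_integral (linepath E (\<gamma>1 (- T1))) f) =
        - cnj (LINT t:{..- T2}|lebesgue. f (\<gamma>2 t) * vector_derivative \<gamma>2 (at t)) - - cnj (contour_integral (linepath E (\<gamma>2 (- T2))) f)"
    using up_tail_difference[OF U f \<gamma> r1(1) r2(1), of "cnj E"] E unfolding r1(2) r2(2) rev by simp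
  then have "cnj ((LINT t:{..- T1}|lebesgue. f (\<gamma>1 t) * vector_derivative \<gamma>1 (at t)) - contour_integral (linepath E (\<gamma>1 (- T1))) f) =
        cnj ((LINT t:{..- T2}|lebesgue. f (\<gamma>2 t) * vector_derivative \<gamma>2 (at t)) - contour_integral (linepath E (\<gamma>2 (- T2))) f)"
    by (simp add: algebra_simps)
  then show ?thesis by (simp only: complex_cnj_cancel_iff)
qed

section \<open>Transforms of curve integrals and path integrals\<close>

context Beta_transform
begin

text \<open>A positive real factor does not change the argument, so the principal logarithm is
  additive here; for a general product a multiple of 2\<pi>i could intervene.\<close>

lemma powr_split:
  fixes w :: complex
  assumes "u > 0" "w \<noteq> 0"
  shows "(w * of_real (u powr \<alpha>)) powr \<xi> = w powr \<xi> * of_real u powr (of_real \<alpha> * \<xi>)"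
proof -
  have "Ln (of_real (u powr \<alpha>) * w) = ln (u powr \<alpha>) + Ln w"
    using assms Ln_times_of_real[of "u powr \<alpha>" w] by (simp add: Ln_of_real)
  also have "ln (u powr \<alpha>) = \<alpha> * ln u" using assms by (simp add: ln_powr)
  finally have "Ln (w * of_real (u powr \<alpha>)) = of_real (\<alpha> * ln u) + Ln w" by (simp add: mult.commute)
  then show ?thesis
    using assms by (simp add: powr_def Ln_of_real exp_add[symmetric] algebra_simps)
qed

lemma transforms_cong:
  assumes "\<And>u. 0 < u \<Longrightarrow> u < v \<Longrightarrow> P u = Q u" "\<And>l. \<Phi> l = \<Psi> l"
  shows "transforms P \<Phi> \<longleftrightarrow> transforms Q \<Psi>"
proof -
  have "set_integrable lborel {0<..<v} (\<lambda>u. kernel l u * P u) \<longleftrightarrow> set_integrable lborel {0<..<v} (\<lambda>u. kernel l u * Q u)" for l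
    using assms(1) by (intro set_integrable_cong) auto
  moreover have "(LINT u:{0<..<v}|lborel. kernel l u * P u) = (LINT u:{0<..<v}|lborel. kernel l u * Q u)" for l
    using assms(1) by (intro set_lebesgue_integral_cong) auto
  moreover have "\<Phi> = \<Psi>" using assms(2) by blast
  ultimately show ?thesis unfolding transforms_def by simp
qed

lemma transforms_cong_D:
  assumes "\<And>u. 0 < u \<Longrightarrow> u < v \<Longrightarrow> P u = Q u" "\<And>l. l \<in> D \<Longrightarrow> \<Phi> l = \<Psi> l" "transforms Q \<Psi>"
  shows "transforms P \<Phi>"
proof -
  obtain \<Lambda> where \<Lambda>: "\<Psi> holomorphic_on D" "\<And>l::real. l \<ge> \<Lambda> \<Longrightarrow> set_integrable lborel {0<..<v} (\<lambda>u. kernel (of_real l) u * Q u) \<and>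
        (LINT u:{0<..<v}|lborel. kernel (of_real l) u * Q u) = \<Psi> (of_real l)"
    using assms(3) unfolding transforms_def by blast
  have "\<Phi> holomorphic_on D" using \<Lambda>(1) assms(2) by (metis holomorphic_cong)
  moreover have "\<Phi> (of_real l) = \<Psi> (of_real l)" if "l \<ge> 0" for l
    using that delta by (intro assms(2)) (simp add: D_def)
  ultimately have "transforms Q \<Phi>"
    unfolding transforms_def using \<Lambda>(2) by (intro conjI exI[of _ "max \<Lambda> 0"]) auto
  then show ?thesis using transforms_cong[of P Q \<Phi> \<Phi>] assms(1) by blast
qed

lemma transforms_curve:
  fixes f :: "complex \<Rightarrow> complex" and \<gamma> :: "real \<Rightarrow> complex"
  assumes w: "w \<noteq> 0" and S: "S \<in> sets lebesgue"
    and int: "set_integrable lebesgue S (\<lambda>t. (f (\<gamma> t) * (w * of_real (v powr \<alpha>)) powr \<gamma> t) * vector_derivative \<gamma> (at t))"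
    and \<gamma>: "(\<lambda>t. indicator S t *\<^sub>R \<gamma> t) \<in> borel_measurable lebesgue"
    and R: "\<And>t. t \<in> S \<Longrightarrow> \<gamma> t \<in> region N"
  shows "transforms (\<lambda>u. LINT t:S|lebesgue. (f (\<gamma> t) * (w * of_real (u powr \<alpha>)) powr \<gamma> t) * vector_derivative \<gamma> (at t))
     (\<lambda>l. Gamma \<mu> * of_real v powr (\<beta> + l + \<mu> - 1) *
       (LINT t:S|lebesgue. (f (\<gamma> t) * (w * of_real (v powr \<alpha>)) powr \<gamma> t * ratio (\<beta> + l + of_real \<alpha> * \<gamma> t)) * vector_derivative \<gamma> (at t)))"
proof -
  let ?h = "\<lambda>t. f (\<gamma> t) * w powr \<gamma> t * vector_derivative \<gamma> (at t)"
  have eq: "(f (\<gamma> t) * (w * of_real (u powr \<alpha>)) powr \<gamma> t) * vector_derivative \<gamma> (at t) =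
      ?h t * of_real u powr (of_real \<alpha> * \<gamma> t)" if "u > 0" for u t
    using powr_split[OF that w] by simp
  have "set_integrable lebesgue S (\<lambda>t. ?h t * of_real v powr (of_real \<alpha> * \<gamma> t))"
    using int unfolding eq[OF v] .
  from transforms_contour_piece[OF S this \<gamma> R] show ?thesis
  proof (subst transforms_cong)
    show "(LINT t:S|lebesgue. (f (\<gamma> t) * (w * of_real (u powr \<alpha>)) powr \<gamma> t) * vector_derivative \<gamma> (at t)) =
        (LINT t:S|lebesgue. ?h t * of_real u powr (of_real \<alpha> * \<gamma> t))" if "0 < u" for u
      unfolding eq[OF that] ..
    show "Gamma \<mu> * of_real v powr (\<beta> + l + \<mu> - 1) *
       (LINT t:S|lebesgue. (f (\<gamma> t) * (w * of_real (v powr \<alpha>)) powr \<gamma> t * ratio (\<beta> + l + of_real \<alpha> * \<gamma> t)) * vector_derivative \<gamma> (at t)) =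
      Gamma \<mu> * of_real v powr (\<beta> + l + \<mu> - 1) *
       (LINT t:S|lebesgue. ?h t * of_real v powr (of_real \<alpha> * \<gamma> t) * ratio (\<beta> + l + of_real \<alpha> * \<gamma> t))" for l
    proof -
      have "(f (\<gamma> t) * (w * of_real (v powr \<alpha>)) powr \<gamma> t * ratio (\<beta> + l + of_real \<alpha> * \<gamma> t)) * vector_derivative \<gamma> (at t) =
        ?h t * of_real v powr (of_real \<alpha> * \<gamma> t) * ratio (\<beta> + l + of_real \<alpha> * \<gamma> t)" for t
        unfolding eq[OF v, symmetric] by (simp only: mult_ac)
      then show ?thesis by (simp only:)
    qed
  qed
qed

lemma LINT_contour_integral:
  assumes "set_integrable lebesgue {0..1} (\<lambda>t. F (g t) * vector_derivative g (at t))"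
  shows "contour_integral g F = (LINT t:{0..1}|lebesgue. F (g t) * vector_derivative g (at t))"
  unfolding contour_integral_integral by (rule set_lebesgue_integral_eq_integral(2)[OF assms, symmetric])

text \<open>\<open>contour_integral\<close> rests on the gauge integral, the transforms on the
  Lebesgue integral. The two are identified where absolute integrability is established, which on
  the right is for l in \<open>D\<close>; hence the use of \<open>transforms_cong_D\<close>.\<close>

lemma transforms_path:
  fixes f :: "complex \<Rightarrow> complex" and g :: "real \<Rightarrow> complex"
  assumes w: "w \<noteq> 0" and g: "continuous_on {0..1} g" "continuous_on {0..1} (\<lambda>t. vector_derivative g (at t))"
    and f: "continuous_on (path_image g) f" and R: "path_image g \<subseteq> region N"
  shows "transforms (\<lambda>u. contour_integral g (\<lambda>\<xi>. f \<xi> * (w * of_real (u powr \<alpha>)) powr \<xi>))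
     (\<lambda>l. Gamma \<mu> * of_real v powr (\<beta> + l + \<mu> - 1) *
       contour_integral g (\<lambda>\<xi>. f \<xi> * (w * of_real (v powr \<alpha>)) powr \<xi> * ratio (\<beta> + l + of_real \<alpha> * \<xi>)))"
    (is "transforms ?P (\<lambda>l. ?c l * ?Q l)")
proof -
  have int: "set_integrable lebesgue {0..1} (\<lambda>t. (f (g t) * (w * of_real (u powr \<alpha>)) powr g t) * vector_derivative g (at t))"
    if "u > 0" for u
  proof (rule absolutely_integrable_continuous_real)
    have "continuous_on {0..1} (\<lambda>t. f (g t))"
      by (rule continuous_on_compose2[OF f g(1)]) (auto simp: path_image_def)
    moreover have "w * of_real (u powr \<alpha>) \<noteq> 0" using that w by simp
    then have "(w * of_real (u powr \<alpha>)) powr g t = exp (g t * Ln (w * of_real (u powr \<alpha>)))" for t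
      by (simp only: powr_def if_False)
    moreover have "continuous_on {0..1} (\<lambda>t. exp (g t * Ln (w * of_real (u powr \<alpha>))))"
      by (intro continuous_intros g)
    ultimately show "continuous_on {0..1} (\<lambda>t. (f (g t) * (w * of_real (u powr \<alpha>)) powr g t) * vector_derivative g (at t))"
      by (auto intro!: continuous_on_mult g)
  qed
  have S: "{0..1::real} \<in> sets lebesgue" by simp
  have gm: "(\<lambda>t. indicator {0..1} t *\<^sub>R g t) \<in> borel_measurable lebesgue"
    using borel_measurable_continuous_on_indicator[OF _ g(1)] by (intro measurable_completion) simp
  have gR: "g t \<in> region N" if "t \<in> {0..1}" for t
    using R that by (auto simp: path_image_def)
  have "?P u = (LINT t:{0..1}|lebesgue. (f (g t) * (w * of_real (u powr \<alpha>)) powr g t) * vector_derivative g (at t))"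
    if "0 < u" for u
    by (rule LINT_contour_integral[OF int[OF that]])
  moreover have "?Q l = (LINT t:{0..1}|lebesgue. (f (g t) * (w * of_real (v powr \<alpha>)) powr g t * ratio (\<beta> + l + of_real \<alpha> * g t)) * vector_derivative g (at t))"
    if "l \<in> D" for l
  proof (rule LINT_contour_integral)
    show "set_integrable lebesgue {0..1} (\<lambda>t. (f (g t) * (w * of_real (v powr \<alpha>)) powr g t * ratio (\<beta> + l + of_real \<alpha> * g t)) * vector_derivative g (at t))"
      using ratio_times_integrable(1)[OF S int[OF v] gm gR that] by (simp add: mult_ac)
  qed
  ultimately show ?thesis
    by (intro transforms_cong_D[OF _ _ transforms_curve[OF w S int[OF v] gm gR]]) simp_all
qed

end

section \<open>The integrand of the Fox function\<close>

text \<open>The new upper pair stands first, so it joins the numerator and moves the others by one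
  place; the new lower pair stands last, beyond the first \<open>m\<close>, and joins the
  denominator.\<close>

lemma fox_integrand_Cons_append:
  assumes "m \<le> length bs" "n \<le> length as"
  shows "fox_integrand m (n + 1) ((1 - \<beta>, \<alpha>) # as) (bs @ [(1 - \<beta> - \<mu>, \<alpha>)]) \<xi> =
    fox_integrand m n as bs \<xi> * (Gamma (\<beta> + of_real \<alpha> * \<xi>) * rGamma (\<beta> + of_real \<alpha> * \<xi> + \<mu>))"
proof -
  let ?b = "bs @ [(1 - \<beta> - \<mu>, \<alpha>)]" and ?a = "(1 - \<beta>, \<alpha>) # as"
  have "(\<Prod>j<m. Gamma (fst (?b ! j) - of_real (snd (?b ! j)) * \<xi>)) = (\<Prod>j<m. Gamma (fst (bs ! j) - of_real (snd (bs ! j)) * \<xi>))"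
    using assms by (intro prod.cong) (auto simp: nth_append)
  moreover have "(\<Prod>j<n + 1. Gamma (1 - fst (?a ! j) + of_real (snd (?a ! j)) * \<xi>)) =
      Gamma (\<beta> + of_real \<alpha> * \<xi>) * (\<Prod>j<n. Gamma (1 - fst (as ! j) + of_real (snd (as ! j)) * \<xi>))"
    by (simp add: prod.lessThan_Suc_shift del: prod.lessThan_Suc)
  moreover have "(\<Prod>j\<in>{m..<length ?b}. rGamma (1 - fst (?b ! j) + of_real (snd (?b ! j)) * \<xi>)) =
      (\<Prod>j\<in>{m..<length bs}. rGamma (1 - fst (bs ! j) + of_real (snd (bs ! j)) * \<xi>)) * rGamma (\<beta> + of_real \<alpha> * \<xi> + \<mu>)"
    using assms by (auto simp: nth_append algebra_simps intro!: prod.cong)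
  moreover have "(\<Prod>j\<in>{n + 1..<length ?a}. rGamma (fst (?a ! j) - of_real (snd (?a ! j)) * \<xi>)) =
      (\<Prod>j\<in>{n..<length as}. rGamma (fst (as ! j) - of_real (snd (as ! j)) * \<xi>))"
    by (simp add: prod.shift_bounds_Suc_ivl del: prod.op_ivl_Suc)
  ultimately show ?thesis by (simp add: fox_integrand_def mult_ac)
qed

lemma right_poles_append: "m \<le> length bs \<Longrightarrow> right_poles m (bs @ cs) = right_poles m bs"
  unfolding right_poles_def by (intro Collect_cong ex_cong) (auto simp: nth_append)

lemma holomorphic_fox_integrand:
  "fox_integrand m n as bs holomorphic_on - (right_poles m bs \<union> left_poles n as)"
  unfolding fox_integrand_def
  by (intro holomorphic_intros holomorphic_on_prod) (auto simp: right_poles_def left_poles_def)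

section \<open>Location of the poles\<close>

lemma finite_affine_nonpos_Ints:
  fixes c :: complex and s y :: real
  assumes "s \<noteq> 0"
  shows "finite {\<xi>. c + of_real s * \<xi> \<in> \<int>\<^sub>\<le>\<^sub>0 \<and> y \<le> Re (c + of_real s * \<xi>)}"
proof (rule finite_subset)
  show "{\<xi>. c + of_real s * \<xi> \<in> \<int>\<^sub>\<le>\<^sub>0 \<and> y \<le> Re (c + of_real s * \<xi>)} \<subseteq>
      (\<lambda>k. (- of_nat k - c) / of_real s) ` {..nat \<lceil>- y\<rceil>}"
  proof clarify
    fix \<xi> assume \<xi>: "c + of_real s * \<xi> \<in> \<int>\<^sub>\<le>\<^sub>0" "y \<le> Re (c + of_real s * \<xi>)"
    then obtain k where k: "c + of_real s * \<xi> = - of_nat k" by (elim nonpos_Ints_cases')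
    then have "y \<le> - real k" using \<xi>(2) by simp
    then have "k \<in> {..nat \<lceil>- y\<rceil>}" by (auto simp: le_nat_iff) linarith
    moreover have "\<xi> = (- of_nat k - c) / of_real s"
      using assms k by (simp add: field_simps)
    ultimately show "\<xi> \<in> (\<lambda>k. (- of_nat k - c) / of_real s) ` {..nat \<lceil>- y\<rceil>}" by blast
  qed
qed simp

lemma finite_right_poles:
  assumes "\<And>j. j < m \<Longrightarrow> snd (bs ! j) > 0"
  shows "finite {p \<in> right_poles m bs. Re p \<le> x}"
proof (rule finite_subset)
  let ?A = "\<lambda>j. {\<xi>. fst (bs ! j) + of_real (- snd (bs ! j)) * \<xi> \<in> \<int>\<^sub>\<le>\<^sub>0 \<and>
      Re (fst (bs ! j)) - snd (bs ! j) * x \<le> Re (fst (bs ! j) + of_real (- snd (bs ! j)) * \<xi>)}"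
  show "{p \<in> right_poles m bs. Re p \<le> x} \<subseteq> (\<Union>j<m. ?A j)"
  proof
    fix p assume p: "p \<in> {p \<in> right_poles m bs. Re p \<le> x}"
    then obtain j where j: "j < m" "fst (bs ! j) - of_real (snd (bs ! j)) * p \<in> \<int>\<^sub>\<le>\<^sub>0"
      by (auto simp: right_poles_def)
    have "snd (bs ! j) * Re p \<le> snd (bs ! j) * x"
      using p assms[OF j(1)] by (intro mult_left_mono) auto
    then show "p \<in> (\<Union>j<m. ?A j)" using j by (intro UN_I[of j]) simp_all
  qed
  show "finite (\<Union>j<m. ?A j)"
  proof (intro finite_UN_I finite_affine_nonpos_Ints)
    show "- snd (bs ! j) \<noteq> 0" if "j \<in> {..<m}" for j using assms[of j] that by simp
  qed simp
qed

lemma finite_left_poles: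
  assumes "\<And>j. j < n \<Longrightarrow> snd (as ! j) > 0"
  shows "finite {p \<in> left_poles n as. x \<le> Re p}"
proof (rule finite_subset)
  let ?A = "\<lambda>j. {\<xi>. (1 - fst (as ! j)) + of_real (snd (as ! j)) * \<xi> \<in> \<int>\<^sub>\<le>\<^sub>0 \<and>
      Re (1 - fst (as ! j)) + snd (as ! j) * x \<le> Re ((1 - fst (as ! j)) + of_real (snd (as ! j)) * \<xi>)}"
  show "{p \<in> left_poles n as. x \<le> Re p} \<subseteq> (\<Union>j<n. ?A j)"
  proof
    fix p assume p: "p \<in> {p \<in> left_poles n as. x \<le> Re p}"
    then obtain j where j: "j < n" "1 - fst (as ! j) + of_real (snd (as ! j)) * p \<in> \<int>\<^sub>\<le>\<^sub>0"
      by (auto simp: left_poles_def)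
    have "snd (as ! j) * x \<le> snd (as ! j) * Re p"
      using p assms[OF j(1)] by (intro mult_left_mono) auto
    then show "p \<in> (\<Union>j<n. ?A j)" using j by (intro UN_I[of j]) simp_all
  qed
  show "finite (\<Union>j<n. ?A j)"
  proof (intro finite_UN_I finite_affine_nonpos_Ints)
    show "snd (as ! j) \<noteq> 0" if "j \<in> {..<n}" for j using assms[of j] that by simp
  qed simp
qed

lemma right_pole_cases:
  assumes "p \<in> right_poles m bs" "\<And>j. j < m \<Longrightarrow> snd (bs ! j) > 0"
  obtains j k where "j < m" "p = (fst (bs ! j) + of_nat k) / of_real (snd (bs ! j))"
proof -
  obtain j where j: "j < m" "fst (bs ! j) - of_real (snd (bs ! j)) * p \<in> \<int>\<^sub>\<le>\<^sub>0"
    using assms(1) by (auto simp: right_poles_def)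
  then obtain k where "fst (bs ! j) - of_real (snd (bs ! j)) * p = - of_nat k" by (elim nonpos_Ints_cases')
  then have "p = (fst (bs ! j) + of_nat k) / of_real (snd (bs ! j))"
    using assms(2)[OF j(1)] by (simp add: field_simps)
  with j(1) show ?thesis by (rule that)
qed

lemma right_poleI:
  assumes "j < m" "snd (bs ! j) > 0"
  shows "(fst (bs ! j) + of_nat k) / of_real (snd (bs ! j)) \<in> right_poles m bs"
  using assms by (auto simp: right_poles_def intro!: exI[of _ j])

text \<open>Each Gamma factor contributes an arithmetic progression of poles that runs horizontally
  to the right without end.\<close>

lemma right_poles_repeat:
  assumes "p \<in> right_poles m bs" "\<And>j. j < m \<Longrightarrow> snd (bs ! j) > 0"
  shows "\<exists>p'\<in>right_poles m bs. Im p' = Im p \<and> x \<le> Re p'"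
proof -
  obtain j k where j: "j < m" "p = (fst (bs ! j) + of_nat k) / of_real (snd (bs ! j))"
    using right_pole_cases assms by blast
  obtain k' :: nat where k': "x * snd (bs ! j) - Re (fst (bs ! j)) \<le> real k'" using real_arch_simple by blast
  let ?p = "(fst (bs ! j) + of_nat k') / of_real (snd (bs ! j))"
  have "?p \<in> right_poles m bs" using j assms(2) by (intro right_poleI) auto
  moreover have "Im ?p = Im p" using j by (simp add: Im_divide_of_real)
  moreover have "x \<le> Re ?p" using k' assms(2)[OF j(1)] by (simp add: Re_divide_of_real pos_le_divide_eq)
  ultimately show ?thesis by blast
qed

lemma right_poles_heights:
  assumes "\<And>j. j < m \<Longrightarrow> snd (bs ! j) > 0"
  shows "\<exists>Y. \<forall>p\<in>right_poles m bs. \<bar>Im p\<bar> \<le> Y"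
proof (intro exI ballI)
  fix p assume "p \<in> right_poles m bs"
  then obtain j k where j: "j < m" "p = (fst (bs ! j) + of_nat k) / of_real (snd (bs ! j))"
    using right_pole_cases assms by blast
  then have "\<bar>Im p\<bar> = \<bar>Im (fst (bs ! j)) / snd (bs ! j)\<bar>" by (simp add: Im_divide_of_real)
  also have "\<dots> \<le> (\<Sum>j<m. \<bar>Im (fst (bs ! j)) / snd (bs ! j)\<bar>)"
    using j(1) by (intro member_le_sum) auto
  finally show "\<bar>Im p\<bar> \<le> (\<Sum>j<m. \<bar>Im (fst (bs ! j)) / snd (bs ! j)\<bar>)" .
qed

section \<open>Growth of the integrand in regions that contain the tails\<close>

text \<open>Far to the right the arguments of the first group of Gamma functions have large negative
  real parts, so only a distance from the rows of poles controls them. For the second group a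
  positive real part serves as well. The factors of the denominator are entire and of order below
  3/2.\<close>

lemma order_bounded_fox_integrand:
  assumes "\<And>j. j < m \<Longrightarrow> \<exists>d>0. \<forall>\<xi>\<in>W. d \<le> \<bar>Im (fst (bs ! j) - of_real (snd (bs ! j)) * \<xi>)\<bar>"
    and "\<And>j. j < n \<Longrightarrow> \<exists>d>0. \<exists>e>0. \<forall>\<xi>\<in>W. e \<le> Re (1 - fst (as ! j) + of_real (snd (as ! j)) * \<xi>) \<or>
           d \<le> \<bar>Im (1 - fst (as ! j) + of_real (snd (as ! j)) * \<xi>)\<bar>"
  shows "order_bounded (fox_integrand m n as bs) W"
    and "W \<inter> (right_poles m bs \<union> left_poles n as) = {}"
proof -
  have r: "order_bounded (\<lambda>\<xi>. Gamma (fst (bs ! j) - of_real (snd (bs ! j)) * \<xi>)) W" if j: "j < m" for j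
  proof -
    obtain d where d: "d > 0" "\<forall>\<xi>\<in>W. d \<le> \<bar>Im (fst (bs ! j) - of_real (snd (bs ! j)) * \<xi>)\<bar>"
      using assms(1)[OF j] by blast
    have "order_bounded (\<lambda>\<xi>. Gamma (fst (bs ! j) + (- of_real (snd (bs ! j))) * \<xi>)) W"
      by (rule order_bounded_affine[OF order_bounded_Gamma_off_axis[OF d(1)]]) (use d(2) in auto)
    then show ?thesis by simp
  qed
  have l: "order_bounded (\<lambda>\<xi>. Gamma (1 - fst (as ! j) + of_real (snd (as ! j)) * \<xi>)) W" if j: "j < n" for j
  proof -
    obtain d e where de: "d > 0" "e > 0" "\<forall>\<xi>\<in>W. e \<le> Re (1 - fst (as ! j) + of_real (snd (as ! j)) * \<xi>) \<or>
           d \<le> \<bar>Im (1 - fst (as ! j) + of_real (snd (as ! j)) * \<xi>)\<bar>"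
      using assms(2)[OF j] by blast
    show ?thesis
      by (rule order_bounded_affine[OF order_bounded_Gamma[OF de(1,2)]]) (use de(3) in auto)
  qed
  have rG: "order_bounded (\<lambda>\<xi>. rGamma (a + b * \<xi>)) W" for a b
    by (rule order_bounded_affine[OF order_bounded_rGamma[of UNIV]]) auto
  have rG': "order_bounded (\<lambda>\<xi>. rGamma (a - b * \<xi>)) W" for a b
    using rG[of a "- b"] by simp
  show "order_bounded (fox_integrand m n as bs) W"
    unfolding fox_integrand_def[abs_def]
    by (intro order_bounded_mult order_bounded_prod finite_lessThan finite_atLeastLessThan r l rG rG') auto
  have "\<xi> \<notin> right_poles m bs" if "\<xi> \<in> W" for \<xi>
  proof
    assume "\<xi> \<in> right_poles m bs"
    then obtain j where j: "j < m" "fst (bs ! j) - of_real (snd (bs ! j)) * \<xi> \<in> \<int>\<^sub>\<le>\<^sub>0" by (auto simp: right_poles_def)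
    obtain z :: int where z: "fst (bs ! j) - of_real (snd (bs ! j)) * \<xi> = of_int z"
      using j(2) by (elim nonpos_Ints_cases)
    have "Im (fst (bs ! j) - of_real (snd (bs ! j)) * \<xi>) = 0" unfolding z by simp
    then show False using assms(1)[OF j(1)] that by fastforce
  qed
  moreover have "\<xi> \<notin> left_poles n as" if "\<xi> \<in> W" for \<xi>
  proof
    assume "\<xi> \<in> left_poles n as"
    then obtain j where j: "j < n" "1 - fst (as ! j) + of_real (snd (as ! j)) * \<xi> \<in> \<int>\<^sub>\<le>\<^sub>0" by (auto simp: left_poles_def)
    obtain z :: int where z: "1 - fst (as ! j) + of_real (snd (as ! j)) * \<xi> = of_int z" "z \<le> 0"
      using j(2) by (elim nonpos_Ints_cases)
    have "Im (1 - fst (as ! j) + of_real (snd (as ! j)) * \<xi>) = 0" "Re (1 - fst (as ! j) + of_real (snd (as ! j)) * \<xi>) \<le> 0"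
      unfolding z(1) using z(2) by simp_all
    then show False using assms(2)[OF j(1)] that by fastforce
  qed
  ultimately show "W \<inter> (right_poles m bs \<union> left_poles n as) = {}" by blast
qed

text \<open>An L-shaped region: the part above \<open>h\<close> receives the tails of vertical
  contours, the part beyond \<open>c\<close> and above \<open>d\<close> those of loops. Left-hand
  poles may remain in the corner cut out to the left of \<open>c\<close> and below
  \<open>h\<close>.\<close>

definition upper_region :: "real \<Rightarrow> real \<Rightarrow> real \<Rightarrow> real \<Rightarrow> complex set" where
  "upper_region C c h d = {z. - C < Re z \<and> h < Im z} \<union> {z. c < Re z \<and> d < Im z}"

lemma quadrant_domain_upper_region:
  assumes "- C \<le> c" "d \<le> h"
  shows "quadrant_domain (Complex (- C) d) (upper_region C c h d)"
proof -
  have conv: "convex {z. a < Re z \<and> b < Im z}" and op: "open {z. a < Re z \<and> b < Im z}" for a b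
  proof -
    have "{z. a < Re z \<and> b < Im z} = {z. a < Re z} \<inter> {z. b < Im z}" by auto
    then show "convex {z. a < Re z \<and> b < Im z}" "open {z. a < Re z \<and> b < Im z}"
      by (simp_all add: convex_Int convex_halfspace_Re_gt convex_halfspace_Im_gt
          open_Int open_halfspace_Re_gt open_halfspace_Im_gt)
  qed
  \<comment> \<open>This point lies in both convex pieces and is therefore a star centre of their
    union.\<close>
  let ?E = "Complex (c + 1) (h + 1)"
  have E1: "?E \<in> {z. - C < Re z \<and> h < Im z}" and E2: "?E \<in> {z. c < Re z \<and> d < Im z}" using assms by auto
  have "starlike (upper_region C c h d)"
    unfolding starlike_def
  proof (intro bexI[of _ ?E] ballI)
    fix y assume "y \<in> upper_region C c h d"
    then show "closed_segment ?E y \<subseteq> upper_region C c h d"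
      unfolding upper_region_def using closed_segment_subset[OF E1 _ conv] closed_segment_subset[OF E2 _ conv] by blast
  qed (use E1 in \<open>auto simp: upper_region_def\<close>)
  moreover have "open (upper_region C c h d)" unfolding upper_region_def by (intro open_Un op)
  ultimately show ?thesis using assms unfolding quadrant_domain_def upper_region_def by auto
qed

lemma rises_up_tail:
  assumes L: "rises L d'" "d < d'" and C: "\<And>t. - C' \<le> Re (L t)" "C' < C"
    and pw: "\<And>a b. L piecewise_C1_differentiable_on {a..b}"
  shows "\<exists>T0. \<forall>T\<ge>T0. up_tail (upper_region C c h d) L T"
proof -
  have "eventually (\<lambda>t. h < Im (L t) \<or> c < Re (L t) \<and> d' \<le> Im (L t)) at_top"
    using L(1) unfolding rises_def by blast
  then obtain T0 where T0: "\<And>t. t \<ge> T0 \<Longrightarrow> h < Im (L t) \<or> c < Re (L t) \<and> d' \<le> Im (L t)"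
    by (auto simp: eventually_at_top_linorder)
  have mem: "L t \<in> upper_region C c h d" if "t \<ge> T0" for t
    using T0[OF that] C(1)[of t] C(2) L(2) unfolding upper_region_def by auto
  have lim: "filterlim (\<lambda>t. Re (L t) + Im (L t)) at_top at_top"
    unfolding filterlim_at_top_dense
  proof
    fix Z
    have "eventually (\<lambda>t. Z + C' < Im (L t) \<or> Z - d' < Re (L t) \<and> d' \<le> Im (L t)) at_top"
      using L(1) unfolding rises_def by blast
    then show "eventually (\<lambda>t. Z < Re (L t) + Im (L t)) at_top"
    proof eventually_elim
      case (elim t)
      then show ?case using C(1)[of t] by linarith
    qed
  qed
  show ?thesis unfolding up_tail_def using mem lim pw by (intro exI[of _ T0]) auto
qed

text \<open>The sign \<open>\<sigma>\<close> lets one proof serve the upper region and the reflected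
  lower one. The right-hand poles lie in finitely many rows below \<open>d\<close>, so a smaller
  level \<open>d0\<close> still clears them by a positive gap; \<open>c1\<close> and
  \<open>h1\<close> clear the left-hand poles.\<close>

lemma fox_integrand_upper_region:
  assumes posB: "\<And>j. j < m \<Longrightarrow> snd (bs ! j) > 0" and posA: "\<And>j. j < n \<Longrightarrow> snd (as ! j) > 0"
    and \<sigma>: "\<sigma> = 1 \<or> \<sigma> = (- 1 :: real)" and d: "\<And>p. p \<in> right_poles m bs \<Longrightarrow> \<sigma> * Im p < d"
  shows "\<exists>d0<d. \<exists>c1 h1. \<forall>C c h. c1 \<le> c \<longrightarrow> h1 \<le> h \<longrightarrow>
    order_bounded (fox_integrand m n as bs) {z. Complex (Re z) (\<sigma> * Im z) \<in> upper_region C c h d0} \<and>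
    {z. Complex (Re z) (\<sigma> * Im z) \<in> upper_region C c h d0} \<inter> (right_poles m bs \<union> left_poles n as) = {}"
proof -
  let ?y = "\<lambda>j. \<sigma> * (Im (fst (bs ! j)) / snd (bs ! j))"
  have yd: "?y j < d" if "j < m" for j
    using d[OF right_poleI[OF that posB[OF that], of 0]] by (simp add: Im_divide_of_real)
  \<comment> \<open>The inserted value d - 1 keeps the maximum defined when there are no rows, and
    it is below \<open>d\<close>.\<close>
  define d1 where "d1 = Max (insert (d - 1) (?y ` {..<m}))"
  have d1: "d1 < d" "\<And>j. j < m \<Longrightarrow> ?y j \<le> d1"
    unfolding d1_def using yd by auto
  define d0 where "d0 = (d1 + d) / 2"
  have d0: "d0 < d" "d1 < d0" using d1(1) by (simp_all add: d0_def)
  have yd0: "?y j < d0" if "j < m" for j using d1(2)[OF that] d0(2) by linarith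
  \<comment> \<open>Beyond this abscissa the arguments of the second group of Gamma functions have
    real part at least 1; the sum serves as an upper bound of all its terms.\<close>
  define c1 where "c1 = (\<Sum>j<n. \<bar>Re (fst (as ! j)) / snd (as ! j)\<bar>)"
  have c1: "Re (fst (as ! j)) / snd (as ! j) \<le> c1" if "j < n" for j
  proof -
    have "\<bar>Re (fst (as ! j)) / snd (as ! j)\<bar> \<le> c1"
      unfolding c1_def using that by (intro member_le_sum) auto
    then show ?thesis by linarith
  qed
  \<comment> \<open>Above this height the arguments of the second group have imaginary part at least
    1 in modulus; the summand |d0| ensures \<open>d0 \<le> h1\<close>.\<close>
  define h1 where "h1 = (\<Sum>j<n. (\<bar>Im (fst (as ! j))\<bar> + 1) / snd (as ! j)) + \<bar>d0\<bar>"
  have h1: "(\<bar>Im (fst (as ! j))\<bar> + 1) / snd (as ! j) \<le> h1" if "j < n" for j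
  proof -
    have "(\<bar>Im (fst (as ! j))\<bar> + 1) / snd (as ! j) \<le> (\<Sum>j<n. (\<bar>Im (fst (as ! j))\<bar> + 1) / snd (as ! j))"
      using that posA by (intro member_le_sum) (auto intro!: divide_nonneg_pos)
    then show ?thesis by (simp add: h1_def)
  qed
  have h1d: "d0 \<le> h1"
  proof -
    have "0 \<le> (\<Sum>j<n. (\<bar>Im (fst (as ! j))\<bar> + 1) / snd (as ! j))"
      using posA by (intro sum_nonneg divide_nonneg_pos) auto
    then show ?thesis by (simp add: h1_def)
  qed
  have \<sigma>abs: "\<bar>\<sigma>\<bar> = 1" using \<sigma> by auto
  have main: "order_bounded (fox_integrand m n as bs) {z. Complex (Re z) (\<sigma> * Im z) \<in> upper_region C c h d0} \<and>
    {z. Complex (Re z) (\<sigma> * Im z) \<in> upper_region C c h d0} \<inter> (right_poles m bs \<union> left_poles n as) = {}"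
    if ch: "c1 \<le> c" "h1 \<le> h" for C c h
  proof -
    let ?W = "{z. Complex (Re z) (\<sigma> * Im z) \<in> upper_region C c h d0}"
    have W: "d0 < \<sigma> * Im z" "c < Re z \<or> h < \<sigma> * Im z" if "z \<in> ?W" for z
      using that ch h1d by (auto simp: upper_region_def)
    have 1: "\<exists>d>0. \<forall>\<xi>\<in>?W. d \<le> \<bar>Im (fst (bs ! j) - of_real (snd (bs ! j)) * \<xi>)\<bar>" if j: "j < m" for j
    proof (intro exI[of _ "snd (bs ! j) * (d0 - ?y j)"] conjI ballI)
      show "0 < snd (bs ! j) * (d0 - ?y j)" using posB[OF j] yd0[OF j] by simp
      fix \<xi> assume "\<xi> \<in> ?W"
      have "snd (bs ! j) * (d0 - ?y j) \<le> snd (bs ! j) * (\<sigma> * Im \<xi> - ?y j)"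
        using W(1)[OF \<open>\<xi> \<in> ?W\<close>] posB[OF j] by (intro mult_left_mono) auto
      also have "\<dots> = \<sigma> * (snd (bs ! j) * Im \<xi> - Im (fst (bs ! j)))"
        using posB[OF j] by (simp add: field_simps)
      also have "\<dots> \<le> \<bar>\<sigma> * (snd (bs ! j) * Im \<xi> - Im (fst (bs ! j)))\<bar>" by (rule abs_ge_self)
      also have "\<dots> = \<bar>Im (fst (bs ! j) - of_real (snd (bs ! j)) * \<xi>)\<bar>"
        by (simp add: abs_mult \<sigma>abs abs_minus_commute)
      finally show "snd (bs ! j) * (d0 - ?y j) \<le> \<bar>Im (fst (bs ! j) - of_real (snd (bs ! j)) * \<xi>)\<bar>" .
    qed
    have 2: "\<exists>d>0. \<exists>e>0. \<forall>\<xi>\<in>?W. e \<le> Re (1 - fst (as ! j) + of_real (snd (as ! j)) * \<xi>) \<or>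
           d \<le> \<bar>Im (1 - fst (as ! j) + of_real (snd (as ! j)) * \<xi>)\<bar>" if j: "j < n" for j
    proof (intro exI[of _ 1] conjI ballI)
      fix \<xi> assume "\<xi> \<in> ?W"
      from W(2)[OF this] show "1 \<le> Re (1 - fst (as ! j) + of_real (snd (as ! j)) * \<xi>) \<or>
           1 \<le> \<bar>Im (1 - fst (as ! j) + of_real (snd (as ! j)) * \<xi>)\<bar>"
      proof
        assume "c < Re \<xi>"
        then have "Re (fst (as ! j)) / snd (as ! j) \<le> Re \<xi>" using c1[OF j] ch by linarith
        then have "Re (fst (as ! j)) \<le> snd (as ! j) * Re \<xi>"
          using posA[OF j] by (simp add: pos_divide_le_eq mult.commute)
        then show ?thesis by simp
      next
        assume "h < \<sigma> * Im \<xi>"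
        then have "(\<bar>Im (fst (as ! j))\<bar> + 1) / snd (as ! j) \<le> \<sigma> * Im \<xi>" using h1[OF j] ch by linarith
        also have "\<dots> \<le> \<bar>Im \<xi>\<bar>" using \<sigma> by auto
        finally have "\<bar>Im (fst (as ! j))\<bar> + 1 \<le> snd (as ! j) * \<bar>Im \<xi>\<bar>"
          using posA[OF j] by (simp add: pos_divide_le_eq mult.commute)
        also have "\<dots> = \<bar>snd (as ! j) * Im \<xi>\<bar>" using posA[OF j] by (simp add: abs_mult)
        finally have "1 \<le> \<bar>snd (as ! j) * Im \<xi> - Im (fst (as ! j))\<bar>" by linarith
        then show ?thesis by simp
      qed
    qed simp_all
    show ?thesis using order_bounded_fox_integrand[OF 1 2] by blast
  qed
  show ?thesis using main d0(1) by blast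
qed

section \<open>The Beta integral of a contour integral\<close>

lemma LINT_UNIV_split:
  fixes F :: "real \<Rightarrow> complex"
  assumes F: "set_integrable lebesgue UNIV F" and T: "T > 0"
  shows "(LINT t|lebesgue. F t) = (LINT t:{T..}|lebesgue. F t) + (LINT t:{..- T}|lebesgue. F t) + integral {- T..T} F"
    and "F integrable_on {- T..T}"
proof -
  have sub: "set_integrable lebesgue S F" if "S \<in> sets lebesgue" for S
    using that by (intro set_integrable_subset[OF F]) auto
  have "(LINT t|lebesgue. F t) = (LINT t:{..- T} \<union> ({- T<..<T} \<union> {T..})|lebesgue. F t)"
  proof -
    have "{..- T} \<union> ({- T<..<T} \<union> {T..}) = UNIV" by auto
    then show ?thesis by (simp add: set_lebesgue_integral_def)
  qed
  also have "\<dots> = (LINT t:{..- T}|lebesgue. F t) + (LINT t:{- T<..<T} \<union> {T..}|lebesgue. F t)"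
    by (rule set_integral_Un[OF _ sub sub]) (use T in auto)
  also have "(LINT t:{- T<..<T} \<union> {T..}|lebesgue. F t) = (LINT t:{- T<..<T}|lebesgue. F t) + (LINT t:{T..}|lebesgue. F t)"
    by (rule set_integral_Un[OF _ sub sub]) auto
  also have "(LINT t:{- T<..<T}|lebesgue. F t) = integral {- T<..<T} F"
    by (rule set_lebesgue_integral_eq_integral(2)[OF sub]) simp
  also have "\<dots> = integral {- T..T} F" by (rule integral_open_interval_real[symmetric])
  finally show "(LINT t|lebesgue. F t) = (LINT t:{T..}|lebesgue. F t) + (LINT t:{..- T}|lebesgue. F t) + integral {- T..T} F"
    by simp
  show "F integrable_on {- T..T}"
    by (rule set_lebesgue_integral_eq_integral(1)[OF sub]) simp
qed

text \<open>Each tail is grouped with the segment that joins it to a corner, because by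
  \<open>up_tail_difference\<close> and \<open>lower_tail_difference\<close> these differences are
  what two contours have in common.\<close>

lemma (in separating_contour) evaluates_LINT:
  assumes ev: "evaluates T K H" and T: "T > 0" and f: "f holomorphic_on - (PR \<union> PL)"
    and int: "set_integrable lebesgue UNIV (\<lambda>t. f (L t) * vector_derivative L (at t))"
  shows "(LINT t|lebesgue. f (L t) * vector_derivative L (at t)) =
    (LINT t:{T..}|lebesgue. f (L t) * vector_derivative L (at t)) - contour_integral (linepath (L T) (Complex K H)) f +
    ((LINT t:{..- T}|lebesgue. f (L t) * vector_derivative L (at t)) - contour_integral (linepath (Complex K (- H)) (L (- T))) f) -
    contour_integral (linepath (Complex K H) (Complex K (- H))) f -
    (\<Sum>p | p \<in> PR \<and> Re p < K. 2 * pi * \<i> * residue f p)"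
proof -
  note sp = LINT_UNIV_split[OF int T]
  have "integral {- T..T} (\<lambda>t. f (L t) * vector_derivative L (at t)) +
        (contour_integral (linepath (L T) (Complex K H)) f +
         contour_integral (linepath (Complex K H) (Complex K (- H))) f +
         contour_integral (linepath (Complex K (- H)) (L (- T))) f) =
        - (2 * pi * \<i> * (\<Sum>p | p \<in> PR \<and> Re p < K. residue f p))"
    using ev f sp(2) unfolding evaluates_def by blast
  then have I: "integral {- T..T} (\<lambda>t. f (L t) * vector_derivative L (at t)) +
        (contour_integral (linepath (L T) (Complex K H)) f +
         contour_integral (linepath (Complex K H) (Complex K (- H))) f +
         contour_integral (linepath (Complex K (- H)) (L (- T))) f) =
        - (\<Sum>p | p \<in> PR \<and> Re p < K. 2 * pi * \<i> * residue f p)"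
    by (simp only: sum_distrib_left)
  have arith: "t1 + t2 + i = t1 - c1 + (t2 - c3) - c2 - r" if "i + (c1 + c2 + c3) = - r"
    for t1 t2 i c1 c2 c3 r :: complex
  proof -
    have "i = - r - (c1 + c2 + c3)" using that by (metis add_diff_cancel_right')
    then show ?thesis by simp
  qed
  show ?thesis unfolding sp(1) by (rule arith[OF I])
qed

section \<open>Isolation of the poles, choice of the abscissa, and comparison of the two
  contours\<close>

lemma common_isolation_radius:
  fixes S F :: "complex set"
  assumes "finite F" and fin: "\<And>p. p \<in> F \<Longrightarrow> finite (S \<inter> cball p 1)"
  shows "\<exists>e>0. \<forall>p\<in>F. ball p e \<inter> S \<subseteq> {p}"
  using assms
proof (induction F rule: finite_induct)
  case empty
  show ?case by (rule exI[of _ 1]) auto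
next
  case (insert p F)
  then obtain e where e: "e > 0" "\<forall>p\<in>F. ball p e \<inter> S \<subseteq> {p}" by auto
  obtain d where d: "d > 0" "\<forall>x\<in>S \<inter> cball p 1. x \<noteq> p \<longrightarrow> d \<le> dist p x"
    using finite_set_avoid[of "S \<inter> cball p 1" p] insert.prems by blast
  have "ball p (min d 1) \<inter> S \<subseteq> {p}"
  proof
    fix x assume "x \<in> ball p (min d 1) \<inter> S"
    then show "x \<in> {p}" using d(2) by fastforce
  qed
  then have "\<forall>q\<in>insert p F. ball q (min e (min d 1)) \<inter> S \<subseteq> {q}"
    using e(2) by fastforce
  then show ?case using e(1) d(1) by (intro exI[of _ "min e (min d 1)"]) auto
qed

lemma countable_Re_image:
  assumes "\<And>x. finite {p \<in> S. Re p \<le> x}"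
  shows "countable (Re ` S)"
proof -
  have "S = (\<Union>n::nat. {p \<in> S. Re p \<le> real n})"
    using real_arch_simple by auto
  moreover have "countable (\<Union>n::nat. {p \<in> S. Re p \<le> real n})"
    by (rule countable_UN) (use assms countable_finite in blast)+
  ultimately show ?thesis by simp
qed

text \<open>Only countably many abscissae are forbidden, so an interval of length one contains a
  permitted one.\<close>

lemma generic_abscissa:
  assumes "\<And>x. finite {p \<in> S. Re p \<le> x}"
  shows "\<exists>K\<ge>K0. \<forall>p\<in>S. Re p \<noteq> K"
proof -
  have "uncountable ({K0..K0 + 1} - Re ` S)"
    by (intro uncountable_minus_countable countable_Re_image assms) (simp add: uncountable_closed_interval)
  then have "{K0..K0 + 1} - Re ` S \<noteq> {}" by (metis countable_empty)
  then obtain K where "K \<in> {K0..K0 + 1} - Re ` S" by blast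
  then show ?thesis by (intro exI[of _ K]) auto
qed

lemma cnj_reflected_bounds:
  assumes f: "f holomorphic_on {z. cnj z \<in> U}" "order_bounded f {z. cnj z \<in> U}" and U: "open U"
  shows "(\<lambda>z. cnj (f (cnj z))) holomorphic_on U" "order_bounded (\<lambda>z. cnj (f (cnj z))) U"
proof -
  have img: "cnj ` U = {z. cnj z \<in> U}" by (force simp: image_iff)
  show "(\<lambda>z. cnj (f (cnj z))) holomorphic_on U"
    using holomorphic_on_compose_cnj_cnj[of f U] f(1) U unfolding img by (simp add: o_def)
  obtain M where "M \<ge> 0" "\<forall>z\<in>{z. cnj z \<in> U}. norm (f z) \<le> exp (M * (1 + norm z) powr (3/2))"
    using f(2) unfolding order_bounded_def by blast
  then have "norm (cnj (f (cnj z))) \<le> exp (M * (1 + norm z) powr (3/2))" if "z \<in> U" for z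
    using that by (metis complex_cnj_cnj complex_mod_cnj mem_Collect_eq)
  then show "order_bounded (\<lambda>z. cnj (f (cnj z))) U" by (rule order_boundedI)
qed

context Beta_transform
begin

text \<open>Both contour integrals are split into the two tails, segments to the right of all relevant left
  poles, and circles around finitely many right poles, and are compared termwise.\<close>

theorem Beta_integral_of_contour_integral:
  fixes f g :: "complex \<Rightarrow> complex"
  assumes sep1: "separating_contour L C1 M1 \<eta>1 PR PL1" and sep2: "separating_contour L' C2 M2 \<eta>2 PR PL2"
    and f: "f holomorphic_on - (PR \<union> PL1)" and g: "g holomorphic_on - (PR \<union> PL2)"
    and fg: "\<And>\<xi>. g \<xi> = f \<xi> * ratio (\<beta> + of_real \<alpha> * \<xi>)"
    and PR_pos: "\<And>p. p \<in> PR \<Longrightarrow> 4 * \<delta> \<le> Re (\<beta> + of_real \<alpha> * p)"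
    and up: "du < du'" "rises L du'" "rises L' du'"
    and low: "dl < dl'" "rises (\<lambda>t. cnj (L (- t))) dl'" "rises (\<lambda>t. cnj (L' (- t))) dl'"
    and g_up: "\<And>C c h. c0 \<le> c \<Longrightarrow> h0 \<le> h \<Longrightarrow> order_bounded g (upper_region C c h du) \<and>
        upper_region C c h du \<inter> (PR \<union> PL2) = {}"
    and g_low: "\<And>C c h. c0 \<le> c \<Longrightarrow> h0 \<le> h \<Longrightarrow> order_bounded g {z. cnj z \<in> upper_region C c h dl} \<and>
        {z. cnj z \<in> upper_region C c h dl} \<inter> (PR \<union> PL2) = {}"
    and w: "w \<noteq> 0" and X: "v < X"
    and int1: "\<And>u. 0 < u \<Longrightarrow> u < X \<Longrightarrow>
        set_integrable lebesgue UNIV (\<lambda>t. (f (L t) * (w * of_real (u powr \<alpha>)) powr L t) * vector_derivative L (at t))"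
    and int2: "set_integrable lebesgue UNIV (\<lambda>t. (g (L' t) * (w * of_real (v powr \<alpha>)) powr L' t) * vector_derivative L' (at t))"
    and kint: "set_integrable lborel {0<..<v} (\<lambda>u. kernel 0 u *
        (LINT t|lebesgue. (f (L t) * (w * of_real (u powr \<alpha>)) powr L t) * vector_derivative L (at t)))"
  shows "(LINT u:{0<..<v}|lborel. kernel 0 u *
        (LINT t|lebesgue. (f (L t) * (w * of_real (u powr \<alpha>)) powr L t) * vector_derivative L (at t))) =
     Gamma \<mu> * of_real v powr (\<beta> + \<mu> - 1) *
        (LINT t|lebesgue. (g (L' t) * (w * of_real (v powr \<alpha>)) powr L' t) * vector_derivative L' (at t))"
proof -
  interpret L1: separating_contour L C1 M1 \<eta>1 PR PL1 by (rule sep1)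
  interpret L2: separating_contour L' C2 M2 \<eta>2 PR PL2 by (rule sep2)
  define C where "C = max C1 C2 + 1"
  \<comment> \<open>Right of \<open>c\<close> one has Re (\<beta> + \<alpha>\<xi>) >= 2\<delta>,
    beyond \<open>h\<close> in height |Im (\<beta> + \<alpha>\<xi>)| >= 2, and right of
    \<open>- C\<close> Re (\<beta> + \<alpha>\<xi>) >= -N. These are the conditions of
    \<open>region N\<close>, so both L-shaped regions fall into it.\<close>
  define c where "c = max c0 (max ((2 * \<delta> - Re \<beta>) / \<alpha>) (- C))"
  define h where "h = max h0 (max ((2 + \<bar>Im \<beta>\<bar>) / \<alpha>) (max du dl))"
  define N where "N = \<bar>\<alpha> * C - Re \<beta>\<bar>"
  have C: "C1 < C" "C2 < C" by (simp_all add: C_def)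
  have c: "c0 \<le> c" "(2 * \<delta> - Re \<beta>) / \<alpha> \<le> c" "- C \<le> c" by (simp_all add: c_def)
  have h: "h0 \<le> h" "(2 + \<bar>Im \<beta>\<bar>) / \<alpha> \<le> h" "du \<le> h" "dl \<le> h" by (simp_all add: h_def)
  have c': "2 * \<delta> \<le> Re \<beta> + \<alpha> * c"
    using c(2) alpha by (simp add: pos_divide_le_eq algebra_simps)
  have h': "2 + \<bar>Im \<beta>\<bar> \<le> \<alpha> * h"
    using h(2) alpha by (simp add: pos_divide_le_eq algebra_simps)
  define Uu where "Uu = upper_region C c h du"
  define Ul where "Ul = upper_region C c h dl"
  have qu: "quadrant_domain (Complex (- C) du) Uu" and ql: "quadrant_domain (Complex (- C) dl) Ul"
    unfolding Uu_def Ul_def using c h by (auto intro: quadrant_domain_upper_region)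
  have right_region: "\<xi> \<in> region N" if "c \<le> Re \<xi>" for \<xi>
  proof -
    have "\<alpha> * c \<le> \<alpha> * Re \<xi>" using that alpha by simp
    then show ?thesis using c' delta by (simp add: region_def N_def)
  qed
  have high_region: "\<xi> \<in> region N" if "- C \<le> Re \<xi>" "h \<le> \<bar>Im \<xi>\<bar>" for \<xi>
  proof -
    have "\<alpha> * (- C) \<le> \<alpha> * Re \<xi>" using that(1) alpha by (intro mult_left_mono) auto
    moreover have "\<alpha> * h \<le> \<alpha> * \<bar>Im \<xi>\<bar>" using that(2) alpha by simp
    moreover have "\<alpha> * \<bar>Im \<xi>\<bar> = \<bar>\<alpha> * Im \<xi>\<bar>" using alpha by (simp add: abs_mult)
    ultimately have "- N \<le> Re \<beta> + \<alpha> * Re \<xi>" "2 \<le> \<bar>Im \<beta> + \<alpha> * Im \<xi>\<bar>"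
      using h' unfolding N_def by linarith+
    then show ?thesis by (simp add: region_def)
  qed
  have Uu_region: "\<xi> \<in> region N" if "\<xi> \<in> Uu" for \<xi>
    using that right_region[of \<xi>] high_region[of \<xi>] unfolding Uu_def upper_region_def by auto
  have Ul_region: "\<xi> \<in> region N" if "cnj \<xi> \<in> Ul" for \<xi>
    using that right_region[of \<xi>] high_region[of \<xi>] unfolding Ul_def upper_region_def by auto
  have pw: "L piecewise_C1_differentiable_on {a..b}" "L' piecewise_C1_differentiable_on {a..b}" for a b
  proof -
    have "{a..b} \<subseteq> {- max \<bar>a\<bar> \<bar>b\<bar>..max \<bar>a\<bar> \<bar>b\<bar>}" by auto
    then show "L piecewise_C1_differentiable_on {a..b}" "L' piecewise_C1_differentiable_on {a..b}"
      using L1.pwC1 L2.pwC1 piecewise_C1_differentiable_on_subset by blast+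
  qed
  have pw': "(\<lambda>t. cnj (L (- t))) piecewise_C1_differentiable_on {a..b}"
    "(\<lambda>t. cnj (L' (- t))) piecewise_C1_differentiable_on {a..b}" for a b
    using pw by (auto intro: piecewise_C1_cnj_reflect(1))
  obtain T1 where T1: "\<forall>T\<ge>T1. up_tail Uu L T"
    unfolding Uu_def using rises_up_tail[OF up(2,1) L1.Re_ge C(1) pw(1)] by blast
  obtain T2 where T2: "\<forall>T\<ge>T2. up_tail Uu L' T"
    unfolding Uu_def using rises_up_tail[OF up(3,1) L2.Re_ge C(2) pw(2)] by blast
  obtain T3 where T3: "\<forall>T\<ge>T3. up_tail Ul (\<lambda>t. cnj (L (- t))) T"
    unfolding Ul_def using rises_up_tail[OF low(2,1) _ C(1) pw'(1)] L1.Re_ge by fastforce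
  obtain T4 where T4: "\<forall>T\<ge>T4. up_tail Ul (\<lambda>t. cnj (L' (- t))) T"
    unfolding Ul_def using rises_up_tail[OF low(3,1) _ C(2) pw'(2)] L2.Re_ge by fastforce
  obtain T5 where T5: "T5 > 0" "\<And>T. T \<ge> T5 \<Longrightarrow> \<exists>K0. \<forall>K\<ge>K0. \<forall>H\<ge>K0. norm (L T) \<le> K \<and> norm (L (- T)) \<le> K \<and>
    ((\<forall>p\<in>PR. Re p \<noteq> K) \<longrightarrow> L1.evaluates T K H)"
    using L1.residue_evaluation by blast
  obtain T6 where T6: "T6 > 0" "\<And>T. T \<ge> T6 \<Longrightarrow> \<exists>K0. \<forall>K\<ge>K0. \<forall>H\<ge>K0. norm (L' T) \<le> K \<and> norm (L' (- T)) \<le> K \<and>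
    ((\<forall>p\<in>PR. Re p \<noteq> K) \<longrightarrow> L2.evaluates T K H)"
    using L2.residue_evaluation by blast
  define T where "T = max T1 (max T2 (max T3 (max T4 (max T5 T6))))"
  have Tge: "T1 \<le> T" "T2 \<le> T" "T3 \<le> T" "T4 \<le> T" "T5 \<le> T" "T6 \<le> T" by (simp_all add: T_def)
  have T: "T > 0" using T5(1) Tge(5) by linarith
  have tails: "up_tail Uu L T" "up_tail Uu L' T" "up_tail Ul (\<lambda>t. cnj (L (- t))) T" "up_tail Ul (\<lambda>t. cnj (L' (- t))) T"
    using T1 T2 T3 T4 Tge by blast+
  obtain K1 where K1: "\<And>K H. K \<ge> K1 \<Longrightarrow> H \<ge> K1 \<Longrightarrow> norm (L T) \<le> K \<and> norm (L (- T)) \<le> K \<and>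
    ((\<forall>p\<in>PR. Re p \<noteq> K) \<longrightarrow> L1.evaluates T K H)"
    using T5(2)[OF Tge(5)] by blast
  obtain K2 where K2: "\<And>K H. K \<ge> K2 \<Longrightarrow> H \<ge> K2 \<Longrightarrow> norm (L' T) \<le> K \<and> norm (L' (- T)) \<le> K \<and>
    ((\<forall>p\<in>PR. Re p \<noteq> K) \<longrightarrow> L2.evaluates T K H)"
    using T6(2)[OF Tge(6)] by blast
  \<comment> \<open>One abscissa for both contours: the right-hand poles are the same for both
    integrands, so the same residue circles appear in the two evaluations.\<close>
  obtain K where K0: "K \<ge> max c (max K1 K2)" and Kgen: "\<forall>p\<in>PR. Re p \<noteq> K"
    using generic_abscissa[OF L1.finite_PR] by blast
  have Kge: "c \<le> K" "K1 \<le> K" "K2 \<le> K" using K0 by simp_all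
  have normK: "norm (L T) \<le> K" "norm (L (- T)) \<le> K" "norm (L' T) \<le> K" "norm (L' (- T)) \<le> K"
    using K1[OF Kge(2,2)] K2[OF Kge(3,3)] by blast+
  have ev1: "L1.evaluates T K K" using K1[OF Kge(2,2)] Kgen by blast
  have ev2: "L2.evaluates T K K" using K2[OF Kge(3,3)] Kgen by blast
  let ?E = "Complex K K" and ?E' = "Complex K (- K)"
  have below: "Re z \<le> Re ?E" "Im z \<le> Im ?E" "Re z \<le> Re ?E'" "Im ?E' \<le> Im z" if "norm z \<le> K" for z
    using that complex_Re_le_cmod[of z] abs_Im_le_cmod[of z] by auto
  define F where "F = {p. p \<in> PR \<and> Re p < K}"
  have finF: "finite F"
    unfolding F_def by (rule finite_subset[OF _ L1.finite_PR[of K]]) auto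
  have "\<exists>e>0. \<forall>p\<in>F. ball p e \<inter> (PR \<union> PL1 \<union> PL2) \<subseteq> {p}"
  proof (rule common_isolation_radius[OF finF])
    fix p
    show "finite ((PR \<union> PL1 \<union> PL2) \<inter> cball p 1)"
    proof (rule finite_subset)
      show "(PR \<union> PL1 \<union> PL2) \<inter> cball p 1 \<subseteq> {q \<in> PR. Re q \<le> Re p + 1} \<union> {q \<in> PL1. Re p - 1 \<le> Re q} \<union> {q \<in> PL2. Re p - 1 \<le> Re q}"
      proof
        fix q assume q: "q \<in> (PR \<union> PL1 \<union> PL2) \<inter> cball p 1"
        then have "\<bar>Re (p - q)\<bar> \<le> 1" using abs_Re_le_cmod[of "p - q"] by (simp add: dist_norm)
        then have "Re q \<le> Re p + 1" "Re p - 1 \<le> Re q" by (simp_all add: abs_le_iff)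
        then show "q \<in> {q \<in> PR. Re q \<le> Re p + 1} \<union> {q \<in> PL1. Re p - 1 \<le> Re q} \<union> {q \<in> PL2. Re p - 1 \<le> Re q}"
          using q by blast
      qed
      show "finite ({q \<in> PR. Re q \<le> Re p + 1} \<union> {q \<in> PL1. Re p - 1 \<le> Re q} \<union> {q \<in> PL2. Re p - 1 \<le> Re q})"
        using L1.finite_PR L1.finite_PL L2.finite_PL by blast
    qed
  qed
  then obtain e where e: "e > 0" "\<And>p. p \<in> F \<Longrightarrow> ball p e \<inter> (PR \<union> PL1 \<union> PL2) \<subseteq> {p}" by blast
  \<comment> \<open>A radius below \<open>e\<close> isolates the pole, and \<alpha>r <= 2\<delta>
    leaves Re (\<beta> + \<alpha>\<xi>) >= 4\<delta> - 2\<delta> on the circle.\<close>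
  define r where "r = min (e / 2) (2 * \<delta> / \<alpha>)"
  have r: "r > 0" "r < e" "r \<le> 2 * \<delta> / \<alpha>" using e(1) delta alpha by (auto simp: r_def)
  have r': "\<alpha> * r \<le> 2 * \<delta>" using r(3) alpha by (simp add: pos_le_divide_eq mult.commute)
  have residue_circle: "2 * pi * \<i> * residue k p = contour_integral (circlepath p r) k"
    if p: "p \<in> F" and k: "k holomorphic_on - (PR \<union> PLx)" and x: "PLx \<subseteq> PL1 \<union> PL2" for p k PLx
  proof -
    have "k holomorphic_on ball p e - {p}"
      by (rule holomorphic_on_subset[OF k]) (use e(2)[OF p] x in blast)
    moreover have "cball p r \<subseteq> ball p e" using r(2) by (auto simp: subset_iff)
    ultimately show ?thesis
      using base_residue[OF open_ball _ r(1), of p p e k] e(1)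
      by (intro contour_integral_unique[symmetric]) auto
  qed
  have circle_region: "path_image (circlepath p r) \<subseteq> region N" if p: "p \<in> F" for p
  proof
    fix z assume "z \<in> path_image (circlepath p r)"
    then have "norm (p - z) = r" using r(1) by (simp add: dist_norm)
    then have "Re p - r \<le> Re z" using abs_Re_le_cmod[of "p - z"] by simp
    then have "\<alpha> * (Re p - r) \<le> \<alpha> * Re z" using alpha by simp
    moreover have "4 * \<delta> \<le> Re (\<beta> + of_real \<alpha> * p)" using PR_pos p by (simp add: F_def)
    ultimately have "2 * \<delta> \<le> Re (\<beta> + of_real \<alpha> * z)" using r' by (simp add: algebra_simps)
    then show "z \<in> region N" using delta by (simp add: region_def N_def)
  qed
  have circle_poles: "path_image (circlepath p r) \<inter> (PR \<union> PL1) = {}" if p: "p \<in> F" for p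
  proof -
    have "path_image (circlepath p r) \<subseteq> ball p e - {p}" using r by (auto simp: path_image_circlepath)
    then show ?thesis using e(2)[OF p] by blast
  qed
  define z where "z u = w * of_real (u powr \<alpha>)" for u
  have z0: "z u \<noteq> 0" if "0 < u" for u using that w by (simp add: z_def)
  have powr_hol: "(\<lambda>\<xi>. k \<xi> * z u powr \<xi>) holomorphic_on A" if "k holomorphic_on A" "0 < u" for k u A
    using that z0[OF that(2)] by (intro holomorphic_intros) auto
  let ?I = "\<lambda>L S k. LINT t:S|lebesgue. k (L t) * vector_derivative L (at t)"
  define fu where "fu u \<xi> = f \<xi> * z u powr \<xi>" for u \<xi>
  define G where "G \<xi> = g \<xi> * z v powr \<xi>" for \<xi>
  define J where "J u = (LINT t|lebesgue. fu u (L t) * vector_derivative L (at t))" for u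
  have fu_hol: "fu u holomorphic_on - (PR \<union> PL1)" if "0 < u" for u
    unfolding fu_def using f that by (rule powr_hol)
  have G_hol: "G holomorphic_on - (PR \<union> PL2)"
    unfolding G_def using g v by (rule powr_hol)
  have fu_int: "set_integrable lebesgue UNIV (\<lambda>t. fu u (L t) * vector_derivative L (at t))" if "0 < u" "u < X" for u
    unfolding fu_def z_def by (rule int1[OF that])
  have G_int: "set_integrable lebesgue UNIV (\<lambda>t. G (L' t) * vector_derivative L' (at t))"
    unfolding G_def z_def by (rule int2)
  \<comment> \<open>All pieces lie in \<open>region N\<close>. Differences are written as sums with
    the factor -1 so that \<open>transforms_add\<close> and \<open>transforms_cmult\<close> apply as
    they stand.\<close>
  define P where "P u = ?I L {T..} (fu u) + - 1 * contour_integral (linepath (L T) ?E) (fu u) +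
     (?I L {..- T} (fu u) + - 1 * contour_integral (linepath ?E' (L (- T))) (fu u)) +
     - 1 * contour_integral (linepath ?E ?E') (fu u) + - 1 * (\<Sum>p\<in>F. contour_integral (circlepath p r) (fu u))" for u
  have J_P: "J u = P u" if u: "0 < u" "u < v" for u
  proof -
    have "J u = ?I L {T..} (fu u) - contour_integral (linepath (L T) ?E) (fu u) +
       (?I L {..- T} (fu u) - contour_integral (linepath ?E' (L (- T))) (fu u)) -
       contour_integral (linepath ?E ?E') (fu u) - (\<Sum>p\<in>F. 2 * pi * \<i> * residue (fu u) p)"
      unfolding J_def F_def using u X by (intro L1.evaluates_LINT[OF ev1 T fu_hol fu_int]) auto
    also have "(\<Sum>p\<in>F. 2 * pi * \<i> * residue (fu u) p) = (\<Sum>p\<in>F. contour_integral (circlepath p r) (fu u))"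
      by (intro sum.cong refl residue_circle[OF _ fu_hol[OF u(1)]]) auto
    finally show ?thesis by (simp add: P_def)
  qed
  have cont_f: "continuous_on A f" if "A \<inter> (PR \<union> PL1) = {}" for A
    using that holomorphic_on_imp_continuous_on[OF f] by (rule_tac continuous_on_subset) auto
  have closing_poles: "path_image (L1.closing T K K) \<inter> (PR \<union> PL1) = {}"
    using ev1 by (simp add: L1.evaluates_def)
  have seg_poles: "closed_segment (L T) ?E \<inter> (PR \<union> PL1) = {}" "closed_segment ?E ?E' \<inter> (PR \<union> PL1) = {}"
    "closed_segment ?E' (L (- T)) \<inter> (PR \<union> PL1) = {}"
    using closing_poles unfolding L1.path_image_closing by blast+
  have seg1: "closed_segment (L T) ?E \<subseteq> region N"
  proof
    fix \<xi> assume "\<xi> \<in> closed_segment (L T) ?E"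
    then have "Re (L T) \<le> Re \<xi>" "Im (L T) \<le> Im \<xi>"
      using segment_up_right[of \<xi> "L T" ?E] below[OF normK(1)] by blast+
    moreover have "L T \<in> Uu" using tails(1) by (simp add: up_tail_def)
    ultimately have "\<xi> \<in> Uu" using qu unfolding quadrant_domain_def by blast
    then show "\<xi> \<in> region N" by (rule Uu_region)
  qed
  have seg2: "closed_segment ?E ?E' \<subseteq> region N"
    using segment_vertical Kge(1) right_region by blast
  have seg3: "closed_segment ?E' (L (- T)) \<subseteq> region N"
  proof
    fix \<xi> assume "\<xi> \<in> closed_segment ?E' (L (- T))"
    then have "Re (L (- T)) \<le> Re \<xi>" "Im \<xi> \<le> Im (L (- T))"
      using segment_down_right[of \<xi> ?E' "L (- T)"] below[OF normK(2)] by blast+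
    then have "Re (cnj (L (- T))) \<le> Re (cnj \<xi>)" "Im (cnj (L (- T))) \<le> Im (cnj \<xi>)" by simp_all
    moreover have "cnj (L (- T)) \<in> Ul" using tails(3) by (simp add: up_tail_def)
    ultimately have "cnj \<xi> \<in> Ul" using ql unfolding quadrant_domain_def by blast
    then show "\<xi> \<in> region N" by (rule Ul_region)
  qed
  have L_meas: "(\<lambda>t. indicator S t *\<^sub>R L t) \<in> borel_measurable lebesgue" if "S \<in> sets borel" for S
  proof -
    have "L \<in> borel_measurable borel" by (rule borel_measurable_continuous_onI[OF L1.continuous_L])
    with that show ?thesis by (intro measurable_completion) simp
  qed
  have tail_up_region: "L t \<in> region N" if "t \<in> {T..}" for t
    using tails(1) that by (intro Uu_region) (simp add: up_tail_def)
  have tail_low_region: "L t \<in> region N" if "t \<in> {..- T}" for t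
  proof (rule Ul_region)
    have "\<forall>s\<ge>T. cnj (L (- s)) \<in> Ul" using tails(3) by (simp add: up_tail_def)
    moreover have "T \<le> - t" using that by simp
    ultimately have "cnj (L (- (- t))) \<in> Ul" by blast
    then show "cnj (L t) \<in> Ul" by simp
  qed
  have sub_int: "set_integrable lebesgue S (\<lambda>t. fu v (L t) * vector_derivative L (at t))" if "S \<in> sets lebesgue" for S
    using that v X by (intro set_integrable_subset[OF fu_int]) auto
  define fl where "fl l \<xi> = fu v \<xi> * ratio (\<beta> + l + of_real \<alpha> * \<xi>)" for l \<xi>
  let ?c = "\<lambda>l. Gamma \<mu> * of_real v powr (\<beta> + l + \<mu> - 1)"
  have tr_up: "transforms (\<lambda>u. ?I L {T..} (fu u)) (\<lambda>l. ?c l * ?I L {T..} (fl l))"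
  proof -
    have S: "{T..} \<in> sets lebesgue" and B: "{T..} \<in> sets borel" by simp_all
    note i = sub_int[OF S, unfolded fu_def z_def]
    show ?thesis
      unfolding fu_def fl_def z_def by (rule transforms_curve[OF w S i L_meas[OF B] tail_up_region])
  qed
  have tr_low: "transforms (\<lambda>u. ?I L {..- T} (fu u)) (\<lambda>l. ?c l * ?I L {..- T} (fl l))"
  proof -
    have S: "{..- T} \<in> sets lebesgue" and B: "{..- T} \<in> sets borel" by simp_all
    note i = sub_int[OF S, unfolded fu_def z_def]
    show ?thesis
      unfolding fu_def fl_def z_def by (rule transforms_curve[OF w S i L_meas[OF B] tail_low_region])
  qed
  have tr_path: "transforms (\<lambda>u. contour_integral k (fu u)) (\<lambda>l. ?c l * contour_integral k (fl l))"
    if "continuous_on {0..1} k" "continuous_on {0..1} (\<lambda>t. vector_derivative k (at t))"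
      "path_image k \<inter> (PR \<union> PL1) = {}" "path_image k \<subseteq> region N" for k
    using transforms_path[OF w that(1,2) cont_f[OF that(3)] that(4)]
    unfolding fu_def[abs_def] fl_def[abs_def] z_def .
  have tr_seg: "transforms (\<lambda>u. contour_integral (linepath a b) (fu u)) (\<lambda>l. ?c l * contour_integral (linepath a b) (fl l))"
    if "closed_segment a b \<inter> (PR \<union> PL1) = {}" "closed_segment a b \<subseteq> region N" for a b
    using that by (intro tr_path) (auto intro: continuous_intros)
  have tr_circle: "transforms (\<lambda>u. contour_integral (circlepath p r) (fu u)) (\<lambda>l. ?c l * contour_integral (circlepath p r) (fl l))"
    if "p \<in> F" for p
    using circle_poles[OF that] circle_region[OF that] path_circlepath[of p r]
    by (intro tr_path) (auto simp: path_def vector_derivative_circlepath intro!: continuous_intros)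
  have tr_P: "transforms P (\<lambda>l. ?c l * ?I L {T..} (fl l) + - 1 * (?c l * contour_integral (linepath (L T) ?E) (fl l)) +
     (?c l * ?I L {..- T} (fl l) + - 1 * (?c l * contour_integral (linepath ?E' (L (- T))) (fl l))) +
     - 1 * (?c l * contour_integral (linepath ?E ?E') (fl l)) + - 1 * (\<Sum>p\<in>F. ?c l * contour_integral (circlepath p r) (fl l)))"
    unfolding P_def[abs_def]
    by (intro transforms_add transforms_cmult transforms_sum finF tr_up tr_low tr_seg tr_circle seg_poles seg1 seg2 seg3)
  have fl0: "fl 0 = G"
    by (simp add: fl_def fu_def G_def fg fun_eq_iff)
  have D0: "0 \<in> D" using delta by (simp add: D_def)
  \<comment> \<open>For the integrand of H' convergence is assumed along \<open>L'\<close>; along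
    the tails of \<open>L\<close> it follows from that of H, since the quotient of Gamma functions
    is bounded on \<open>region N\<close>.\<close>
  have G_up: "set_integrable lebesgue {T..} (\<lambda>t. G (L t) * vector_derivative L (at t))"
  proof -
    have S: "{T..} \<in> sets lebesgue" and B: "{T..} \<in> sets borel" by simp_all
    have eq: "G (L t) * vector_derivative L (at t) =
        (fu v (L t) * vector_derivative L (at t)) * ratio (\<beta> + 0 + of_real \<alpha> * L t)" for t
      unfolding fl0[symmetric] fl_def by (simp only: mult_ac)
    show ?thesis
      unfolding eq by (rule ratio_times_integrable(1)[OF S sub_int[OF S] L_meas[OF B] tail_up_region D0])
  qed
  have G_low: "set_integrable lebesgue {..- T} (\<lambda>t. G (L t) * vector_derivative L (at t))"
  proof -
    have S: "{..- T} \<in> sets lebesgue" and B: "{..- T} \<in> sets borel" by simp_all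
    have eq: "G (L t) * vector_derivative L (at t) =
        (fu v (L t) * vector_derivative L (at t)) * ratio (\<beta> + 0 + of_real \<alpha> * L t)" for t
      unfolding fl0[symmetric] fl_def by (simp only: mult_ac)
    show ?thesis
      unfolding eq by (rule ratio_times_integrable(1)[OF S sub_int[OF S] L_meas[OF B] tail_low_region D0])
  qed
  have G_sub: "set_integrable lebesgue S (\<lambda>t. G (L' t) * vector_derivative L' (at t))" if "S \<in> sets lebesgue" for S
    using that by (intro set_integrable_subset[OF G_int]) auto
  have G_bound: "order_bounded G A" if "order_bounded g A" for A
    unfolding G_def[abs_def] using that by (intro order_bounded_mult order_bounded_powr)
  have up_eq: "?I L {T..} G - contour_integral (linepath (L T) ?E) G = ?I L' {T..} G - contour_integral (linepath (L' T) ?E) G"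
  proof (rule up_tail_difference[OF qu _ _ tails(1,2) G_up G_sub])
    show "G holomorphic_on Uu"
      using g_up[OF c(1) h(1)] by (intro holomorphic_on_subset[OF G_hol]) (auto simp: Uu_def)
    show "order_bounded G Uu" using g_up[OF c(1) h(1)] G_bound by (simp add: Uu_def)
  qed (use below normK in auto)
  have low_eq: "?I L {..- T} G - contour_integral (linepath ?E' (L (- T))) G = ?I L' {..- T} G - contour_integral (linepath ?E' (L' (- T))) G"
  proof (rule lower_tail_difference[OF ql _ _ L1.pwC1 L2.pwC1 tails(3,4) G_low G_sub])
    have oU: "open Ul" using ql by (simp add: quadrant_domain_def)
    have gl: "order_bounded g {z. cnj z \<in> Ul}" "{z. cnj z \<in> Ul} \<inter> (PR \<union> PL2) = {}"
      using g_low[OF c(1) h(1)] unfolding Ul_def by blast+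
    have "G holomorphic_on {z. cnj z \<in> Ul}"
      using gl(2) by (intro holomorphic_on_subset[OF G_hol]) auto
    from cnj_reflected_bounds[OF this G_bound[OF gl(1)] oU]
    show "(\<lambda>z. cnj (G (cnj z))) holomorphic_on Ul" "order_bounded (\<lambda>z. cnj (G (cnj z))) Ul" .
  qed (use below normK in auto)
  \<comment> \<open>The residue evaluation along \<open>L'\<close> with its tails exchanged for
    those of \<open>L\<close>: up to the factor in front, these are term by term the values at l = 0
    of the transforms of the pieces of \<open>P\<close>.\<close>
  have eval2: "(LINT t|lebesgue. G (L' t) * vector_derivative L' (at t)) =
       ?I L {T..} G - contour_integral (linepath (L T) ?E) G +
       (?I L {..- T} G - contour_integral (linepath ?E' (L (- T))) G) -
       contour_integral (linepath ?E ?E') G - (\<Sum>p\<in>F. contour_integral (circlepath p r) G)"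
  proof -
    have "(LINT t|lebesgue. G (L' t) * vector_derivative L' (at t)) =
       ?I L' {T..} G - contour_integral (linepath (L' T) ?E) G +
       (?I L' {..- T} G - contour_integral (linepath ?E' (L' (- T))) G) -
       contour_integral (linepath ?E ?E') G - (\<Sum>p\<in>F. 2 * pi * \<i> * residue G p)"
      unfolding F_def by (intro L2.evaluates_LINT[OF ev2 T G_hol G_int])
    also have "(\<Sum>p\<in>F. 2 * pi * \<i> * residue G p) = (\<Sum>p\<in>F. contour_integral (circlepath p r) G)"
      by (intro sum.cong refl residue_circle[OF _ G_hol]) auto
    finally show ?thesis unfolding up_eq low_eq .
  qed
  have kint': "set_integrable lborel {0<..<v} (\<lambda>u. kernel 0 u * J u)"
    using kint unfolding J_def fu_def z_def .
  have "(LINT u:{0<..<v}|lborel. kernel 0 u * J u) = (LINT u:{0<..<v}|lborel. kernel 0 u * P u)"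
    using J_P by (intro set_lebesgue_integral_cong) auto
  also have "\<dots> = ?c 0 * ?I L {T..} (fl 0) + - 1 * (?c 0 * contour_integral (linepath (L T) ?E) (fl 0)) +
     (?c 0 * ?I L {..- T} (fl 0) + - 1 * (?c 0 * contour_integral (linepath ?E' (L (- T))) (fl 0))) +
     - 1 * (?c 0 * contour_integral (linepath ?E ?E') (fl 0)) + - 1 * (\<Sum>p\<in>F. ?c 0 * contour_integral (circlepath p r) (fl 0))"
  proof (rule transforms_at_0[OF tr_P])
    have "set_integrable lborel {0<..<v} (\<lambda>u. kernel 0 u * J u) \<longleftrightarrow> set_integrable lborel {0<..<v} (\<lambda>u. kernel 0 u * P u)"
      using J_P by (intro set_integrable_cong) auto
    then show "set_integrable lborel {0<..<v} (\<lambda>u. kernel 0 u * P u)" using kint' by blast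
  qed
  also have "\<dots> = ?c 0 * (?I L {T..} G - contour_integral (linepath (L T) ?E) G +
       (?I L {..- T} G - contour_integral (linepath ?E' (L (- T))) G) -
       contour_integral (linepath ?E ?E') G - (\<Sum>p\<in>F. contour_integral (circlepath p r) G))"
    unfolding fl0 sum_distrib_left[symmetric] by (simp only: distrib_left right_diff_distrib) simp
  also have "\<dots> = ?c 0 * (LINT t|lebesgue. G (L' t) * vector_derivative L' (at t))"
    unfolding eval2 ..
  finally show ?thesis
    unfolding J_def fu_def G_def z_def by simp
qed

end

section \<open>Fractional integrals and the composition formula\<close>

lemma pair_sigma_finite_lebesgue: "pair_sigma_finite (lebesgue :: real measure) (lebesgue :: real measure)"
  unfolding pair_sigma_finite_def using sigma_finite_lebesgue by blast

lemma lebesgue_measurable_id: "(\<lambda>x. x) \<in> lebesgue \<rightarrow>\<^sub>M borel"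
  by (intro measurable_completion) simp

text \<open>Translation by s makes this the Beta integral with second parameter 1 over (0, x -
  s).\<close>

lemma fractional_kernel_integrable:
  fixes s x :: real and \<mu> :: complex
  assumes "Re \<mu> > 0" "s < x"
  shows "set_integrable lebesgue {s<..<x} (\<lambda>t. complex_of_real (t - s) powr (\<mu> - 1))"
    and "(LINT t:{s<..<x}|lebesgue. norm (complex_of_real (t - s) powr (\<mu> - 1))) = (x - s) powr Re \<mu> * Beta (Re \<mu>) 1"
proof -
  let ?f = "\<lambda>u. indicator {0<..<x - s} u *\<^sub>R (complex_of_real u powr (\<mu> - 1) * of_real (x - s - u) powr (1 - 1))"
  have eq: "indicator {s<..<x} t *\<^sub>R (complex_of_real (t - s) powr (\<mu> - 1)) = ?f (- s + 1 * t)" for t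
    by (auto simp: indicator_def)
  have "integrable lborel ?f"
    using set_integrable_Beta_scaled(1)[of \<mu> 1 "x - s"] assms by (simp add: set_integrable_def)
  then have "integrable lebesgue ?f" by (subst integrable_completion) auto
  then have "integrable lebesgue (\<lambda>t. ?f (- s + 1 * t))"
    by (subst lebesgue_integrable_real_affine_iff) auto
  then show "set_integrable lebesgue {s<..<x} (\<lambda>t. complex_of_real (t - s) powr (\<mu> - 1))"
    unfolding set_integrable_def eq .
  have eqn: "indicator {s<..<x} t *\<^sub>R norm (complex_of_real (t - s) powr (\<mu> - 1)) = norm (?f (- s + 1 * t))" for t
    unfolding eq[symmetric] by simp
  have "(LINT t:{s<..<x}|lebesgue. norm (complex_of_real (t - s) powr (\<mu> - 1))) = (\<integral>t. norm (?f (- s + 1 * t)) \<partial>lebesgue)"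
    unfolding set_lebesgue_integral_def eqn ..
  also have "\<dots> = (\<integral>u. norm (?f u) \<partial>lebesgue)"
    using lebesgue_integral_real_affine[of 1 "\<lambda>u. norm (?f u)" "- s"] by simp
  also have "\<dots> = (\<integral>u. norm (?f u) \<partial>lborel)"
    by (rule integral_completion) measurable
  also have "\<dots> = (LINT u:{0<..<x - s}|lborel. norm (complex_of_real u powr (\<mu> - 1) * of_real (x - s - u) powr (1 - 1)))"
    unfolding set_lebesgue_integral_def by (simp add: norm_mult)
  also have "\<dots> = (x - s) powr (Re \<mu> + Re 1 - 1) * Beta (Re \<mu>) (Re 1)"
    using assms by (intro LINT_norm_Beta_scaled) auto
  finally show "(LINT t:{s<..<x}|lebesgue. norm (complex_of_real (t - s) powr (\<mu> - 1))) = (x - s) powr Re \<mu> * Beta (Re \<mu>) 1"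
    by simp
qed

text \<open>A divergent Lebesgue integral has the value 0 by convention, so a bound on integrals of
  norms does not show that the inner integrands are integrable; this is established here. Fubini
  gives it for almost every t, the kernel having an integral bounded uniformly in s.\<close>

lemma fractional_integral_AE_integrable:
  fixes \<phi> :: "real \<Rightarrow> complex" and \<mu> :: complex
  assumes \<phi>: "set_integrable lebesgue {a<..<x} \<phi>" and mu: "Re \<mu> > 0"
  shows "AE t in lebesgue. integrable lebesgue
     (\<lambda>s. indicator {s<..<x} t *\<^sub>R ((indicator {a<..<x} s *\<^sub>R \<phi> s) * complex_of_real (t - s) powr (\<mu> - 1)))"
proof -
  interpret pair_sigma_finite "lebesgue :: real measure" "lebesgue :: real measure"
    by (rule pair_sigma_finite_lebesgue)
  note lebesgue_measurable_id [measurable]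
  let ?p = "\<lambda>s. indicator {a<..<x} s *\<^sub>R \<phi> s"
  have p[measurable]: "?p \<in> borel_measurable lebesgue"
    using \<phi> by (auto simp: set_integrable_def)
  let ?F = "\<lambda>s t. indicator {s<..<x} t *\<^sub>R (?p s * complex_of_real (t - s) powr (\<mu> - 1))"
  have F_eq: "?F s t = ?p s * (indicator {s<..<x} t *\<^sub>R complex_of_real (t - s) powr (\<mu> - 1))" for s t by simp
  have p0: "?p s = 0" if "\<not> s < x" for s using that by simp
  have "integrable (lebesgue \<Otimes>\<^sub>M lebesgue) (case_prod ?F)"
  proof (rule Fubini_integrable)
    have "case_prod ?F = (\<lambda>(s, t). (if s < t \<and> t < x then 1 else 0) *\<^sub>R (?p s * complex_of_real (t - s) powr (\<mu> - 1)))"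
      by (auto simp: fun_eq_iff indicator_def)
    also have "\<dots> \<in> borel_measurable (lebesgue \<Otimes>\<^sub>M lebesgue)" by measurable
    finally show "case_prod ?F \<in> borel_measurable (lebesgue \<Otimes>\<^sub>M lebesgue)" .
    show "AE s in lebesgue. integrable lebesgue (\<lambda>t. case_prod ?F (s, t))"
    proof (rule AE_I2)
      fix s
      show "integrable lebesgue (\<lambda>t. case_prod ?F (s, t))"
      proof (cases "s < x")
        case True
        then show ?thesis
          using fractional_kernel_integrable(1)[OF mu True]
          unfolding prod.case F_eq set_integrable_def by (intro integrable_mult_right) auto
      next
        case False
        show ?thesis unfolding prod.case F_eq p0[OF False] by simp
      qed
    qed
    show "integrable lebesgue (\<lambda>s. \<integral>t. norm (case_prod ?F (s, t)) \<partial>lebesgue)"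
    proof (rule Bochner_Integration.integrable_bound)
      let ?c = "(x - a) powr Re \<mu> * Beta (Re \<mu>) 1"
      show "integrable lebesgue (\<lambda>s. ?c * norm (?p s))"
        using \<phi> unfolding set_integrable_def by (intro integrable_mult_right integrable_norm) auto
      have "case_prod ?F = (\<lambda>(s, t). (if s < t \<and> t < x then 1 else 0) *\<^sub>R (?p s * complex_of_real (t - s) powr (\<mu> - 1)))"
        by (auto simp: fun_eq_iff indicator_def)
      then have "(\<lambda>s. \<integral>t. norm (case_prod ?F (s, t)) \<partial>lebesgue) =
        (\<lambda>s. \<integral>t. norm ((if s < t \<and> t < x then 1 else 0) *\<^sub>R (?p s * complex_of_real (t - s) powr (\<mu> - 1))) \<partial>lebesgue)"
        by simp
      also have "\<dots> \<in> borel_measurable lebesgue" by measurable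
      finally show "(\<lambda>s. \<integral>t. norm (case_prod ?F (s, t)) \<partial>lebesgue) \<in> borel_measurable lebesgue" .
      show "AE s in lebesgue. norm (\<integral>t. norm (case_prod ?F (s, t)) \<partial>lebesgue) \<le> norm (?c * norm (?p s))"
      proof (rule AE_I2)
        fix s
        show "norm (\<integral>t. norm (case_prod ?F (s, t)) \<partial>lebesgue) \<le> norm (?c * norm (?p s))"
        proof (cases "s \<in> {a<..<x}")
          case True
          have "(\<integral>t. norm (case_prod ?F (s, t)) \<partial>lebesgue) =
              norm (?p s) * (\<integral>t. norm (indicator {s<..<x} t *\<^sub>R complex_of_real (t - s) powr (\<mu> - 1)) \<partial>lebesgue)"
            unfolding prod.case F_eq norm_mult by (rule integral_mult_right_zero)
          also have "(\<integral>t. norm (indicator {s<..<x} t *\<^sub>R complex_of_real (t - s) powr (\<mu> - 1)) \<partial>lebesgue) =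
              (LINT t:{s<..<x}|lebesgue. norm (complex_of_real (t - s) powr (\<mu> - 1)))"
            unfolding set_lebesgue_integral_def by simp
          also have "\<dots> = (x - s) powr Re \<mu> * Beta (Re \<mu>) 1"
            using True by (intro fractional_kernel_integrable(2)[OF mu]) auto
          finally have eq: "(\<integral>t. norm (case_prod ?F (s, t)) \<partial>lebesgue) = norm (?p s) * ((x - s) powr Re \<mu> * Beta (Re \<mu>) 1)" .
          have B: "Beta (Re \<mu>) 1 \<ge> 0"
            using mu by (simp add: Beta_def Gamma_real_pos less_imp_le)
          have "(x - s) powr Re \<mu> \<le> (x - a) powr Re \<mu>"
            using True mu by (intro powr_mono2) auto
          then have "norm (?p s) * ((x - s) powr Re \<mu> * Beta (Re \<mu>) 1) \<le> norm (?p s) * ?c"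
            using B by (intro mult_left_mono mult_right_mono) auto
          moreover have "0 \<le> norm (?p s) * ((x - s) powr Re \<mu> * Beta (Re \<mu>) 1)" using B by simp
          ultimately show ?thesis unfolding eq real_norm_def by (simp only: abs_of_nonneg mult.commute)
        next
          case False
          then have p0: "?p s = 0" by simp
          show ?thesis unfolding prod.case F_eq p0 by simp
        qed
      qed
    qed
  qed
  then show ?thesis by (rule AE_integrable_snd)
qed

text \<open>The substitution u = x - t turns the convolution over (s, x) into the Beta-type integral
  over (0, v). The equivalence of integrability lets what Fubini says about sections be used for
  that integral.\<close>

lemma LINT_reflected_convolution:
  fixes k :: "real \<Rightarrow> complex" and \<mu> :: complex
  assumes meas: "(\<lambda>u. indicator {0<..<X} u *\<^sub>R k u) \<in> borel_measurable borel" and v: "v \<le> X" "v = x - s"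
  shows "integrable lebesgue (\<lambda>t. indicator {s<..<x} t *\<^sub>R (k (x - t) * complex_of_real (t - s) powr (\<mu> - 1))) \<longleftrightarrow>
      set_integrable lborel {0<..<v} (\<lambda>u. k u * complex_of_real (v - u) powr (\<mu> - 1))"
    and "(\<integral>t. indicator {s<..<x} t *\<^sub>R (k (x - t) * complex_of_real (t - s) powr (\<mu> - 1)) \<partial>lebesgue) =
      (LINT u:{0<..<v}|lborel. k u * complex_of_real (v - u) powr (\<mu> - 1))"
proof -
  let ?f = "\<lambda>u. indicator {0<..<v} u *\<^sub>R (k u * complex_of_real (v - u) powr (\<mu> - 1))"
  note meas[measurable]
  have "?f = (\<lambda>u. indicator {0<..<v} u *\<^sub>R ((indicator {0<..<X} u *\<^sub>R k u) * complex_of_real (v - u) powr (\<mu> - 1)))"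
    using v(1) by (auto simp: indicator_def fun_eq_iff)
  also have "\<dots> \<in> borel_measurable lborel" by measurable
  finally have fm: "?f \<in> borel_measurable lborel" .
  have eq: "indicator {s<..<x} t *\<^sub>R (k (x - t) * complex_of_real (t - s) powr (\<mu> - 1)) = ?f (x + - 1 * t)" for t
  proof (cases "t \<in> {s<..<x}")
    case True
    then have "x + - 1 * t \<in> {0<..<v}" using v(2) by auto
    then show ?thesis using True v(2) by simp
  next
    case False
    then have "x + - 1 * t \<notin> {0<..<v}" using v(2) by auto
    with False show ?thesis by simp
  qed
  show "integrable lebesgue (\<lambda>t. indicator {s<..<x} t *\<^sub>R (k (x - t) * complex_of_real (t - s) powr (\<mu> - 1))) \<longleftrightarrow>
      set_integrable lborel {0<..<v} (\<lambda>u. k u * complex_of_real (v - u) powr (\<mu> - 1))"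
    unfolding eq set_integrable_def integrable_completion[OF fm, symmetric]
    using lebesgue_integrable_real_affine_iff[of "- 1" ?f x] by simp
  have "(\<integral>t. ?f (x + - 1 * t) \<partial>lebesgue) = (\<integral>t. ?f t \<partial>lebesgue)"
    using lebesgue_integral_real_affine[of "- 1" ?f x] by simp
  also have "\<dots> = (\<integral>t. ?f t \<partial>lborel)" by (rule integral_completion[OF fm])
  finally show "(\<integral>t. indicator {s<..<x} t *\<^sub>R (k (x - t) * complex_of_real (t - s) powr (\<mu> - 1)) \<partial>lebesgue) =
      (LINT u:{0<..<v}|lborel. k u * complex_of_real (v - u) powr (\<mu> - 1))"
    unfolding eq set_lebesgue_integral_def .
qed

text \<open>The identity \<open>kk'\<close> is assumed only where its u-integral converges
  absolutely. Fubini provides this for almost every s with \<phi>(s) nonzero, and at zeros of \<phi>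
  both sides vanish. The factor \<Gamma>(\<mu>) then cancels the normalisation of the fractional
  integral.\<close>

theorem convolution_frac_integral:
  fixes \<phi> k k' :: "real \<Rightarrow> complex" and \<mu> :: complex
  assumes mu: "Re \<mu> > 0" and ax: "a < x"
    and meas: "(\<lambda>u. indicator {0<..<x - a} u *\<^sub>R k u) \<in> borel_measurable borel"
    and kk': "\<And>v. 0 < v \<Longrightarrow> v < x - a \<Longrightarrow> set_integrable lborel {0<..<v} (\<lambda>u. k u * complex_of_real (v - u) powr (\<mu> - 1)) \<Longrightarrow>
        (LINT u:{0<..<v}|lborel. k u * complex_of_real (v - u) powr (\<mu> - 1)) = Gamma \<mu> * k' v"
    and \<phi>: "set_integrable lebesgue {a<..<x} \<phi>"
    and int: "set_integrable lebesgue {a<..<x} (\<lambda>t. norm (k (x - t)) *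
        (LINT s:{a<..<t}|lebesgue. norm (\<phi> s / complex_of_real (t - s) powr (1 - \<mu>))))"
    and int': "set_integrable lebesgue {a<..<x} (\<lambda>t. k' (x - t) * \<phi> t)"
  shows "(LINT t:{a<..<x}|lebesgue. k (x - t) * frac_integral a \<mu> \<phi> t) = (LINT t:{a<..<x}|lebesgue. k' (x - t) * \<phi> t)"
proof -
  interpret pair_sigma_finite "lebesgue :: real measure" "lebesgue :: real measure"
    by (rule pair_sigma_finite_lebesgue)
  note lebesgue_measurable_id [measurable]
  let ?p = "\<lambda>s. indicator {a<..<x} s *\<^sub>R \<phi> s"
  have p[measurable]: "?p \<in> borel_measurable lebesgue"
    using \<phi> by (auto simp: set_integrable_def)
  let ?k = "\<lambda>t. indicator {0<..<x - a} (x - t) *\<^sub>R k (x - t)"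
  have k[measurable]: "?k \<in> borel_measurable lebesgue"
    using meas by (intro measurable_completion) (auto intro: measurable_compose[of "\<lambda>t. x - t"])
  let ?C = "\<lambda>s t. indicator {s<..<x} t *\<^sub>R (?p s * complex_of_real (t - s) powr (\<mu> - 1))"
  let ?F = "\<lambda>t s. ?k t * ?C s t"
  have div: "\<phi> s / complex_of_real (t - s) powr (1 - \<mu>) = \<phi> s * complex_of_real (t - s) powr (\<mu> - 1)" for s t
    by (metis divide_inverse minus_diff_eq powr_minus)
  have inner_s: "?F t s = ?k t * (indicator {a<..<t} s *\<^sub>R (\<phi> s / complex_of_real (t - s) powr (1 - \<mu>)))" for t s
    unfolding div using ax by (auto simp: indicator_def)
  have k_ind: "?k t = indicator {a<..<x} t *\<^sub>R k (x - t)" for t by (auto simp: indicator_def)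
  have F_meas: "case_prod ?F \<in> borel_measurable (lebesgue \<Otimes>\<^sub>M lebesgue)"
  proof -
    have "case_prod ?F = (\<lambda>(t, s). ?k t * ((if s < t \<and> t < x then 1 else 0) *\<^sub>R (?p s * complex_of_real (t - s) powr (\<mu> - 1))))"
      by (auto simp: fun_eq_iff indicator_def)
    also have "\<dots> \<in> borel_measurable (lebesgue \<Otimes>\<^sub>M lebesgue)" by measurable
    finally show ?thesis .
  qed
  have F_int: "integrable (lebesgue \<Otimes>\<^sub>M lebesgue) (case_prod ?F)"
  proof (rule Fubini_integrable[OF F_meas])
    have "(\<integral>s. norm (case_prod ?F (t, s)) \<partial>lebesgue) = indicator {a<..<x} t *\<^sub>R (norm (k (x - t)) *
        (LINT s:{a<..<t}|lebesgue. norm (\<phi> s / complex_of_real (t - s) powr (1 - \<mu>))))" for t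
    proof -
      have "(\<integral>s. norm (case_prod ?F (t, s)) \<partial>lebesgue) =
          norm (?k t) * (\<integral>s. norm (indicator {a<..<t} s *\<^sub>R (\<phi> s / complex_of_real (t - s) powr (1 - \<mu>))) \<partial>lebesgue)"
        unfolding prod.case inner_s norm_mult by (rule integral_mult_right_zero)
      also have "(\<integral>s. norm (indicator {a<..<t} s *\<^sub>R (\<phi> s / complex_of_real (t - s) powr (1 - \<mu>))) \<partial>lebesgue) =
          (LINT s:{a<..<t}|lebesgue. norm (\<phi> s / complex_of_real (t - s) powr (1 - \<mu>)))"
        unfolding set_lebesgue_integral_def norm_scaleR by simp
      finally show ?thesis unfolding k_ind by simp
    qed
    then show "integrable lebesgue (\<lambda>t. \<integral>s. norm (case_prod ?F (t, s)) \<partial>lebesgue)"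
      using int unfolding set_integrable_def by simp
    show "AE t in lebesgue. integrable lebesgue (\<lambda>s. case_prod ?F (t, s))"
      using fractional_integral_AE_integrable[OF \<phi> mu]
    proof eventually_elim
      case (elim t)
      show ?case unfolding prod.case by (rule integrable_mult_right) (use elim in blast)
    qed
  qed
  have outer: "AE s in lebesgue. (\<integral>t. ?F t s \<partial>lebesgue) = Gamma \<mu> * (indicator {a<..<x} s *\<^sub>R (k' (x - s) * \<phi> s))"
    using AE_integrable_snd[OF F_int]
  proof eventually_elim
    case (elim s)
    show ?case
    proof (cases "s \<in> {a<..<x} \<and> \<phi> s \<noteq> 0")
      case False
      then have "?p s = 0" by auto
      then show ?thesis using False by auto
    next
      case True
      have eq: "?F t s = \<phi> s * (indicator {s<..<x} t *\<^sub>R (k (x - t) * complex_of_real (t - s) powr (\<mu> - 1)))" for t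
        using True by (auto simp: indicator_def)
      have v: "0 < x - s" "x - s < x - a" using True by auto
      note refl = LINT_reflected_convolution[OF meas less_imp_le[OF v(2)] refl, of \<mu>]
      have "integrable lebesgue (\<lambda>t. \<phi> s * (indicator {s<..<x} t *\<^sub>R (k (x - t) * complex_of_real (t - s) powr (\<mu> - 1))))"
        using elim unfolding eq .
      \<comment> \<open>Division by \<phi>(s) passes from the section of \<open>?F\<close> to the
        convolution of the kernel itself, which is the premise of \<open>kk'\<close>.\<close>
      then have "integrable lebesgue (\<lambda>t. 1 / \<phi> s * (\<phi> s * (indicator {s<..<x} t *\<^sub>R (k (x - t) * complex_of_real (t - s) powr (\<mu> - 1)))))"
        by (rule integrable_mult_right[rotated])
      moreover have "1 / \<phi> s * (\<phi> s * y) = y" for y using True by simp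
      ultimately have "integrable lebesgue (\<lambda>t. indicator {s<..<x} t *\<^sub>R (k (x - t) * complex_of_real (t - s) powr (\<mu> - 1)))"
        by (simp only:)
      from kk'[OF v this[unfolded refl(1)]]
      have "(\<integral>t. indicator {s<..<x} t *\<^sub>R (k (x - t) * complex_of_real (t - s) powr (\<mu> - 1)) \<partial>lebesgue) = Gamma \<mu> * k' (x - s)"
        unfolding refl(2) .
      then show ?thesis unfolding eq integral_mult_right_zero using True by simp
    qed
  qed
  have "Gamma \<mu> \<noteq> 0" using mu by (simp add: Gamma_eq_zero_iff not_nonpos_Ints_Re_pos)
  have inner: "(\<integral>s. ?F t s \<partial>lebesgue) = ?k t * (LINT s:{a<..<t}|lebesgue. \<phi> s / complex_of_real (t - s) powr (1 - \<mu>))" for t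
    unfolding inner_s set_lebesgue_integral_def by (rule integral_mult_right_zero)
  have "indicator {a<..<x} t *\<^sub>R (k (x - t) * frac_integral a \<mu> \<phi> t) = 1 / Gamma \<mu> * (\<integral>s. ?F t s \<partial>lebesgue)" for t
    unfolding inner unfolding frac_integral_def k_ind by simp
  then have "(LINT t:{a<..<x}|lebesgue. k (x - t) * frac_integral a \<mu> \<phi> t) = (\<integral>t. 1 / Gamma \<mu> * (\<integral>s. ?F t s \<partial>lebesgue) \<partial>lebesgue)"
    unfolding set_lebesgue_integral_def by (simp only:)
  also have "\<dots> = 1 / Gamma \<mu> * (\<integral>t. (\<integral>s. ?F t s \<partial>lebesgue) \<partial>lebesgue)"
    by (rule integral_mult_right_zero)
  also have "(\<integral>t. (\<integral>s. ?F t s \<partial>lebesgue) \<partial>lebesgue) = (\<integral>s. (\<integral>t. ?F t s \<partial>lebesgue) \<partial>lebesgue)"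
    by (rule Fubini_integral[OF F_int, symmetric])
  also have "\<dots> = (\<integral>s. Gamma \<mu> * (indicator {a<..<x} s *\<^sub>R (k' (x - s) * \<phi> s)) \<partial>lebesgue)"
  proof (rule integral_cong_AE[OF _ _ outer])
    show "(\<lambda>s. \<integral>t. ?F t s \<partial>lebesgue) \<in> borel_measurable lebesgue"
      by (rule borel_measurable_integrable[OF integrable_snd[OF F_int]])
    show "(\<lambda>s. Gamma \<mu> * (indicator {a<..<x} s *\<^sub>R (k' (x - s) * \<phi> s))) \<in> borel_measurable lebesgue"
      using int' unfolding set_integrable_def
      by (intro borel_measurable_times borel_measurable_const borel_measurable_integrable)
  qed
  also have "\<dots> = Gamma \<mu> * (LINT t:{a<..<x}|lebesgue. k' (x - t) * \<phi> t)"
    unfolding set_lebesgue_integral_def by (rule integral_mult_right_zero)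
  finally show ?thesis using \<open>Gamma \<mu> \<noteq> 0\<close> by simp
qed

section \<open>The Fox kernel and the composition formula\<close>

text \<open>A real part bounded below excludes the loop around the left-hand poles, along whose ends
  it tends to minus infinity; the other two shapes have been treated.\<close>

lemma fox_contour_separating:
  assumes L: "fox_contour L m n as bs" and bdd: "bdd_below (range (\<lambda>t. Re (L t)))"
    and posB: "\<And>j. j < m \<Longrightarrow> snd (bs ! j) > 0" and posA: "\<And>j. j < n \<Longrightarrow> snd (as ! j) > 0"
  shows "\<exists>C M \<eta>. separating_contour L C M \<eta> (right_poles m bs) (left_poles n as)"
    "\<exists>d. (\<forall>p\<in>right_poles m bs. Im p < d) \<and> rises L d"
    "\<exists>d. (\<forall>p\<in>right_poles m bs. Im p > d) \<and> rises (\<lambda>t. cnj (L (- t))) (- d)"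
proof -
  obtain \<eta> where pw: "\<And>T. L piecewise_C1_differentiable_on {- T..T}"
    and shape: "vertical_shape L \<or> right_loop_shape L \<eta> \<or> left_loop_shape L \<eta>"
    and right: "\<And>p. p \<in> right_poles m bs \<Longrightarrow> right_of_contour L \<eta> p"
    and left: "\<And>p. p \<in> left_poles n as \<Longrightarrow> left_of_contour L \<eta> p"
    using L unfolding fox_contour_def by blast
  note fin = finite_right_poles[of m bs, OF posB] finite_left_poles[of n as, OF posA]
  have "\<not> left_loop_shape L \<eta>"
  proof
    assume "left_loop_shape L \<eta>"
    then have "filterlim (\<lambda>t. Re (L t)) at_bot at_top" by (auto simp: left_loop_shape_def)
    moreover obtain B where "\<And>t. B \<le> Re (L t)" using bdd by (auto simp: bdd_below_def)
    ultimately show False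
      unfolding filterlim_at_bot_dense by (metis eventually_at_top_linorder not_le order_refl)
  qed
  then consider "vertical_shape L" | "right_loop_shape L \<eta>" using shape by blast
  then have "(\<exists>C M \<eta>. separating_contour L C M \<eta> (right_poles m bs) (left_poles n as)) \<and>
    (\<exists>d. (\<forall>p\<in>right_poles m bs. Im p < d) \<and> rises L d) \<and>
    (\<exists>d. (\<forall>p\<in>right_poles m bs. Im p > d) \<and> rises (\<lambda>t. cnj (L (- t))) (- d))"
  proof cases
    case 1
    obtain Y where "\<And>p. p \<in> right_poles m bs \<Longrightarrow> \<bar>Im p\<bar> \<le> Y"
      using right_poles_heights[of m bs] posB by blast
    from vertical_shape_separating[OF pw 1 fin this right left] show ?thesis by blast
  next
    case 2
    have "\<exists>p'\<in>right_poles m bs. Im p' = Im p \<and> x \<le> Re p'" if "p \<in> right_poles m bs" for p x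
      using right_poles_repeat[OF that] posB by blast
    from right_loop_shape_separating[OF pw 2 bdd fin this right left] show ?thesis by blast
  qed
  then show "\<exists>C M \<eta>. separating_contour L C M \<eta> (right_poles m bs) (left_poles n as)"
    "\<exists>d. (\<forall>p\<in>right_poles m bs. Im p < d) \<and> rises L d"
    "\<exists>d. (\<forall>p\<in>right_poles m bs. Im p > d) \<and> rises (\<lambda>t. cnj (L (- t))) (- d)"
    by blast+
qed

text \<open>In each progression of poles the leftmost one is the quotient of the pair, and the
  others only add a nonnegative real number to it.\<close>

lemma right_poles_Re_ge:
  assumes posB: "\<And>j. j < m \<Longrightarrow> snd (bs ! j) > 0" and alpha: "\<alpha> > 0" and p: "p \<in> right_poles m bs"
  shows "Re \<beta> + Min ((\<lambda>j. Re (of_real \<alpha> * fst (bs ! j) / of_real (snd (bs ! j)))) ` {..<m}) \<le> Re (\<beta> + of_real \<alpha> * p)"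
proof -
  obtain j k where j: "j < m" "p = (fst (bs ! j) + of_nat k) / of_real (snd (bs ! j))"
    using right_pole_cases[OF p] posB by blast
  have "Min ((\<lambda>j. Re (of_real \<alpha> * fst (bs ! j) / of_real (snd (bs ! j)))) ` {..<m}) \<le> Re (of_real \<alpha> * fst (bs ! j) / of_real (snd (bs ! j)))"
    using j(1) by (intro Min_le) auto
  also have "\<dots> = \<alpha> * (Re (fst (bs ! j)) / snd (bs ! j))" by (simp add: Re_divide_of_real)
  also have "\<dots> \<le> \<alpha> * Re p"
    using j(2) posB[OF j(1)] alpha by (intro mult_left_mono) (auto simp: Re_divide_of_real divide_right_mono)
  finally show ?thesis by simp
qed

text \<open>The contour integral is a parameter integral, measurable in u as soon as the part
  \<open>h\<close> of its integrand that is independent of u is measurable; convergence at a single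
  u gives the latter.\<close>

lemma fox_kernel_measurable:
  assumes w: "w \<noteq> 0" and alpha: "\<alpha> > 0" and X: "X > 0"
    and conv: "\<And>u. 0 < u \<Longrightarrow> u < X \<Longrightarrow> fox_H_convergent L m n as bs (w * of_real (u powr \<alpha>))"
    and cont: "continuous_on UNIV L"
  shows "(\<lambda>u. indicator {0<..<X} u *\<^sub>R fox_kernel L w m n \<alpha> as bs \<beta> u) \<in> borel_measurable borel"
proof -
  \<comment> \<open>The locale is entered only for its facts on powers: X/2 lies in the range of
    convergence, and the other values are arbitrary admissible ones.\<close>
  interpret Beta_transform "X / 2" 1 0 \<alpha> 1 by standard (use alpha X in auto)
  interpret lebesgue: sigma_finite_measure "lebesgue :: real measure" by (rule sigma_finite_lebesgue)
  define h where "h t = fox_integrand m n as bs (L t) * w powr L t * vector_derivative L (at t)" for t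
  have eq: "fox_integrand m n as bs (L t) * (w * of_real (u powr \<alpha>)) powr L t * vector_derivative L (at t) =
      h t * of_real u powr (of_real \<alpha> * L t)" if "u > 0" for u t
    using powr_split[OF that w] by (simp add: h_def)
  have L: "L \<in> borel_measurable lebesgue"
    by (intro measurable_completion) (simp add: borel_measurable_continuous_onI[OF cont])
  have "set_integrable lebesgue UNIV (\<lambda>t. h t * of_real (X / 2) powr (of_real \<alpha> * L t))"
    using conv[of "X / 2"] X unfolding fox_H_convergent_def by (simp add: eq)
  then have "(\<lambda>t. indicator UNIV t *\<^sub>R (h t * of_real (X / 2) powr (of_real \<alpha> * L t))) \<in> borel_measurable lebesgue"
    unfolding set_integrable_def by (rule borel_measurable_integrable)
  from measurable_indicator_powr[OF _ this] L have h: "h \<in> borel_measurable lebesgue" by simp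
  note h[measurable] L[measurable]
  have "(\<lambda>u. LINT t|lebesgue. h t * complex_of_real u powr (of_real \<alpha> * L t)) \<in> borel_measurable borel"
    by (rule lebesgue.borel_measurable_lebesgue_integral) measurable
  then have [measurable]: "(\<lambda>u. LINT t|lebesgue. h t * complex_of_real u powr (of_real \<alpha> * L t)) \<in> borel_measurable borel" .
  have "(\<lambda>u. indicator {0<..<X} u *\<^sub>R fox_kernel L w m n \<alpha> as bs \<beta> u) =
    (\<lambda>u. indicator {0<..<X} u *\<^sub>R (of_real u powr (\<beta> - 1) * (1 / (2 * of_real pi * \<i>) *
       (LINT t|lebesgue. h t * complex_of_real u powr (of_real \<alpha> * L t)))))"
    by (auto simp: fun_eq_iff indicator_def fox_kernel_def fox_H_def eq)
  also have "\<dots> \<in> borel_measurable borel" by measurable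
  finally show ?thesis .
qed

theorem fox_kernel_Beta_integral:
  fixes \<mu> \<beta> w :: complex and \<alpha> v X :: real
  assumes alpha: "\<alpha> > 0" and mu: "Re \<mu> > 0" and w: "w \<noteq> 0"
    and mn: "m \<le> length bs" "n \<le> length as"
    and posB: "\<And>j. j < m \<Longrightarrow> snd (bs ! j) > 0" and posA: "\<And>j. j < n \<Longrightarrow> snd (as ! j) > 0"
    and Min: "Re \<beta> + Min ((\<lambda>j. Re (of_real \<alpha> * fst (bs ! j) / of_real (snd (bs ! j)))) ` {..<m}) > 0"
    and L: "fox_contour L m n as bs" "bdd_below (range (\<lambda>t. Re (L t)))"
    and L': "fox_contour L' m (n + 1) ((1 - \<beta>, \<alpha>) # as) (bs @ [(1 - \<beta> - \<mu>, \<alpha>)])" "bdd_below (range (\<lambda>t. Re (L' t)))"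
    and conv: "\<And>u. 0 < u \<Longrightarrow> u < X \<Longrightarrow> fox_H_convergent L m n as bs (w * of_real (u powr \<alpha>))"
    and conv': "fox_H_convergent L' m (n + 1) ((1 - \<beta>, \<alpha>) # as) (bs @ [(1 - \<beta> - \<mu>, \<alpha>)]) (w * of_real (v powr \<alpha>))"
    and vX: "0 < v" "v < X"
    and int: "set_integrable lborel {0<..<v} (\<lambda>u. fox_kernel L w m n \<alpha> as bs \<beta> u * complex_of_real (v - u) powr (\<mu> - 1))"
  shows "(LINT u:{0<..<v}|lborel. fox_kernel L w m n \<alpha> as bs \<beta> u * complex_of_real (v - u) powr (\<mu> - 1)) =
    Gamma \<mu> * fox_kernel L' w m (n + 1) \<alpha> ((1 - \<beta>, \<alpha>) # as) (bs @ [(1 - \<beta> - \<mu>, \<alpha>)]) (\<beta> + \<mu>) v"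
proof -
  let ?as = "(1 - \<beta>, \<alpha>) # as" and ?bs = "bs @ [(1 - \<beta> - \<mu>, \<alpha>)]"
  let ?f = "fox_integrand m n as bs" and ?g = "fox_integrand m (n + 1) ?as ?bs"
  \<comment> \<open>A quarter of the positive lower bound of Re (\<beta> + \<alpha>p) over the
    right-hand poles p, as the margins 4\<delta> at the poles and 2\<delta> on the circles
    require.\<close>
  define \<delta> where "\<delta> = (Re \<beta> + Min ((\<lambda>j. Re (of_real \<alpha> * fst (bs ! j) / of_real (snd (bs ! j)))) ` {..<m})) / 4"
  have delta: "\<delta> > 0" using Min by (simp add: \<delta>_def)
  interpret Beta_transform v \<mu> \<beta> \<alpha> \<delta> by standard (use vX mu alpha delta in auto)
  have posB': "snd (?bs ! j) > 0" if "j < m" for j using posB[OF that] that mn by (simp add: nth_append)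
  have posA': "snd (?as ! j) > 0" if "j < n + 1" for j using posA alpha that by (cases j) auto
  have PR: "right_poles m ?bs = right_poles m bs" using mn by (intro right_poles_append)
  obtain C1 M1 \<eta>1 where sep1: "separating_contour L C1 M1 \<eta>1 (right_poles m bs) (left_poles n as)"
    using fox_contour_separating(1)[OF L posB posA] by blast
  obtain C2 M2 \<eta>2 where sep2: "separating_contour L' C2 M2 \<eta>2 (right_poles m bs) (left_poles (n + 1) ?as)"
    using fox_contour_separating(1)[OF L' posB' posA'] unfolding PR by blast
  obtain u1 where u1: "\<forall>p\<in>right_poles m bs. Im p < u1" "rises L u1"
    using fox_contour_separating(2)[OF L posB posA] by blast
  obtain u2 where u2: "\<forall>p\<in>right_poles m bs. Im p < u2" "rises L' u2"
    using fox_contour_separating(2)[OF L' posB' posA'] unfolding PR by blast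
  obtain l1 where l1: "\<forall>p\<in>right_poles m bs. Im p > l1" "rises (\<lambda>t. cnj (L (- t))) (- l1)"
    using fox_contour_separating(3)[OF L posB posA] by blast
  obtain l2 where l2: "\<forall>p\<in>right_poles m bs. Im p > l2" "rises (\<lambda>t. cnj (L' (- t))) (- l2)"
    using fox_contour_separating(3)[OF L' posB' posA'] unfolding PR by blast
  \<comment> \<open>Both upper tails must stay at or above this level and all right-hand poles
    strictly below it; the smaller of the two admissible levels satisfies both. The level
    \<open>dl'\<close> does the same for the reflected lower tails.\<close>
  define du' where "du' = min u1 u2"
  define dl' where "dl' = min (- l1) (- l2)"
  have ru: "rises L du'" "rises L' du'"
    using rises_mono[OF u1(2)] rises_mono[OF u2(2)] by (simp_all add: du'_def)
  have rl: "rises (\<lambda>t. cnj (L (- t))) dl'" "rises (\<lambda>t. cnj (L' (- t))) dl'"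
    using rises_mono[OF l1(2)] rises_mono[OF l2(2)] by (simp_all add: dl'_def)
  have hu: "1 * Im p < du'" if "p \<in> right_poles m ?bs" for p
    using that u1(1) u2(1) unfolding PR du'_def by simp
  have hl: "- 1 * Im p < dl'" if "p \<in> right_poles m ?bs" for p
    using that l1(1) l2(1) unfolding PR dl'_def by simp
  have "\<exists>du<du'. \<exists>c1 h1. \<forall>C c h. c1 \<le> c \<longrightarrow> h1 \<le> h \<longrightarrow>
    order_bounded ?g {z. Complex (Re z) (1 * Im z) \<in> upper_region C c h du} \<and>
    {z. Complex (Re z) (1 * Im z) \<in> upper_region C c h du} \<inter> (right_poles m ?bs \<union> left_poles (n + 1) ?as) = {}"
    by (rule fox_integrand_upper_region[OF posB' posA' disjI1[OF refl] hu])
  then obtain du c1 h1 where gu: "du < du'" "\<forall>C c h. c1 \<le> c \<longrightarrow> h1 \<le> h \<longrightarrow>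
    order_bounded ?g {z. Complex (Re z) (1 * Im z) \<in> upper_region C c h du} \<and>
    {z. Complex (Re z) (1 * Im z) \<in> upper_region C c h du} \<inter> (right_poles m ?bs \<union> left_poles (n + 1) ?as) = {}"
    by (elim exE conjE)
  have "\<exists>dl<dl'. \<exists>c2 h2. \<forall>C c h. c2 \<le> c \<longrightarrow> h2 \<le> h \<longrightarrow>
    order_bounded ?g {z. Complex (Re z) (- 1 * Im z) \<in> upper_region C c h dl} \<and>
    {z. Complex (Re z) (- 1 * Im z) \<in> upper_region C c h dl} \<inter> (right_poles m ?bs \<union> left_poles (n + 1) ?as) = {}"
    by (rule fox_integrand_upper_region[OF posB' posA' disjI2[OF refl] hl])
  then obtain dl c2 h2 where gl: "dl < dl'" "\<forall>C c h. c2 \<le> c \<longrightarrow> h2 \<le> h \<longrightarrow>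
    order_bounded ?g {z. Complex (Re z) (- 1 * Im z) \<in> upper_region C c h dl} \<and>
    {z. Complex (Re z) (- 1 * Im z) \<in> upper_region C c h dl} \<inter> (right_poles m ?bs \<union> left_poles (n + 1) ?as) = {}"
    by (elim exE conjE)
  have gu': "order_bounded ?g (upper_region C c h du) \<and> upper_region C c h du \<inter> (right_poles m bs \<union> left_poles (n + 1) ?as) = {}"
    if "max c1 c2 \<le> c" "max h1 h2 \<le> h" for C c h
    using gu(2)[rule_format, of c h C] that unfolding PR by simp
  have cnj_eq: "Complex (Re z) (- 1 * Im z) = cnj z" for z by (simp add: complex_eq_iff)
  have gl': "order_bounded ?g {z. cnj z \<in> upper_region C c h dl} \<and>
      {z. cnj z \<in> upper_region C c h dl} \<inter> (right_poles m bs \<union> left_poles (n + 1) ?as) = {}"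
    if "max c1 c2 \<le> c" "max h1 h2 \<le> h" for C c h
    using gl(2)[rule_format, of c h C] that unfolding PR cnj_eq by simp
  have fg: "?g \<xi> = ?f \<xi> * ratio (\<beta> + of_real \<alpha> * \<xi>)" for \<xi>
    using fox_integrand_Cons_append[OF mn] by (simp add: ratio_def)
  have g_hol: "?g holomorphic_on - (right_poles m bs \<union> left_poles (n + 1) ?as)"
    using holomorphic_fox_integrand[of m "n + 1" ?as ?bs] unfolding PR .
  have PRpos: "4 * \<delta> \<le> Re (\<beta> + of_real \<alpha> * p)" if "p \<in> right_poles m bs" for p
    using right_poles_Re_ge[OF posB alpha that, of \<beta>] by (simp add: \<delta>_def)
  let ?J = "\<lambda>u. LINT t|lebesgue. (?f (L t) * (w * of_real (u powr \<alpha>)) powr L t) * vector_derivative L (at t)"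
  let ?J' = "LINT t|lebesgue. (?g (L' t) * (w * of_real (v powr \<alpha>)) powr L' t) * vector_derivative L' (at t)"
  have k_eq: "fox_kernel L w m n \<alpha> as bs \<beta> u * complex_of_real (v - u) powr (\<mu> - 1) = 1 / (2 * of_real pi * \<i>) * (kernel 0 u * ?J u)" for u
    by (simp add: fox_kernel_def fox_H_def kernel_def)
  have kint: "set_integrable lborel {0<..<v} (\<lambda>u. kernel 0 u * ?J u)"
  proof -
    have "set_integrable lborel {0<..<v} (\<lambda>u. (2 * of_real pi * \<i>) * (fox_kernel L w m n \<alpha> as bs \<beta> u * complex_of_real (v - u) powr (\<mu> - 1)))"
      using int by (intro set_integrable_mult_right) auto
    then show ?thesis unfolding k_eq by (simp add: mult.assoc[symmetric])
  qed
  have "(LINT u:{0<..<v}|lborel. kernel 0 u * ?J u) = Gamma \<mu> * of_real v powr (\<beta> + \<mu> - 1) * ?J'"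
    using conv conv' unfolding fox_H_convergent_def
    by (intro Beta_integral_of_contour_integral[OF sep1 sep2 holomorphic_fox_integrand g_hol fg PRpos
          gu(1) ru gl(1) rl gu' gl' w vX(2) _ _ kint])
  then have "(LINT u:{0<..<v}|lborel. fox_kernel L w m n \<alpha> as bs \<beta> u * complex_of_real (v - u) powr (\<mu> - 1)) =
      1 / (2 * of_real pi * \<i>) * (Gamma \<mu> * of_real v powr (\<beta> + \<mu> - 1) * ?J')"
    unfolding k_eq by simp
  then show ?thesis by (simp add: fox_kernel_def fox_H_def mult_ac)
qed

theorem corollary1:
  fixes a x \<alpha> :: real
    and \<mu> \<beta> w :: complex
    and m n :: nat
    and as bs :: "(complex \<times> real) list"
    and L L' :: "real \<Rightarrow> complex"
    and \<phi> :: "real \<Rightarrow> complex"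
  assumes "a < x" and "\<alpha> > 0"
    and "Re \<mu> > 0" and "Re \<beta> > 0" and "w \<noteq> 0"
    and "1 \<le> m" and "m \<le> length bs" and "n \<le> length as"
    and "\<forall>(c, A)\<in>set as. A > 0" and "\<forall>(d, B)\<in>set bs. B > 0"
    and "Re \<beta> + Min ((\<lambda>j. Re (of_real \<alpha> * fst (bs ! j) / of_real (snd (bs ! j)))) ` {..<m}) > 0"
    and "right_poles m bs \<inter> left_poles n as = {}"
    \<comment> \<open>the contours of the \<open>H\<close>-functions on the left-hand and on the right-hand side\<close>
    and "fox_contour L m n as bs"
    and "fox_contour L' m (n + 1) ((1 - \<beta>, \<alpha>) # as) (bs @ [(1 - \<beta> - \<mu>, \<alpha>)])"
    \<comment> \<open>this excludes only loops around the left-hand poles, for which the identity fails\<close>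
    and "bdd_below (range (\<lambda>t. Re (L t)))" and "bdd_below (range (\<lambda>t. Re (L' t)))"
    \<comment> \<open>absolute convergence of the contour integrals\<close>
    and "\<forall>t\<in>{a<..<x}. fox_H_convergent L m n as bs (w * of_real ((x - t) powr \<alpha>))"
    and "\<forall>t\<in>{a<..<x}. fox_H_convergent L' m (n + 1) ((1 - \<beta>, \<alpha>) # as)
           (bs @ [(1 - \<beta> - \<mu>, \<alpha>)]) (w * of_real ((x - t) powr \<alpha>))"
    \<comment> \<open>absolute convergence of the iterated integral on the left and of the integral on the right\<close>
    and "\<phi> absolutely_integrable_on {a<..<x}"
    and "(\<lambda>t. norm (fox_kernel L w m n \<alpha> as bs \<beta> (x - t)) *
           (LINT s:{a<..<t}|lebesgue. norm (\<phi> s / of_real (t - s) powr (1 - \<mu>))))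
         absolutely_integrable_on {a<..<x}"
    and "(\<lambda>t. fox_kernel L' w m (n + 1) \<alpha> ((1 - \<beta>, \<alpha>) # as) (bs @ [(1 - \<beta> - \<mu>, \<alpha>)]) (\<beta> + \<mu>) (x - t) * \<phi> t)
         absolutely_integrable_on {a<..<x}"
  shows "fox_operator L w m n \<alpha> a as bs \<beta> (frac_integral a \<mu> \<phi>) x =
         fox_operator L' w m (n + 1) \<alpha> a ((1 - \<beta>, \<alpha>) # as) (bs @ [(1 - \<beta> - \<mu>, \<alpha>)]) (\<beta> + \<mu>) \<phi> x"
  unfolding fox_operator_def
proof (rule convolution_frac_integral[OF \<open>Re \<mu> > 0\<close> \<open>a < x\<close> _ _ assms(19,20,21)])
  have posB: "snd (bs ! j) > 0" if "j < m" for j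
    using assms(7,10) that nth_mem[of j bs] by (cases "bs ! j") fastforce
  have posA: "snd (as ! j) > 0" if "j < n" for j
    using assms(8,9) that nth_mem[of j as] by (cases "as ! j") fastforce
  have conv: "fox_H_convergent L m n as bs (w * of_real (u powr \<alpha>))" if "0 < u" "u < x - a" for u
    using bspec[OF assms(17), of "x - u"] that by simp
  have conv': "fox_H_convergent L' m (n + 1) ((1 - \<beta>, \<alpha>) # as) (bs @ [(1 - \<beta> - \<mu>, \<alpha>)]) (w * of_real (u powr \<alpha>))"
    if "0 < u" "u < x - a" for u
    using bspec[OF assms(18), of "x - u"] that by simp
  obtain C M \<eta> where sep: "separating_contour L C M \<eta> (right_poles m bs) (left_poles n as)"
    using fox_contour_separating(1)[OF assms(13,15) posB posA] by blast
  then have "continuous_on UNIV L"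
    by (intro escaping_contour.continuous_L) (rule separating_contour.axioms(1))
  then show "(\<lambda>u. indicator {0<..<x - a} u *\<^sub>R fox_kernel L w m n \<alpha> as bs \<beta> u) \<in> borel_measurable borel"
    using \<open>a < x\<close> by (intro fox_kernel_measurable[OF \<open>w \<noteq> 0\<close> \<open>\<alpha> > 0\<close> _ conv]) auto
  fix v assume v: "0 < v" "v < x - a"
    and "set_integrable lborel {0<..<v} (\<lambda>u. fox_kernel L w m n \<alpha> as bs \<beta> u * complex_of_real (v - u) powr (\<mu> - 1))"
  then show "(LINT u:{0<..<v}|lborel. fox_kernel L w m n \<alpha> as bs \<beta> u * complex_of_real (v - u) powr (\<mu> - 1)) =
    Gamma \<mu> * fox_kernel L' w m (n + 1) \<alpha> ((1 - \<beta>, \<alpha>) # as) (bs @ [(1 - \<beta> - \<mu>, \<alpha>)]) (\<beta> + \<mu>) v"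
    by (intro fox_kernel_Beta_integral[OF assms(2,3,5,7,8) posB posA assms(11,13,15,14,16) conv conv'[OF v] v])
qed

end
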